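(* Let $\mathbb{K}\in\{\mathbb{R},\mathbb{C}\}$ and let $(E,*,\{M_n(E)_+\}_n,e)$ be a complete unital operator system over $\mathbb{K}$. Let $S$ be the set of integers $n\ge 1$ for which the order unit space $(M_n(E)_{sa},M_n(E)_+,I_n)$, where $I_n$ stands for $e\otimes I_n$, admits a compatible JB-algebra structure (necessarily unique). (1) If $1\le m<n$ and $n\in S$, then $m\in S$. (2) Suppose $S$ contains an integer $n$ with $n\ge 2$ if $\mathbb{K}=\mathbb{C}$ and $n\ge 4$ if $\mathbb{K}=\mathbb{R}$. Then there exist a unital C*-algebra $A$ over $\mathbb{K}$ and a unital $*$-isomorphism $\phi\colon A\to E$ such that $\phi_m\colon M_m(A)_{sa}\to M_m(E)_{sa}$ is a JB-algebra isomorphism for all $m\in S$.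
   Context: Order unit spaces. An order unit space is a triple $(V,V_+,v)$ where $V$ is a real vector space partially ordered by the cone $V_+$ and $v\in V_+$ is an order unit (for every $x\in V$ there is $\lambda\ge 0$ with $x\le\lambda v$) that is Archimedean ($x\le\lambda v$ for all $\lambda>0$ implies $x\le 0$). JB-algebras. A real Jordan algebra is a real vector space with a commutative bilinear product $\circ$ satisfying $a\circ(b\circ a^2)=(a\circ b)\circ a^2$. A JB-algebra is a real Jordan algebra complete for a norm with $\|a\circ b\|\le\|a\|\|b\|$, $\|a^2\|=\|a\|^2$, $\|a^2\|\le\|a^2+b^2\|$. A compatible JB-algebra structure on an order unit space $(V,V_+,v)$ is a JB-algebra structure on $V$ for which $v$ is an identity element and $V_+=\{x^2:x\in V\}$; at most one exists. Operator systems. For a $\mathbb{K}$-vector space $E$ with a (conjugate-)linear involution $*$, put $(x^* )_{ij}=(x_{ji})^*$ on $M_n(E)$ and $M_n(E)_{sa}=\{x\in M_n(E):x=x^*\}$. A (unital) operator system over $\mathbb{K}$ is a quadruple $(E,*,\{M_n(E)_+\}_n,e)$ with $E$ a $\mathbb{K}$-vector space, $*$ an involution on $E$, cones $M_n(E)_+\subset M_n(E)_{sa}$ and $e\in E$ such that $a^*\cdot M_m(E)_+\cdot a\subset M_n(E)_+$ for all $a\in M_{m,n}(\mathbb{K})$ and $e\otimes I_n$ is an Archimedean order unit of $(M_n(E)_{sa},M_n(E)_+)$ for all $m,n\ge 1$. The norm on $E$ is the one induced by any unital complete order embedding $E\to B(H)$ ($H$ a Hilbert space over $\mathbb{K}$),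 equivalently $\|x\|=\inf\{\lambda\ge0:\begin{pmatrix}\lambda e & x \\ x^* & \lambda e\end{pmatrix}\in M_2(E)_+\}$; $E$ is complete if it is complete in this norm. A real C*-algebra is a real associative $*$-algebra complete for a norm with $\|ab\|\le\|a\|\|b\|$, $\|a^*a\|=\|a\|^2$ and $\|a^*a\|\le\|a^*a+b^*b\|$ for all $a,b$. For a C*-algebra $A$ over $\mathbb{K}$, $M_m(A)$ is a C*-algebra over $\mathbb{K}$ and $M_m(A)_{sa}$ is a JB-algebra with product $x\circ y=\frac12(xy+yx)$. A unital $*$-isomorphism $\phi\colon A\to E$ here means a bijective $\mathbb{K}$-linear map with $\phi(1_A)=e$ and $\phi(x^* )=\phi(x)^*$; $\phi_m$ denotes its entrywise application to matrices. For $m\in S$, $M_m(E)_{sa}$ carries its compatible JB-algebra structure. *)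

theory Defs
  imports Complex_Main "HOL-Library.Function_Algebras"
begin

text \<open>
  Carrier sets are subspaces of an ambient type: a matrix is a function on pairs of indices, and
  \<open>M\<^sub>n(E)\<close> consists of the functions vanishing outside \<open>{0..<n} \<times> {0..<n}\<close>. Addition of matrices is
  the pointwise addition of functions.
\<close>

section \<open>Norms\<close>

definition norm_on ::
  "('k::real_normed_field \<Rightarrow> 'v::ab_group_add \<Rightarrow> 'v) \<Rightarrow> 'v set \<Rightarrow> ('v \<Rightarrow> real) \<Rightarrow> bool" where
  "norm_on scale V N \<longleftrightarrow>
     (\<forall>x\<in>V. 0 \<le> N x \<and> (N x = 0 \<longleftrightarrow> x = 0)) \<and>
     (\<forall>x\<in>V. \<forall>y\<in>V. N (x + y) \<le> N x + N y) \<and>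
     (\<forall>c. \<forall>x\<in>V. N (scale c x) = norm c * N x)"

definition complete_on :: "'v::ab_group_add set \<Rightarrow> ('v \<Rightarrow> real) \<Rightarrow> bool" where
  "complete_on V N \<longleftrightarrow>
     (\<forall>X :: nat \<Rightarrow> 'v. range X \<subseteq> V \<longrightarrow>
        (\<forall>\<epsilon>>0. \<exists>M. \<forall>m\<ge>M. \<forall>n\<ge>M. N (X m - X n) < \<epsilon>) \<longrightarrow>
        (\<exists>l\<in>V. (\<lambda>n. N (X n - l)) \<longlonglongrightarrow> 0))"

section \<open>Order unit spaces and JB-algebras\<close>

locale order_unit_space = vector_space scale
  for scale :: "real \<Rightarrow> 'v::ab_group_add \<Rightarrow> 'v" +
  fixes V :: "'v set" and C :: "'v set" and v :: 'v
  assumes subspace_V: "subspace V"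
    and cone_subset: "C \<subseteq> V"
    and cone_zero: "0 \<in> C"
    and cone_add: "\<lbrakk>x \<in> C; y \<in> C\<rbrakk> \<Longrightarrow> x + y \<in> C"
    and cone_scale: "\<lbrakk>0 \<le> r; x \<in> C\<rbrakk> \<Longrightarrow> scale r x \<in> C"
    and cone_proper: "\<lbrakk>x \<in> C; - x \<in> C\<rbrakk> \<Longrightarrow> x = 0"
    and unit_pos: "v \<in> C"
    and order_unit: "x \<in> V \<Longrightarrow> \<exists>r\<ge>0. scale r v - x \<in> C"
    and archimedean: "\<lbrakk>x \<in> V; \<And>r. 0 < r \<Longrightarrow> scale r v - x \<in> C\<rbrakk> \<Longrightarrow> - x \<in> C"

locale real_jordan_algebra = vector_space scale
  for scale :: "real \<Rightarrow> 'v::ab_group_add \<Rightarrow> 'v" +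
  fixes V :: "'v set" and jp :: "'v \<Rightarrow> 'v \<Rightarrow> 'v"
  assumes subspace_V: "subspace V"
    and jp_closed: "\<lbrakk>a \<in> V; b \<in> V\<rbrakk> \<Longrightarrow> jp a b \<in> V"
    and jp_commute: "\<lbrakk>a \<in> V; b \<in> V\<rbrakk> \<Longrightarrow> jp a b = jp b a"
    and jp_add: "\<lbrakk>a \<in> V; b \<in> V; c \<in> V\<rbrakk> \<Longrightarrow> jp (a + b) c = jp a c + jp b c"
    and jp_scale: "\<lbrakk>a \<in> V; b \<in> V\<rbrakk> \<Longrightarrow> jp (scale r a) b = scale r (jp a b)"
    and jordan_identity:
      "\<lbrakk>a \<in> V; b \<in> V\<rbrakk> \<Longrightarrow> jp a (jp b (jp a a)) = jp (jp a b) (jp a a)"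

definition jb_algebra ::
  "(real \<Rightarrow> 'v::ab_group_add \<Rightarrow> 'v) \<Rightarrow> 'v set \<Rightarrow> ('v \<Rightarrow> 'v \<Rightarrow> 'v) \<Rightarrow> bool" where
  "jb_algebra scale V jp \<longleftrightarrow> real_jordan_algebra scale V jp \<and>
     (\<exists>N. norm_on scale V N \<and> complete_on V N \<and>
        (\<forall>a\<in>V. \<forall>b\<in>V. N (jp a b) \<le> N a * N b) \<and>
        (\<forall>a\<in>V. N (jp a a) = (N a)\<^sup>2) \<and>
        (\<forall>a\<in>V. \<forall>b\<in>V. N (jp a a) \<le> N (jp a a + jp b b)))"

definition compatible_jb ::
  "(real \<Rightarrow> 'v::ab_group_add \<Rightarrow> 'v) \<Rightarrow> 'v set \<Rightarrow> 'v set \<Rightarrow> 'v \<Rightarrow> ('v \<Rightarrow> 'v \<Rightarrow> 'v) \<Rightarrow> bool" where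
  "compatible_jb scale V C v jp \<longleftrightarrow> jb_algebra scale V jp \<and>
     v \<in> V \<and> (\<forall>x\<in>V. jp v x = x) \<and> C = {jp x x | x. x \<in> V}"

text \<open>No norm appears below because the norm of a JB-algebra is determined by its product.\<close>

definition jb_iso ::
  "(real \<Rightarrow> 'v::ab_group_add \<Rightarrow> 'v) \<Rightarrow> 'v set \<Rightarrow> ('v \<Rightarrow> 'v \<Rightarrow> 'v) \<Rightarrow>
   (real \<Rightarrow> 'w::ab_group_add \<Rightarrow> 'w) \<Rightarrow> 'w set \<Rightarrow> ('w \<Rightarrow> 'w \<Rightarrow> 'w) \<Rightarrow> ('v \<Rightarrow> 'w) \<Rightarrow> bool" where
  "jb_iso scale\<^sub>1 V jp\<^sub>1 scale\<^sub>2 W jp\<^sub>2 f \<longleftrightarrow>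
     jb_algebra scale\<^sub>1 V jp\<^sub>1 \<and> jb_algebra scale\<^sub>2 W jp\<^sub>2 \<and> bij_betw f V W \<and>
     (\<forall>x\<in>V. \<forall>y\<in>V. f (x + y) = f x + f y) \<and>
     (\<forall>r. \<forall>x\<in>V. f (scale\<^sub>1 r x) = scale\<^sub>2 r (f x)) \<and>
     (\<forall>x\<in>V. \<forall>y\<in>V. f (jp\<^sub>1 x y) = jp\<^sub>2 (f x) (f y))"

section \<open>Matrices\<close>

type_synonym 'e matrix = "nat \<Rightarrow> nat \<Rightarrow> 'e"

definition mat :: "nat \<Rightarrow> 'e::zero matrix \<Rightarrow> 'e matrix" where
  "mat n x = (\<lambda>i j. if i < n \<and> j < n then x i j else 0)"

definition mats :: "nat \<Rightarrow> 'e::zero matrix set" where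
  "mats n = {x. \<forall>i j. n \<le> i \<or> n \<le> j \<longrightarrow> x i j = 0}"

definition mat_star :: "('e \<Rightarrow> 'e) \<Rightarrow> 'e matrix \<Rightarrow> 'e matrix" where
  "mat_star star x = (\<lambda>i j. star (x j i))"

definition sa_mats :: "('e::zero \<Rightarrow> 'e) \<Rightarrow> nat \<Rightarrow> 'e matrix set" where
  "sa_mats star n = {x \<in> mats n. mat_star star x = x}"

definition mat_rscale ::
  "('k::real_normed_field \<Rightarrow> 'e \<Rightarrow> 'e) \<Rightarrow> real \<Rightarrow> 'e matrix \<Rightarrow> 'e matrix" where
  "mat_rscale scale r x = (\<lambda>i j. scale (of_real r) (x i j))"

definition diag_mat :: "'e::zero \<Rightarrow> nat \<Rightarrow> 'e matrix" where
  "diag_mat e n = mat n (\<lambda>i j. if i = j then e else 0)"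

text \<open>The product \<open>a\<^sup>* \<cdot> x \<cdot> a\<close>, where only the entries of \<open>a\<close> with indices in
  \<open>{0..<m} \<times> {0..<n}\<close> are used.\<close>

definition compress ::
  "('k::real_normed_field \<Rightarrow> 'e::ab_group_add \<Rightarrow> 'e) \<Rightarrow> ('k \<Rightarrow> 'k) \<Rightarrow>
   nat \<Rightarrow> nat \<Rightarrow> 'k matrix \<Rightarrow> 'e matrix \<Rightarrow> 'e matrix" where
  "compress scale kconj m n a x =
     mat n (\<lambda>i j. \<Sum>k<m. \<Sum>l<m. scale (kconj (a k i) * a l j) (x k l))"

definition mat_mult ::
  "('a::ab_group_add \<Rightarrow> 'a \<Rightarrow> 'a) \<Rightarrow> nat \<Rightarrow> 'a matrix \<Rightarrow> 'a matrix \<Rightarrow> 'a matrix" where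
  "mat_mult mult m x y = mat m (\<lambda>i j. \<Sum>k<m. mult (x i k) (y k j))"

definition mat_jordan ::
  "('k::real_normed_field \<Rightarrow> 'a::ab_group_add \<Rightarrow> 'a) \<Rightarrow> ('a \<Rightarrow> 'a \<Rightarrow> 'a) \<Rightarrow>
   nat \<Rightarrow> 'a matrix \<Rightarrow> 'a matrix \<Rightarrow> 'a matrix" where
  "mat_jordan scale mult m x y =
     mat_rscale scale (1 / 2) (mat_mult mult m x y + mat_mult mult m y x)"

definition mat_map :: "('a \<Rightarrow> 'b) \<Rightarrow> 'a matrix \<Rightarrow> 'b matrix" where
  "mat_map \<phi> x = (\<lambda>i j. \<phi> (x i j))"

section \<open>Operator systems\<close>

text \<open>The scalar field is \<open>\<real>\<close> with \<open>kconj = id\<close> or \<open>\<complex>\<close> with \<open>kconj = cnj\<close>.\<close>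

locale operator_system = vector_space scale
  for scale :: "'k::real_normed_field \<Rightarrow> 'e::ab_group_add \<Rightarrow> 'e" +
  fixes kconj :: "'k \<Rightarrow> 'k"
    and star :: "'e \<Rightarrow> 'e"
    and pos :: "nat \<Rightarrow> 'e matrix set"
    and e :: 'e
  assumes star_add: "star (x + y) = star x + star y"
    and star_scale: "star (scale c x) = scale (kconj c) (star x)"
    and star_star: "star (star x) = x"
    and pos_compress:
      "\<lbrakk>1 \<le> m; 1 \<le> n; z \<in> pos m\<rbrakk> \<Longrightarrow> compress scale kconj m n b z \<in> pos n"
    and order_unit_level:
      "1 \<le> n \<Longrightarrow> order_unit_space (mat_rscale scale) (sa_mats star n) (pos n) (diag_mat e n)"

definition opsys_norm ::
  "('k::real_normed_field \<Rightarrow> 'e::ab_group_add \<Rightarrow> 'e) \<Rightarrow> ('e \<Rightarrow> 'e) \<Rightarrow>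
   (nat \<Rightarrow> 'e matrix set) \<Rightarrow> 'e \<Rightarrow> 'e \<Rightarrow> real" where
  "opsys_norm scale star pos e x =
     Inf {r. 0 \<le> r \<and>
       mat 2 (\<lambda>i j. if i = j then scale (of_real r) e else if i < j then x else star x) \<in> pos 2}"

definition complete_operator_system ::
  "('k::real_normed_field \<Rightarrow> 'e::ab_group_add \<Rightarrow> 'e) \<Rightarrow> ('k \<Rightarrow> 'k) \<Rightarrow> ('e \<Rightarrow> 'e) \<Rightarrow>
   (nat \<Rightarrow> 'e matrix set) \<Rightarrow> 'e \<Rightarrow> bool" where
  "complete_operator_system scale kconj star pos e \<longleftrightarrow>
     operator_system scale kconj star pos e \<and> complete_on UNIV (opsys_norm scale star pos e)"

definition jb_levels ::
  "('k::real_normed_field \<Rightarrow> 'e::ab_group_add \<Rightarrow> 'e) \<Rightarrow> ('e \<Rightarrow> 'e) \<Rightarrow>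
   (nat \<Rightarrow> 'e matrix set) \<Rightarrow> 'e \<Rightarrow> nat set" where
  "jb_levels scale star pos e =
     {n. 1 \<le> n \<and>
       (\<exists>jp. compatible_jb (mat_rscale scale) (sa_mats star n) (pos n) (diag_mat e n) jp)}"

section \<open>C*-algebras\<close>

text \<open>
  A C*-algebra is carried by a whole additive type. An algebra \<open>A\<close> for which a linear bijection
  \<open>A \<rightarrow> E\<close> exists can, by transport of structure, be carried by the type of \<open>E\<close>.
\<close>

locale unital_cstar_algebra = vector_space scale
  for scale :: "'k::real_normed_field \<Rightarrow> 'a::ab_group_add \<Rightarrow> 'a" +
  fixes kconj :: "'k \<Rightarrow> 'k"
    and mult :: "'a \<Rightarrow> 'a \<Rightarrow> 'a"
    and one :: 'a
    and star :: "'a \<Rightarrow> 'a"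
    and N :: "'a \<Rightarrow> real"
  assumes mult_assoc: "mult (mult a b) c = mult a (mult b c)"
    and mult_add_left: "mult (a + b) c = mult a c + mult b c"
    and mult_add_right: "mult a (b + c) = mult a b + mult a c"
    and mult_scale_left: "mult (scale r a) b = scale r (mult a b)"
    and mult_scale_right: "mult a (scale r b) = scale r (mult a b)"
    and one_mult: "mult one a = a"
    and mult_one: "mult a one = a"
    and star_add: "star (a + b) = star a + star b"
    and star_scale: "star (scale r a) = scale (kconj r) (star a)"
    and star_star: "star (star a) = a"
    and star_mult: "star (mult a b) = mult (star b) (star a)"
    and norm_N: "norm_on scale UNIV N"
    and complete_N: "complete_on UNIV N"
    and N_mult: "N (mult a b) \<le> N a * N b"
    and N_cstar: "N (mult (star a) a) = (N a)\<^sup>2"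

text \<open>The last axiom below holds automatically over \<open>\<complex>\<close>, but not over \<open>\<real>\<close>.\<close>

locale unital_real_cstar_algebra =
  unital_cstar_algebra scale "\<lambda>c. c" mult one star N
  for scale :: "real \<Rightarrow> 'a::ab_group_add \<Rightarrow> 'a" and mult one star N +
  assumes N_sum: "N (mult (star a) a) \<le> N (mult (star a) a + mult (star b) b)"

definition unital_star_iso ::
  "('k::real_normed_field \<Rightarrow> 'a::ab_group_add \<Rightarrow> 'a) \<Rightarrow> 'a \<Rightarrow> ('a \<Rightarrow> 'a) \<Rightarrow>
   ('k \<Rightarrow> 'e::ab_group_add \<Rightarrow> 'e) \<Rightarrow> 'e \<Rightarrow> ('e \<Rightarrow> 'e) \<Rightarrow> ('a \<Rightarrow> 'e) \<Rightarrow> bool" where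
  "unital_star_iso scaleA oneA starA scale e star \<phi> \<longleftrightarrow>
     bij \<phi> \<and> Vector_Spaces.linear scaleA scale \<phi> \<and> \<phi> oneA = e \<and>
     (\<forall>x. \<phi> (starA x) = star (\<phi> x))"

end

theory Submission imports Defs begin

text \<open>
  A compatible JB-product is determined by the order: the difference \<open>B\<close> of two such products
  satisfies \<open>N z \<le> N (z + B b z)\<close>, so the even vector field \<open>y \<mapsto> B y y - B a a\<close>, which vanishes
  at \<open>\<plusminus>a\<close>, has an isometric flow. As in Vaisala's proof of the Mazur--Ulam theorem, the orbit of
  \<open>0\<close> is bounded but doubles its norm whenever the time doubles, hence it is constant and \<open>B a a = 0\<close>.
  Consequently unitary scalar matrices act on \<open>M\<^sub>n(E)\<close> by Jordan automorphisms.

  A scalar projection \<open>q\<close> is idempotent for the JB-product, and its Peirce projections are the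
  compressions by \<open>q\<close> and \<open>1 - q\<close>; in particular a corner of \<open>M\<^sub>n(E)\<close> is again a JB-algebra, which is
  part (1). For part (2) the Peirce spaces provide a product on \<open>E\<close>: the Jordan product of
  \<open>a\<close> at \<open>(0, 1)\<close> and \<open>b\<close> at \<open>(1, 2)\<close> in the real case, that of a self-adjoint \<open>a\<close> at \<open>(0, 0)\<close> and
  \<open>b\<close> at \<open>(0, 1)\<close> in the complex case. Associativity expresses that left and right
  multiplications come from elements of orthogonal Peirce spaces, which operator-commute.
\<close>

section \<open>Jordan algebras\<close>

text \<open>The axioms of a JB-product show no link with matrix multiplication. Uniqueness supplies
  the only one: a scalar symmetry of the matrix order must preserve \<open>jp\<close>. Uniqueness
  itself is reached without spectral theory or states: \<open>square_shift_bound\<close> plays the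
  role of the Cauchy-Schwarz inequality at a norming functional, and the flow is replaced by
  finitely many Euler steps, so that neither a dual space nor a differential equation occurs. The
  thresholds 2 and 4 come from the places where an element can stand. Over the complex numbers,
  linearity and phases reduce everything to self-adjoint elements, which fit on the diagonal. Over
  the reals a skew element fits only off the diagonal: a product then occupies three indices and a
  triple product four. The algebra is \<open>'e\<close> itself with a new multiplication, and the
  isomorphism is the identity. The remaining issue in (2) is that one multiplication has to serve
  every level, including those above the level from which it was built.\<close>

context real_jordan_algebra
begin

lemmas V_closed [simp] = subspace_add [OF subspace_V] subspace_diff [OF subspace_V]
  subspace_scale [OF subspace_V] subspace_neg [OF subspace_V] subspace_0 [OF subspace_V] jp_closed

lemma jp_add_right: "a \<in> V \<Longrightarrow> b \<in> V \<Longrightarrow> c \<in> V \<Longrightarrow> jp c (a + b) = jp c a + jp c b"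
  by (metis jp_add jp_commute V_closed(1))

lemma jp_scale_right: "a \<in> V \<Longrightarrow> b \<in> V \<Longrightarrow> jp a (scale r b) = scale r (jp a b)"
  by (metis jp_scale jp_commute V_closed(3))

lemma jp_minus: "a \<in> V \<Longrightarrow> b \<in> V \<Longrightarrow> jp (- a) b = - jp a b"
  using jp_scale[of a b "-1"] by simp

lemma jp_minus_right: "a \<in> V \<Longrightarrow> b \<in> V \<Longrightarrow> jp a (- b) = - jp a b"
  using jp_scale_right[of a b "-1"] by simp

lemma jp_diff: "a \<in> V \<Longrightarrow> b \<in> V \<Longrightarrow> c \<in> V \<Longrightarrow> jp (a - b) c = jp a c - jp b c"
  using jp_add[of a "-b" c] by (simp add: jp_minus)

lemma jp_diff_right: "a \<in> V \<Longrightarrow> b \<in> V \<Longrightarrow> c \<in> V \<Longrightarrow> jp c (a - b) = jp c a - jp c b"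
  using jp_add_right[of a "-b" c] by (simp add: jp_minus_right)

lemma jp_zero [simp]: "a \<in> V \<Longrightarrow> jp 0 a = 0" "a \<in> V \<Longrightarrow> jp a 0 = 0"
  using jp_scale[of a a 0] jp_scale_right[of a a 0] by simp_all

lemmas jp_bilinear = jp_add jp_add_right jp_diff jp_diff_right jp_minus jp_minus_right
  jp_scale jp_scale_right

lemma double_eq_0: "x + x = 0 \<Longrightarrow> x = (0::'v)"
proof -
  assume "x + x = 0"
  then have "scale 2 x = 0" using scale_left_distrib[of 1 1 x] by simp
  then show ?thesis by simp
qed

lemma double_eqD: "x + x = y + y \<Longrightarrow> x = (y::'v)"
  using double_eq_0[of "x - y"] by (simp add: algebra_simps)

text \<open>The Jordan identity says that the cubic form \<open>T x x x\<close> below vanishes, hence so does its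
  polarization.\<close>

lemma jordan_linearized:
  assumes "a \<in> V" "b \<in> V" "c \<in> V" "d \<in> V"
  shows "jp (jp (jp a c) b) d + jp (jp (jp a d) b) c + jp (jp (jp c d) b) a =
         jp (jp a c) (jp b d) + jp (jp a d) (jp b c) + jp (jp c d) (jp b a)"
proof -
  define T where "T x y z = jp (jp (jp x y) b) z - jp (jp x y) (jp b z)" for x y z
  have T0: "T x x x = 0" if "x \<in> V" for x
  proof -
    have "jp x (jp b (jp x x)) = jp (jp (jp x x) b) x"
      using that assms jp_commute[of x "jp b (jp x x)"] jp_commute[of b "jp x x"] by simp
    moreover have "jp (jp x b) (jp x x) = jp (jp x x) (jp b x)"
      using that assms jp_commute[of "jp x b" "jp x x"] jp_commute[of b x] by simp
    ultimately show ?thesis using jordan_identity[of x b] that assms by (simp add: T_def)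
  qed
  have Tc: "T x y z = T y x z" if "x \<in> V" "y \<in> V" for x y z
    using that by (simp add: T_def jp_commute[of x y])
  have Ta: "T (x + x') y z = T x y z + T x' y z" "T y (x + x') z = T y x z + T y x' z"
    "T y z (x + x') = T y z x + T y z x'" "T (- x) y z = - T x y z" "T y (- x) z = - T y x z"
    "T y z (- x) = - T y z x"
    if "x \<in> V" "x' \<in> V" "y \<in> V" "z \<in> V" for x x' y z
    using that assms by (simp_all add: T_def jp_bilinear)
  have T2: "T x x y + T x y x + T x y x = 0" if "x \<in> V" "y \<in> V" for x y
  proof -
    \<comment> \<open>The two signs of \<open>y\<close> separate the part linear in \<open>y\<close>
      from the quadratic part.\<close>
    have "T (x + y) (x + y) (x + y) = 0" "T (x + - y) (x + - y) (x + - y) = 0"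
      using that by (auto intro: T0)
    then have "(T x x y + T x y x + T x y x) + (T y y x + T x y y + T x y y) = 0"
      "(T y y x + T x y y + T x y y) - (T x x y + T x y x + T x y x) = 0"
      using that T0[OF that(1)] T0[OF that(2)]
      by (simp_all add: Ta Tc[of y x] del: add_uminus_conv_diff) (simp_all add: algebra_simps)
    then have "(T x x y + T x y x + T x y x) + (T x x y + T x y x + T x y x) = 0"
      by (metis add.commute eq_iff_diff_eq_0)
    then show ?thesis by (rule double_eq_0)
  qed
  \<comment> \<open>Second polarization, now of the argument that still occurs twice.\<close>
  have "T (a + c) (a + c) d + T (a + c) d (a + c) + T (a + c) d (a + c) = 0"
    using assms by (simp add: T2)
  then have "(T a a d + T a d a + T a d a) + (T c c d + T c d c + T c d c)
     + ((T a c d + T a d c + T c d a) + (T a c d + T a d c + T c d a)) = 0"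
    using assms by (simp add: Ta Tc[of c a] algebra_simps)
  then have "(T a c d + T a d c + T c d a) + (T a c d + T a d c + T c d a) = 0"
    using assms by (simp add: T2)
  then have "T a c d + T a d c + T c d a = 0" by (rule double_eq_0)
  then show ?thesis by (simp add: T_def algebra_simps)
qed

end

section \<open>Powers of one element and the associative subalgebra they span\<close>

locale unital_jordan_algebra = real_jordan_algebra scale V jp
  for scale :: "real \<Rightarrow> 'v::ab_group_add \<Rightarrow> 'v" and V jp +
  fixes u :: 'v
  assumes u_in [simp]: "u \<in> V"
    and u_jp [simp]: "x \<in> V \<Longrightarrow> jp u x = x"
begin

lemma jp_u [simp]: "x \<in> V \<Longrightarrow> jp x u = x"
  by (simp add: jp_commute[of x u])

primrec pw :: "'v \<Rightarrow> nat \<Rightarrow> 'v" where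
  "pw x 0 = u"
| "pw x (Suc n) = jp x (pw x n)"

lemma pw_in [simp]: "x \<in> V \<Longrightarrow> pw x n \<in> V"
  by (induction n) simp_all

text \<open>In total degree \<open>n\<close> the linearized identity at x, x^l, x^k, x becomes a
  linear recursion for \<open>f k\<close>, because the products of lower degree are known by
  induction. At k = 1 the recursion forces \<open>f 2 = f 1\<close>, and from then on it carries the
  value from k to k + 1.\<close>

lemma power_associative:
  assumes x: "x \<in> V"
  shows "jp (pw x i) (pw x j) = pw x (i + j)"
proof (induction "i + j" arbitrary: i j rule: less_induct)
  case less
  define n where "n = i + j"
  have IH: "jp (pw x k) (pw x l) = pw x (k + l)" if "k + l < n" for k l
    using less that by (simp add: n_def)
  define f where "f k = jp (pw x k) (pw x (n - k))" for k
  have f0: "f 0 = pw x n" using x by (simp add: f_def)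
  have f1: "f 1 = pw x n" if "0 < n"
    using x that by (cases n) (simp_all add: f_def)
  have rel: "f 1 + f 1 + f k = f (k + 1) + f (k + 1) + f 2" if k: "1 \<le> k" "k + 2 \<le> n" for k
  proof -
    define l where "l = n - k - 2"
    have n: "n = k + l + 2" using k by (simp add: l_def)
    have eq: "jp x (pw x r) = pw x (r + 1)" "jp (pw x r) x = pw x (r + 1)" for r
      using x by (simp_all add: jp_commute[of "pw x r" x])
    have prods: "jp (pw x (k+1)) (pw x l) = pw x (n - 1)" "jp (pw x 2) (pw x l) = pw x (l + 2)"
      "jp (pw x l) (pw x k) = pw x (k + l)"
      using IH[of "k+1" l] IH[of 2 l] IH[of l k] k n by (simp_all add: add.commute)
    have x2: "jp x x = pw x 2" using x by (simp add: numeral_2_eq_2)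
    have "pw x (n - 1 + 1) = f 1"
      using n f1 by simp
    moreover have "jp (pw x (l + 2)) (pw x k) = f k"
      using x n by (simp add: f_def jp_commute[of "pw x k"] del: pw.simps add_2_eq_Suc')
    moreover have "jp (pw x (k + 1)) (pw x (l + 1)) = f (k + 1)"
      using n by (simp add: f_def del: pw.simps)
    moreover have "jp (pw x 2) (pw x (k + l)) = f 2"
      using n by (simp add: f_def del: pw.simps)
    moreover note jordan_linearized[of x "pw x l" "pw x k" x, OF x pw_in[OF x] pw_in[OF x] x, unfolded eq prods x2]
    ultimately show ?thesis by (simp only: add_ac)
  qed
  have "f k = pw x n" if "k \<le> n" for k
  proof (cases "n < 3")
    case True
    have "f n = pw x n" using x by (simp add: f_def)
    have "k = 0 \<or> k = n \<or> k = 1 \<and> n = 2" using True that by linarith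
    then show ?thesis using f0 f1 \<open>f n = pw x n\<close> by auto
  next
    case False
    then have f1: "f 1 = pw x n" and n3: "3 \<le> n" using f1 by auto
    have "f 1 + f 1 + f 1 = f 2 + f 2 + f 2" using rel[of 1] n3 by (simp add: numeral_2_eq_2)
    moreover have "scale 3 y = y + y + y" for y
      using scale_left_distrib[of 2 1 y] scale_left_distrib[of 1 1 y] by simp
    ultimately have "scale 3 (f 1) = scale 3 (f 2)" by simp
    then have f2: "f 2 = f 1" by simp
    have "k < n \<Longrightarrow> f k = pw x n" for k
    proof (induction k)
      case 0 show ?case by (rule f0)
    next
      case (Suc k)
      show ?case
      proof (cases "k = 0")
        case False
        then have "f 1 + f 1 + f k = f (k + 1) + f (k + 1) + f 2" using rel[of k] Suc by simp
        then have "f (k + 1) + f (k + 1) = f 1 + f 1"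
          using Suc f1 f2 by simp
        then have "f (k + 1) = f 1" by (rule double_eqD)
        then show ?thesis using f1 by simp
      qed (use f1 in simp)
    qed
    moreover have "f n = pw x n" using x by (simp add: f_def)
    ultimately show ?thesis using that by (cases "k = n") auto
  qed
  from this[of i] show ?case by (simp add: f_def n_def)
qed

lemma span_pw_in: "x \<in> V \<Longrightarrow> a \<in> span (range (pw x)) \<Longrightarrow> a \<in> V"
  using span_minimal[OF _ subspace_V, of "range (pw x)"] pw_in by blast

text \<open>Membership in \<open>V\<close> is carried along because the product is bilinear only
  there.\<close>

lemma span_pw_induct:
  assumes x: "x \<in> V" and a: "a \<in> span (range (pw x))"
    and "P 0" "\<And>i. P (pw x i)" "\<And>y z. y \<in> V \<Longrightarrow> z \<in> V \<Longrightarrow> P y \<Longrightarrow> P z \<Longrightarrow> P (y + z)"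
    "\<And>r y. y \<in> V \<Longrightarrow> P y \<Longrightarrow> P (scale r y)"
  shows "P a"
proof -
  have "a \<in> V \<and> P a"
    using a
  proof (induction rule: span_induct)
    case base
    show ?case using assms by (auto simp: subspace_def)
  next
    case (step a)
    then show ?case using assms by auto
  qed
  then show ?thesis ..
qed

lemma span_pw_jp:
  assumes x: "x \<in> V" and a: "a \<in> span (range (pw x))" and b: "b \<in> span (range (pw x))"
  shows "jp a b \<in> span (range (pw x))"
  using x a
proof (rule span_pw_induct)
  note bV = span_pw_in[OF x b]
  show "jp 0 b \<in> span (range (pw x))" using bV by (simp add: span_zero)
  fix i show "jp (pw x i) b \<in> span (range (pw x))"
    using x b
    by (rule span_pw_induct) (simp_all add: x power_associative span_zero span_base span_add span_scale jp_bilinear)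
next
  show "jp (y + z) b \<in> span (range (pw x))"
    if "y \<in> V" "z \<in> V" "jp y b \<in> span (range (pw x))" "jp z b \<in> span (range (pw x))" for y z
    using that span_pw_in[OF x b] by (simp add: jp_bilinear span_add)
  show "jp (scale r y) b \<in> span (range (pw x))"
    if "y \<in> V" "jp y b \<in> span (range (pw x))" for r y
    using that span_pw_in[OF x b] by (simp add: jp_bilinear span_scale)
qed

lemma span_pw_assoc:
  assumes x: "x \<in> V" and a: "a \<in> span (range (pw x))" and b: "b \<in> span (range (pw x))"
    and c: "c \<in> span (range (pw x))"
  shows "jp (jp a b) c = jp a (jp b c)"
proof -
  note V = span_pw_in[OF x b] span_pw_in[OF x c] x
  show ?thesis
    using x a
  proof (rule span_pw_induct)
    fix i show "jp (jp (pw x i) b) c = jp (pw x i) (jp b c)"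
      using x b
    proof (rule span_pw_induct)
      fix j show "jp (jp (pw x i) (pw x j)) c = jp (pw x i) (jp (pw x j) c)"
        using x c
        by (rule span_pw_induct) (simp_all add: x power_associative jp_bilinear add.assoc)
    qed (use V in \<open>simp_all add: jp_bilinear\<close>)
  qed (use V in \<open>simp_all add: jp_bilinear\<close>)
qed

end

section \<open>JB-algebras\<close>

locale unital_jb_algebra = unital_jordan_algebra scale V jp u
  for scale :: "real \<Rightarrow> 'v::ab_group_add \<Rightarrow> 'v" and V jp u +
  fixes N :: "'v \<Rightarrow> real"
  assumes norm_N: "norm_on scale V N"
    and complete_N: "complete_on V N"
    and N_jp: "\<lbrakk>a \<in> V; b \<in> V\<rbrakk> \<Longrightarrow> N (jp a b) \<le> N a * N b"
    and N_square: "a \<in> V \<Longrightarrow> N (jp a a) = (N a)\<^sup>2"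
    and N_square_add: "\<lbrakk>a \<in> V; b \<in> V\<rbrakk> \<Longrightarrow> N (jp a a) \<le> N (jp a a + jp b b)"
begin

lemma N_nonneg [simp]: "x \<in> V \<Longrightarrow> 0 \<le> N x"
  and N_eq_0: "x \<in> V \<Longrightarrow> N x = 0 \<longleftrightarrow> x = 0"
  and N_triangle: "x \<in> V \<Longrightarrow> y \<in> V \<Longrightarrow> N (x + y) \<le> N x + N y"
  and N_scale: "x \<in> V \<Longrightarrow> N (scale c x) = \<bar>c\<bar> * N x"
  using norm_N by (auto simp: norm_on_def)

lemma N_zero [simp]: "N 0 = 0"
  using N_eq_0[of 0] by simp

lemma N_minus [simp]: "x \<in> V \<Longrightarrow> N (- x) = N x"
  using N_scale[of x "-1"] by simp

lemma N_minus_commute: "x \<in> V \<Longrightarrow> y \<in> V \<Longrightarrow> N (x - y) = N (y - x)"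
  using N_minus[of "x - y"] by simp

lemma N_triangle_diff: "x \<in> V \<Longrightarrow> y \<in> V \<Longrightarrow> N (x - y) \<le> N x + N y"
  using N_triangle[of x "- y"] by simp

text \<open>Only an inequality, since in the zero algebra \<open>u\<close> is 0.\<close>

lemma N_u: "N u \<le> 1"
proof -
  have "N u = (N u)\<^sup>2" using N_square[of u] by simp
  then show ?thesis by (auto simp: power2_eq_square)
qed

lemma N_limit_unique:
  assumes "range X \<subseteq> V" "a \<in> V" "b \<in> V"
    and "(\<lambda>n. N (X n - a)) \<longlonglongrightarrow> 0" "(\<lambda>n. N (X n - b)) \<longlonglongrightarrow> 0"
  shows "a = b"
proof -
  have X: "X n \<in> V" for n using assms by auto
  have "(\<lambda>n. N (X n - a) + N (X n - b)) \<longlonglongrightarrow> 0 + 0" by (intro tendsto_add assms)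
  moreover have "N (a - b) \<le> N (X n - a) + N (X n - b)" for n
    using N_triangle_diff[of "X n - b" "X n - a"] X assms by (simp add: add.commute)
  ultimately have "N (a - b) \<le> 0 + 0"
    by (intro LIMSEQ_le_const) auto
  then have "N (a - b) = 0" using N_nonneg[of "a - b"] assms(2,3) by (simp del: N_nonneg)
  then show ?thesis using N_eq_0[of "a - b"] assms by simp
qed

lemma N_limit_jp:
  assumes "range X \<subseteq> V" "range Y \<subseteq> V" "a \<in> V" "b \<in> V"
    and "(\<lambda>n. N (X n - a)) \<longlonglongrightarrow> 0" "(\<lambda>n. N (Y n - b)) \<longlonglongrightarrow> 0"
  shows "(\<lambda>n. N (jp (X n) (Y n) - jp a b)) \<longlonglongrightarrow> 0"
proof -
  have X: "X n \<in> V" "Y n \<in> V" for n using assms by auto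
  have "(\<lambda>n. N (X n - a) * (N (Y n - b) + N b) + N a * N (Y n - b)) \<longlonglongrightarrow> 0 * (0 + N b) + N a * 0"
    by (intro tendsto_intros assms)
  then have lim: "(\<lambda>n. N (X n - a) * (N (Y n - b) + N b) + N a * N (Y n - b)) \<longlonglongrightarrow> 0" by simp
  have "N (jp (X n) (Y n) - jp a b) \<le> N (X n - a) * (N (Y n - b) + N b) + N a * N (Y n - b)" for n
  proof -
    have "jp (X n) (Y n) - jp a b = jp (X n - a) (Y n) + jp a (Y n - b)"
      using X assms by (simp add: jp_bilinear)
    then have "N (jp (X n) (Y n) - jp a b) \<le> N (X n - a) * N (Y n) + N a * N (Y n - b)"
      using N_triangle[of "jp (X n - a) (Y n)" "jp a (Y n - b)"] N_jp[of "X n - a" "Y n"]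
        N_jp[of a "Y n - b"] X assms by simp
    moreover have "N (Y n) \<le> N (Y n - b) + N b" using N_triangle[of "Y n - b" b] X assms by simp
    then have "N (X n - a) * N (Y n) \<le> N (X n - a) * (N (Y n - b) + N b)"
      using X assms by (intro mult_left_mono) auto
    ultimately show ?thesis by simp
  qed
  then show ?thesis
    by (intro tendsto_sandwich[OF _ _ tendsto_const lim]) (use X assms in auto)
qed

end

section \<open>Peirce calculus of an idempotent\<close>

context unital_jordan_algebra
begin

lemma scale_2: "scale 2 x = x + x"
  using scale_left_distrib[of 1 1 x] by simp

lemma scale_half: "scale (1/2) x + scale (1/2) x = x"
  using scale_left_distrib[of "1/2" "1/2" x] by simp

text \<open>The linearized identity with \<open>p\<close> inserted twice. The factor
  \<open>2 * i - 1\<close> vanishes exactly at i = 1/2, the eigenvalue whose Peirce space does not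
  act on the other ones by preserving them.\<close>

lemma peirce_product:
  assumes p: "p \<in> V" "jp p p = p" and xy: "x \<in> V" "y \<in> V" "jp p x = scale i x" "jp p y = scale j y"
  shows "scale (2 * i - 1) (jp p (jp x y)) = scale (j * (2 * i - 1)) (jp x y)"
proof -
  have "jp (jp (jp p p) y) x + jp (jp (jp p x) y) p + jp (jp (jp p x) y) p =
    jp (jp p p) (jp y x) + jp (jp p x) (jp y p) + jp (jp p x) (jp y p)"
    using p xy by (intro jordan_linearized) auto
  then have "scale j (jp x y) + scale i (jp p (jp x y)) + scale i (jp p (jp x y)) =
    jp p (jp x y) + scale (i * j) (jp x y) + scale (i * j) (jp x y)"
    using p xy by (simp add: jp_bilinear jp_commute[of y x] jp_commute[of y p] jp_commute[of "jp x y" p] mult.commute)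
  then have "scale i (jp p (jp x y)) + scale i (jp p (jp x y)) - jp p (jp x y) =
    scale (i * j) (jp x y) + scale (i * j) (jp x y) - scale j (jp x y)"
    by (simp add: algebra_simps)
  moreover have "2 * i - 1 = i + i - 1" "j * (2 * i - 1) = i * j + i * j - j"
    by (simp_all add: algebra_simps)
  then have "scale (2 * i - 1) z = scale i z + scale i z - z"
    "scale (j * (2 * i - 1)) z = scale (i * j) z + scale (i * j) z - scale j z" for z
    by (simp_all only: scale_left_distrib scale_left_diff_distrib scale_one)
  ultimately show ?thesis by simp
qed

definition peirce :: "'v \<Rightarrow> real \<Rightarrow> 'v set" where
  "peirce p i = {x \<in> V. jp p x = scale i x}"

lemma peirce_closed:
  assumes p: "p \<in> V" "jp p p = p" and "i \<noteq> 1/2" "x \<in> peirce p i" "y \<in> peirce p j"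
  shows "jp x y \<in> peirce p j" "jp y x \<in> peirce p j"
proof -
  have "scale (2 * i - 1) (jp p (jp x y) - scale j (jp x y)) = 0"
    using peirce_product[OF p, of x y i j] assms
    by (simp add: peirce_def scale_right_diff_distrib mult.commute)
  then show "jp x y \<in> peirce p j" using assms by (auto simp: peirce_def)
  then show "jp y x \<in> peirce p j" using assms jp_commute[of x y] by (simp add: peirce_def)
qed

lemma peirce_in: "x \<in> peirce p i \<Longrightarrow> x \<in> V"
  by (simp add: peirce_def)

text \<open>The product is an eigenvector of \<open>jp p\<close> for both 0 and 1.\<close>

lemma peirce_one_zero:
  assumes p: "p \<in> V" "jp p p = p" and xy: "x \<in> peirce p 1" "y \<in> peirce p 0"
  shows "jp x y = 0" "jp y x = 0"
proof -
  show "jp x y = 0"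
    using peirce_closed(1)[OF p _ xy] peirce_closed(2)[OF p _ xy(2,1)] by (simp add: peirce_def)
  then show "jp y x = 0" using xy jp_commute[of x y] by (simp add: peirce_def)
qed

lemma peirce_subspace: "p \<in> V \<Longrightarrow> subspace (peirce p i)"
  by (auto simp: subspace_def peirce_def jp_bilinear scale_right_distrib mult.commute)

lemma peirce_complement:
  assumes "p \<in> V" "x \<in> peirce p i"
  shows "x \<in> peirce (u - p) (1 - i)"
  using assms by (simp add: peirce_def jp_bilinear scale_left_diff_distrib)

text \<open>Equivalently, \<open>x\<close> acting as twice the multiplication by \<open>x\<close> is
  a Jordan homomorphism from the Peirce space of 1 into the operators on the half space. Unknown
  products in that Peirce space are later identified through this action.\<close>

lemma peirce_half_hom:
  assumes p: "p \<in> V" "jp p p = p"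
    and x: "x \<in> peirce p 1" and y: "y \<in> peirce p 1" and z: "z \<in> peirce p (1/2)"
  shows "jp (jp x y) z = jp x (jp y z) + jp y (jp x z)"
proof -
  note V = peirce_in[OF x] peirce_in[OF y] peirce_in[OF z]
  have *: "jp p (jp x y) = jp x y" "jp p (jp x z) = scale (1/2) (jp x z)"
    "jp p (jp y z) = scale (1/2) (jp y z)"
    using peirce_closed(1)[OF p _ x y] peirce_closed(1)[OF p _ x z] peirce_closed(1)[OF p _ y z]
    by (simp_all add: peirce_def)
  have "jp (jp (jp x y) p) z + jp (jp (jp x z) p) y + jp (jp (jp y z) p) x =
         jp (jp x y) (jp p z) + jp (jp x z) (jp p y) + jp (jp y z) (jp p x)"
    using p V by (intro jordan_linearized) auto
  then have "jp (jp x y) z + scale (1/2) (jp (jp x z) y) + scale (1/2) (jp (jp y z) x) =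
    scale (1/2) (jp (jp x y) z) + jp (jp x z) y + jp (jp y z) x"
    using p V x y z by (simp add: peirce_def jp_bilinear * jp_commute[of "jp x y" p] jp_commute[of "jp x z" p] jp_commute[of "jp y z" p])
  then have "scale 2 (jp (jp x y) z + scale (1/2) (jp (jp x z) y) + scale (1/2) (jp (jp y z) x)) =
    scale 2 (scale (1/2) (jp (jp x y) z) + jp (jp x z) y + jp (jp y z) x)" by simp
  then have "jp (jp x y) z = jp (jp x z) y + jp (jp y z) x"
    by (simp add: scale_right_distrib) (simp add: scale_2 algebra_simps)
  then show ?thesis using V by (simp add: jp_commute[of "jp x z" y] jp_commute[of "jp y z" x] add.commute)
qed

text \<open>With \<open>p\<close> inserted in the linearized identity, \<open>jp x y = 0\<close> and
  \<open>jp p y = 0\<close> leave only the two mixed products, each with the factor 1/2.\<close>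

lemma peirce_operators_commute:
  assumes p: "p \<in> V" "jp p p = p"
    and x: "x \<in> peirce p 1" and y: "y \<in> peirce p 0" and z: "z \<in> peirce p (1/2)"
  shows "jp y (jp x z) = jp x (jp y z)"
proof -
  note V = peirce_in[OF x] peirce_in[OF y] peirce_in[OF z]
  have *: "jp x y = 0" "jp p (jp x z) = scale (1/2) (jp x z)"
    "jp p (jp y z) = scale (1/2) (jp y z)" "jp p x = x" "jp p y = 0"
    using peirce_one_zero(1)[OF p x y] peirce_closed(1)[OF p _ x z] peirce_closed(1)[OF p _ y z] x y
    by (simp_all add: peirce_def)
  have "jp (jp (jp x y) p) z + jp (jp (jp x z) p) y + jp (jp (jp y z) p) x =
         jp (jp x y) (jp p z) + jp (jp x z) (jp p y) + jp (jp y z) (jp p x)"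
    using p V by (intro jordan_linearized) auto
  then have "scale (1/2) (jp (jp x z) y) + scale (1/2) (jp (jp y z) x) = jp (jp y z) x"
    using p V by (simp add: * jp_bilinear jp_commute[of "jp x z" p] jp_commute[of "jp y z" p])
  then have "scale (1/2) (jp (jp x z) y) = scale (1/2) (jp (jp y z) x)"
    using scale_half[of "jp (jp y z) x"] by (metis add_right_cancel)
  then have "jp (jp x z) y = jp (jp y z) x" by simp
  then show ?thesis using V by (simp add: jp_commute[of y "jp x z"] jp_commute[of x "jp y z"])
qed

text \<open>Its use lies in the component in the Peirce space of 0: the terms with an outer factor
  \<open>p\<close> or \<open>x\<close> have none there, so \<open>jp (jp x z) w\<close> and
  \<open>jp (jp x w) z\<close> have the same component.\<close>

lemma peirce_half_exchange:
  assumes p: "p \<in> V" "jp p p = p"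
    and x: "x \<in> peirce p 1" and z: "z \<in> peirce p (1/2)" and w: "w \<in> peirce p (1/2)"
  shows "jp (jp x z) w + scale 2 (jp p (jp (jp x w) z)) = jp (jp x w) z + jp x (jp z w)"
proof -
  note V = peirce_in[OF x] peirce_in[OF z] peirce_in[OF w]
  have *: "jp p x = x" "jp p z = scale (1/2) z" "jp p w = scale (1/2) w"
    using x z w by (simp_all add: peirce_def)
  have "jp (jp (jp p x) z) w + jp (jp (jp p w) z) x + jp (jp (jp x w) z) p =
         jp (jp p x) (jp z w) + jp (jp p w) (jp z x) + jp (jp x w) (jp z p)"
    using p V by (intro jordan_linearized) auto
  then have "jp (jp x z) w + scale (1/2) (jp x (jp z w)) + jp p (jp (jp x w) z) =
     jp x (jp z w) + scale (1/2) (jp (jp x z) w) + scale (1/2) (jp (jp x w) z)"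
    using p V by (simp add: * jp_bilinear jp_commute[of w z] jp_commute[of z x] jp_commute[of z p]
      jp_commute[of w "jp x z"] jp_commute[of "jp z w" x] jp_commute[of "jp (jp x w) z" p])
  then have "scale 2 (jp (jp x z) w + scale (1/2) (jp x (jp z w)) + jp p (jp (jp x w) z)) =
     scale 2 (jp x (jp z w) + scale (1/2) (jp (jp x z) w) + scale (1/2) (jp (jp x w) z))" by simp
  then show ?thesis
    by (simp add: scale_right_distrib) (simp add: scale_2 algebra_simps)
qed

text \<open>The linearized identity gives \<open>2 L^3 - 3 L^2 + L = 0\<close> for the
  multiplication L by \<open>p\<close>. The three summands are the Lagrange polynomials
  \<open>2 L^2 - L\<close>, \<open>4 L - 4 L^2\<close> and \<open>1 - 3 L + 2 L^2\<close> at the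
  roots 1, 1/2, 0, applied to \<open>x\<close>.\<close>

lemma peirce_decomposition:
  assumes p: "p \<in> V" "jp p p = p" and x: "x \<in> V"
  obtains a b c where "a \<in> peirce p 1" "b \<in> peirce p (1/2)" "c \<in> peirce p 0" "x = a + b + c"
proof -
  define y z where "y = jp p x" and "z = jp p y"
  have V: "y \<in> V" "z \<in> V" using p x by (simp_all add: y_def z_def)
  have "jp (jp (jp p p) p) x + jp (jp (jp p x) p) p + jp (jp (jp p x) p) p =
    jp (jp p p) (jp p x) + jp (jp p x) (jp p p) + jp (jp p x) (jp p p)"
    using p x by (intro jordan_linearized) auto
  then have "y + jp p z + jp p z = z + z + z"
    using p x V by (simp add: y_def[symmetric] z_def[symmetric] jp_commute[of y p] jp_commute[of z p])
  then have pz: "scale 2 (jp p z) = scale 3 z - y"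
    using scale_left_distrib[of 2 1 z] by (simp add: scale_2 algebra_simps)
  have 1: "scale 2 z - y \<in> peirce p 1"
    using p V pz scale_left_distrib[of 2 1 z] by (simp add: peirce_def jp_bilinear z_def[symmetric])
  have 2: "scale 4 (y - z) \<in> peirce p (1/2)"
  proof -
    have "scale 2 (z - jp p z) = y - z"
      using pz scale_left_distrib[of 2 1 z] by (simp add: scale_right_diff_distrib)
    then have "scale 4 (z - jp p z) = scale 2 (y - z)"
      by (metis scale_scale mult_2 numeral_Bit0)
    then show ?thesis using p V by (simp add: peirce_def jp_bilinear z_def[symmetric])
  qed
  have 3: "x - scale 3 y + scale 2 z \<in> peirce p 0"
    using p V pz x by (simp add: peirce_def jp_bilinear z_def[symmetric] y_def[symmetric] algebra_simps)
  have "x = (scale 2 z - y) + scale 4 (y - z) + (x - scale 3 y + scale 2 z)"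
    using scale_left_distrib[of 3 1 y] scale_left_distrib[of 2 2 z]
    by (simp add: scale_right_diff_distrib)
  with 1 2 3 that show ?thesis by blast
qed

end

section \<open>Corners and square roots\<close>

context unital_jb_algebra
begin

text \<open>Completeness survives because an eigenspace of the continuous map \<open>jp p\<close> is
  closed.\<close>

lemma corner_jb_algebra:
  assumes p: "p \<in> V" "jp p p = p"
  shows "unital_jb_algebra scale (peirce p 1) jp p N"
proof -
  have V: "peirce p 1 \<subseteq> V" by (auto simp: peirce_def)
  show ?thesis
  proof (unfold_locales)
    show "subspace (peirce p 1)" by (rule peirce_subspace[OF p(1)])
    show "a \<in> peirce p 1 \<Longrightarrow> b \<in> peirce p 1 \<Longrightarrow> jp a b \<in> peirce p 1" for a b
      by (rule peirce_closed(1)[OF p]) auto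
    show "norm_on scale (peirce p 1) N" using norm_N V by (auto simp: norm_on_def subset_iff)
    show "complete_on (peirce p 1) N"
      unfolding complete_on_def
    proof (intro allI impI)
      fix X :: "nat \<Rightarrow> 'v" assume X: "range X \<subseteq> peirce p 1"
        and "\<forall>\<epsilon>>0. \<exists>M. \<forall>m\<ge>M. \<forall>n\<ge>M. N (X m - X n) < \<epsilon>"
      then obtain l where l: "l \<in> V" "(\<lambda>n. N (X n - l)) \<longlonglongrightarrow> 0"
        using complete_N V unfolding complete_on_def by (meson order_trans)
      have "(\<lambda>n. N (jp p (X n) - jp p l)) \<longlonglongrightarrow> 0"
        using X V p l by (intro N_limit_jp[of "\<lambda>_. p"]) auto
      moreover have "jp p (X n) = X n" for n using X by (auto simp: peirce_def)
      ultimately have "jp p l = l"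
        using N_limit_unique[of X "jp p l" l] X V p l by auto
      with l show "\<exists>l\<in>peirce p 1. (\<lambda>n. N (X n - l)) \<longlonglongrightarrow> 0" by (auto simp: peirce_def)
    qed
    show "p \<in> peirce p 1" using p by (simp add: peirce_def)
    show "x \<in> peirce p 1 \<Longrightarrow> jp p x = x" for x by (simp add: peirce_def)
    show "a \<in> peirce p 1 \<Longrightarrow> b \<in> peirce p 1 \<Longrightarrow> N (jp a a) \<le> N (jp a a + jp b b)" for a b
      using V N_square_add by auto
  qed (use V in \<open>auto simp: jp_bilinear jp_commute jordan_identity N_jp N_square subset_iff\<close>)
qed

text \<open>The equation for \<open>1 - w\<close> as a root of \<open>u - t\<close> is the fixed
  point equation \<open>w = (t + w^2) / 2\<close>. At \<open>N t = 1\<close> there is no uniform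
  contraction, so the increments are majorized by those of the scalar iteration \<open>U\<close> at
  t = 1, which increases and is bounded by 1. The iterates are part of the conclusion because they
  remain in any subalgebra containing \<open>t\<close>, which is not immediate for the
  limit.\<close>

lemma sqrt_iteration:
  assumes t: "t \<in> V" "N t \<le> 1"
  obtains W w where "W 0 = 0" "\<And>k. W (Suc k) = scale (1/2) (t + jp (W k) (W k))" "range W \<subseteq> V"
    "w \<in> V" "(\<lambda>k. N (W k - w)) \<longlonglongrightarrow> 0" "jp (u - w) (u - w) = u - t"
proof -
  define W where "W = rec_nat 0 (\<lambda>_ z. scale (1/2) (t + jp z z))"
  define U where "U = rec_nat 0 (\<lambda>_ z. (1 + z\<^sup>2) / 2 :: real)"
  have W: "W 0 = 0" "\<And>k. W (Suc k) = scale (1/2) (t + jp (W k) (W k))" by (simp_all add: W_def)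
  have U: "U 0 = 0" "\<And>k. U (Suc k) = (1 + (U k)\<^sup>2) / 2" by (simp_all add: U_def)
  have WV: "W k \<in> V" for k by (induction k) (simp_all add: W t)
  have U01: "0 \<le> U k \<and> U k \<le> 1" for k
    by (induction k) (simp_all add: U abs_square_le_1)
  have Umono: "U k \<le> U (Suc k)" for k
    using zero_le_power2[of "1 - U k"] by (simp add: U power2_eq_square algebra_simps)
  have NW: "N (W k) \<le> U k" for k
  proof (induction k)
    case (Suc k)
    have "N (t + jp (W k) (W k)) \<le> N t + N (jp (W k) (W k))" using WV t by (intro N_triangle) auto
    also have "\<dots> \<le> 1 + (U k)\<^sup>2"
      using t WV Suc by (simp add: N_square add_mono power_mono)
    finally show ?case using WV t by (simp add: W U N_scale)
  qed (simp add: W U)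
  have step: "N (W (Suc k) - W k) \<le> U (Suc k) - U k" for k
  proof (induction k)
    case 0 show ?case using t WV by (simp add: W U N_scale)
  next
    case (Suc k)
    let ?a = "W (Suc k)" and ?b = "W k"
    \<comment> \<open>Commutativity alone factors a difference of two squares.\<close>
    have "W (Suc (Suc k)) - ?a = scale (1/2) (jp (?a - ?b) (?a + ?b))"
      using WV t jp_commute[of ?a ?b] by (subst (1 2) W)
        (simp add: jp_bilinear scale_right_distrib scale_right_diff_distrib del: W)
    then have "N (W (Suc (Suc k)) - ?a) = N (jp (?a - ?b) (?a + ?b)) / 2"
      using WV by (simp add: N_scale)
    also have "\<dots> \<le> (N (?a - ?b) * N (?a + ?b)) / 2"
      using N_jp[of "?a - ?b" "?a + ?b"] WV by simp
    also have "\<dots> \<le> ((U (Suc k) - U k) * (U (Suc k) + U k)) / 2"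
      using Suc N_triangle[of ?a ?b] NW[of k] NW[of "Suc k"] WV Umono[of k]
      by (intro divide_right_mono mult_mono) auto
    also have "\<dots> = U (Suc (Suc k)) - U (Suc k)"
      by (subst (3) U, subst (4) U) (simp add: field_simps power2_eq_square)
    finally show ?case .
  qed
  have diff: "N (W (k + d) - W k) \<le> U (k + d) - U k" for k d
  proof (induction d)
    case (Suc d)
    have "N (W (k + Suc d) - W k) \<le> N (W (Suc (k + d)) - W (k + d)) + N (W (k + d) - W k)"
      using N_triangle[of "W (Suc (k + d)) - W (k + d)" "W (k + d) - W k"] WV by simp
    then show ?case using Suc step[of "k + d"] by simp
  qed simp
  have diff': "N (W m - W n) \<le> \<bar>U m - U n\<bar>" for m n
    using diff[of n "m - n"] diff[of m "n - m"] N_minus_commute[OF WV WV, of m n]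
    by (cases "n \<le> m") auto
  have "m \<le> n \<Longrightarrow> U m \<le> U n" for m n
    by (rule lift_Suc_mono_le[of U, OF Umono])
  then have "convergent U"
    using U01 by (intro Bseq_mono_convergent BseqI'[of U 1]) auto
  then have "Cauchy U" by (rule convergent_Cauchy)
  then have "\<forall>\<epsilon>>0. \<exists>M. \<forall>m\<ge>M. \<forall>n\<ge>M. N (W m - W n) < \<epsilon>"
    using diff' unfolding Cauchy_def dist_real_def by (meson le_less_trans)
  then obtain w where w: "w \<in> V" "(\<lambda>k. N (W k - w)) \<longlonglongrightarrow> 0"
    using complete_N WV unfolding complete_on_def by blast
  have lim: "(\<lambda>k. N (jp (W k) (W k) - jp w w)) \<longlonglongrightarrow> 0"
    using WV w by (intro N_limit_jp) auto
  have "(\<lambda>k. N (W (Suc k) - scale (1/2) (t + jp w w))) \<longlonglongrightarrow> 0"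
  proof -
    have eq: "N (W (Suc k) - scale (1/2) (t + jp w w)) = N (jp (W k) (W k) - jp w w) / 2" for k
    proof -
      have "W (Suc k) - scale (1/2) (t + jp w w) = scale (1/2) (jp (W k) (W k) - jp w w)"
        by (simp add: W scale_right_distrib scale_right_diff_distrib)
      then show ?thesis using WV w by (simp add: N_scale)
    qed
    have "(\<lambda>k. N (jp (W k) (W k) - jp w w) / 2) \<longlonglongrightarrow> 0 / 2"
      by (intro tendsto_divide lim tendsto_const) simp
    then show ?thesis unfolding eq by simp
  qed
  then have "w = scale (1/2) (t + jp w w)"
    using WV w t LIMSEQ_Suc[OF w(2)] by (intro N_limit_unique[of "\<lambda>k. W (Suc k)"]) auto
  then have "w + w = t + jp w w" by (metis scale_half)
  then have "jp (u - w) (u - w) = u - t"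
    using w by (simp add: jp_bilinear) (simp add: algebra_simps)
  with W WV w show ?thesis by (intro that[of W w]) auto
qed

lemma sqrt_exists:
  assumes "t \<in> V" "N t \<le> 1"
  obtains y where "y \<in> V" "jp y y = u - t"
  using assms by (metis sqrt_iteration V_closed(2) u_in)

end

section \<open>The norm as an order unit norm\<close>

locale ordered_jb_algebra = unital_jb_algebra scale V jp u N + ord: order_unit_space scale V C u
  for scale :: "real \<Rightarrow> 'v::ab_group_add \<Rightarrow> 'v" and V jp u N C +
  assumes C_squares: "C = {jp x x | x. x \<in> V}"
begin

lemma C_in [simp]: "x \<in> C \<Longrightarrow> x \<in> V"
  using ord.cone_subset by auto

lemma square_in_C: "x \<in> V \<Longrightarrow> jp x x \<in> C"
  unfolding C_squares by blast

lemma C_squareE: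
  assumes "x \<in> C"
  obtains a where "a \<in> V" "x = jp a a"
  using assms unfolding C_squares by blast

lemma unit_minus_in_C: "t \<in> V \<Longrightarrow> N t \<le> 1 \<Longrightarrow> u - t \<in> C"
  by (metis sqrt_exists square_in_C)

lemma N_mono: "x \<in> C \<Longrightarrow> y - x \<in> C \<Longrightarrow> N x \<le> N y"
proof -
  assume "x \<in> C" "y - x \<in> C"
  then obtain a b where ab: "x = jp a a" "y - x = jp b b" "a \<in> V" "b \<in> V"
    by (meson C_squareE)
  have "y = jp b b + x" by (subst ab(2) [symmetric]) simp
  then have "y = jp a a + jp b b" unfolding ab(1) by (simp only: add.commute)
  then show ?thesis unfolding ab(1) using N_square_add[OF ab(3,4)] by (simp only:)
qed

text \<open>Both \<open>y\<close> and \<open>u - y\<close> have square roots in the closed associative subalgebra generated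
  by \<open>y\<close>, so \<open>y - y\<^sup>2 = c\<^sup>2 d\<^sup>2 = (c d)\<^sup>2\<close>.\<close>

lemma square_le_self:
  assumes y: "y \<in> C" "u - y \<in> C"
  shows "y - jp y y \<in> C"
proof -
  let ?S = "span (range (pw y))"
  have yV: "y \<in> V" using y by simp
  have N: "N y \<le> 1" "N (u - y) \<le> 1" using N_mono[of y u] N_mono[of "u - y" u] y N_u by auto
  have yS: "u \<in> ?S" "y \<in> ?S"
    using span_base[OF rangeI[of "pw y" 0]] span_base[OF rangeI[of "pw y" 1]] yV by simp_all
  \<comment> \<open>Instead of closing up the subalgebra, each root is accompanied by a sequence
    from \<open>?S\<close> converging to it. Associativity is applied to the sequences and only the
    resulting identity passes to the limit.\<close>
  have "\<exists>Z z. range Z \<subseteq> ?S \<and> z \<in> V \<and> (\<lambda>k. N (Z k - z)) \<longlonglongrightarrow> 0 \<and> jp z z = u - t"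
    if t: "t \<in> ?S" "N t \<le> 1" for t
  proof -
    have tV: "t \<in> V" using span_pw_in[OF yV] t by simp
    obtain W w where W: "W 0 = 0" "\<And>k. W (Suc k) = scale (1/2) (t + jp (W k) (W k))"
      "range W \<subseteq> V" "w \<in> V" "(\<lambda>k. N (W k - w)) \<longlonglongrightarrow> 0" "jp (u - w) (u - w) = u - t"
      by (rule sqrt_iteration[OF tV t(2)]) (rule that)
    have "W k \<in> ?S" for k
      by (induction k) (simp_all add: W(1,2) span_zero span_scale span_add span_pw_jp[OF yV] t)
    then have "range (\<lambda>k. u - W k) \<subseteq> ?S" using yS span_diff by auto
    moreover have "N ((u - W k) - (u - w)) = N (W k - w)" for k
    proof -
      have "W k \<in> V" using W(3) by auto
      then show ?thesis using N_minus_commute[of w "W k"] W(4) by simp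
    qed
    ultimately show ?thesis
      using W by (intro exI[of _ "\<lambda>k. u - W k"] exI[of _ "u - w"]) auto
  qed
  note sq = this
  obtain X c where X: "range X \<subseteq> ?S" "c \<in> V" "(\<lambda>k. N (X k - c)) \<longlonglongrightarrow> 0" "jp c c = y"
    using sq[of "u - y"] N yS span_diff by auto
  obtain Y d where Y: "range Y \<subseteq> ?S" "d \<in> V" "(\<lambda>k. N (Y k - d)) \<longlonglongrightarrow> 0" "jp d d = u - y"
    using sq[of y] N yS by auto
  have XY: "X k \<in> ?S" "Y k \<in> ?S" for k using X Y by auto
  have XYV: "X k \<in> V" "Y k \<in> V" for k using XY span_pw_in[OF yV] by auto
  have l1: "(\<lambda>k. N (jp (jp (X k) (X k)) (jp (Y k) (Y k)) - jp (jp c c) (jp d d))) \<longlonglongrightarrow> 0"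
    using X Y XYV by (intro N_limit_jp) auto
  have l2: "(\<lambda>k. N (jp (jp (X k) (Y k)) (jp (X k) (Y k)) - jp (jp c d) (jp c d))) \<longlonglongrightarrow> 0"
    using X Y XYV by (intro N_limit_jp) auto
  have "jp (jp (X k) (X k)) (jp (Y k) (Y k)) = jp (jp (X k) (Y k)) (jp (X k) (Y k))" for k
  proof -
    note a = span_pw_assoc[OF yV]
    note m = span_pw_jp[OF yV]
    let ?x = "X k" and ?y = "Y k"
    have "jp (jp ?x ?y) (jp ?x ?y) = jp ?x (jp ?y (jp ?y ?x))"
      using a[OF XY(1)[of k] XY(2)[of k] m[OF XY(1)[of k] XY(2)[of k]]] jp_commute[OF XYV, of k k] by simp
    also have "\<dots> = jp ?x (jp (jp ?y ?y) ?x)"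
      using a[OF XY(2)[of k] XY(2)[of k] XY(1)[of k]] by simp
    also have "\<dots> = jp ?x (jp ?x (jp ?y ?y))" using XYV jp_commute[of "jp ?y ?y" ?x] by simp
    also have "\<dots> = jp (jp ?x ?x) (jp ?y ?y)"
      using a[OF XY(1)[of k] XY(1)[of k] m[OF XY(2)[of k] XY(2)[of k]]] by simp
    finally show ?thesis by simp
  qed
  then have "jp (jp c c) (jp d d) = jp (jp c d) (jp c d)"
    using l1 l2 X(2) Y(2) XYV by (intro N_limit_unique[of "\<lambda>k. jp (jp (X k) (X k)) (jp (Y k) (Y k))"]) auto
  then have "y - jp y y = jp (jp c d) (jp c d)"
    using X(4) Y(4) yV by (simp add: jp_bilinear)
  then show ?thesis using square_in_C X(2) Y(2) by simp
qed

text \<open>For the converse, \<open>y = (u - x) / 2\<close> satisfies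
  \<open>4 (y - y^2) = u - x^2\<close>, so \<open>square_le_self\<close> gives
  \<open>x^2 \<le> u\<close>, hence \<open>(N x)^2 = N (x^2) \<le> 1\<close>.\<close>

lemma N_le_one_iff:
  assumes x: "x \<in> V"
  shows "N x \<le> 1 \<longleftrightarrow> u - x \<in> C \<and> u + x \<in> C"
proof
  assume "N x \<le> 1"
  then show "u - x \<in> C \<and> u + x \<in> C"
    using unit_minus_in_C[of x] unit_minus_in_C[of "- x"] x by simp
next
  assume a: "u - x \<in> C \<and> u + x \<in> C"
  define y where "y = scale (1/2) (u - x)"
  have "scale (1/2) (u + x) = u - y"
    using scale_half[of u] by (simp add: y_def scale_right_distrib scale_right_diff_distrib algebra_simps)
  then have "y \<in> C" "u - y \<in> C"
    using a ord.cone_scale[of "1/2" "u + x"] ord.cone_scale[of "1/2" "u - x"] by (auto simp: y_def)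
  then have "scale 4 (y - jp y y) \<in> C" using ord.cone_scale square_le_self by simp
  also have "scale 4 (y - jp y y) = u - jp x x"
    using x by (simp add: y_def jp_bilinear scale_right_diff_distrib) (simp add: scale_2 algebra_simps)
  finally have "N (jp x x) \<le> N u" using N_mono[of "jp x x" u] square_in_C[OF x] by simp
  then show "N x \<le> 1" using N_square[OF x] N_u x by (metis abs_square_le_1 abs_of_nonneg N_nonneg order_trans)
qed

text \<open>The norm is therefore determined by the cone and the unit, so two compatible products
  share it. At r = 0 no rescaling is possible and properness of the cone takes over.\<close>

lemma N_le_iff:
  assumes x: "x \<in> V" and r: "0 \<le> r"
  shows "N x \<le> r \<longleftrightarrow> scale r u - x \<in> C \<and> scale r u + x \<in> C"
proof (cases "r = 0")
  case True
  have "N x \<le> 0 \<longleftrightarrow> x = 0" using N_eq_0[OF x] N_nonneg[OF x] by linarith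
  then show ?thesis using True ord.cone_proper[of x] ord.cone_zero by auto
next
  case False
  then have r: "0 < r" using r by simp
  have "N x \<le> r \<longleftrightarrow> N (scale (1/r) x) \<le> 1" using r x by (simp add: N_scale)
  also have "\<dots> \<longleftrightarrow> u - scale (1/r) x \<in> C \<and> u + scale (1/r) x \<in> C"
    using x by (simp add: N_le_one_iff)
  also have "\<dots> \<longleftrightarrow> scale r u - x \<in> C \<and> scale r u + x \<in> C"
  proof -
    have "scale r (u - scale (1/r) x) = scale r u - x" "scale r (u + scale (1/r) x) = scale r u + x"
      "scale (1/r) (scale r u - x) = u - scale (1/r) x" "scale (1/r) (scale r u + x) = u + scale (1/r) x"
      using r by (simp_all add: scale_right_distrib scale_right_diff_distrib)
    then show ?thesis
      using ord.cone_scale[of r "u - scale (1/r) x"] ord.cone_scale[of r "u + scale (1/r) x"]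
        ord.cone_scale[of "1/r" "scale r u - x"] ord.cone_scale[of "1/r" "scale r u + x"] r by auto
  qed
  finally show ?thesis .
qed

text \<open>A Cauchy-Schwarz inequality without states: where \<open>u - z\<close> is small,
  \<open>jp b z\<close> is close to \<open>b\<close>. It adds up three positive elements, namely the
  square of \<open>b + s (u - z)\<close>, the gap in \<open>(u - z)^2 \<le> 2 (u - z)\<close>
  multiplied by \<open>s^2\<close>, and the gap in \<open>b^2 \<le> (N b)^2 u\<close>.\<close>

lemma square_shift_bound:
  assumes b: "b \<in> V" and z: "z \<in> V" "N z \<le> 1"
  shows "scale ((N b)\<^sup>2) u + scale (2 * s\<^sup>2) (u - z) - scale (2 * s) (jp b z - b) \<in> C"
proof -
  define y where "y = scale (1/2) (u - z)"
  have "scale (1/2) (u + z) = u - y"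
    using scale_half[of u] by (simp add: y_def scale_right_distrib scale_right_diff_distrib algebra_simps)
  then have "y \<in> C" "u - y \<in> C"
    using N_le_one_iff[OF z(1)] z ord.cone_scale[of "1/2" "u + z"] ord.cone_scale[of "1/2" "u - z"] by (auto simp: y_def)
  then have 1: "scale (s\<^sup>2) (scale 4 (y - jp y y)) \<in> C"
    using ord.cone_scale square_le_self by simp
  have e1: "scale (s\<^sup>2) (scale 4 (y - jp y y)) = scale (2 * s\<^sup>2) (u - z) - scale (s\<^sup>2) (jp (u - z) (u - z))"
    using z by (simp add: y_def jp_scale jp_scale_right scale_right_diff_distrib[symmetric] mult.commute)
      (simp add: scale_right_diff_distrib)
  have 2: "jp (b + scale s (u - z)) (b + scale s (u - z)) \<in> C" (is "?q \<in> C")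
    using b z by (intro square_in_C) auto
  have e2: "?q = jp b b + scale (s\<^sup>2) (jp (u - z) (u - z)) - scale (2 * s) (jp b z - b)"
  proof -
    have "?q = jp b b + (scale s (jp b (u - z)) + scale s (jp b (u - z))) + scale (s\<^sup>2) (jp (u - z) (u - z))"
      using b z by (simp add: jp_add jp_add_right jp_scale jp_scale_right jp_commute[of "u - z" b]
          power2_eq_square scale_right_distrib)
    moreover have "scale s (jp b (u - z)) + scale s (jp b (u - z)) = - scale (2 * s) (jp b z - b)"
      using b z scale_left_distrib[of s s "jp b z - b"]
      by (simp add: jp_diff_right scale_right_diff_distrib)
    ultimately show ?thesis by simp
  qed
  have 3: "scale ((N b)\<^sup>2) u - jp b b \<in> C"
    using N_le_iff[of "jp b b" "(N b)\<^sup>2"] b by (simp add: N_square)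
  have "scale (s\<^sup>2) (scale 4 (y - jp y y)) + ?q + (scale ((N b)\<^sup>2) u - jp b b) \<in> C"
    using 1 2 3 by (intro ord.cone_add)
  then show ?thesis unfolding e1 e2 by (simp add: algebra_simps)
qed

end

section \<open>Uniqueness of the product\<close>

locale two_jb_products =
  fst: ordered_jb_algebra scale V jp u N C + snd: ordered_jb_algebra scale V jp' u N' C
  for scale :: "real \<Rightarrow> 'v::ab_group_add \<Rightarrow> 'v" and V jp jp' u N N' C
begin

lemma norms_agree: "x \<in> V \<Longrightarrow> N' x = N x"
  using fst.N_le_iff[of x] snd.N_le_iff[of x] fst.N_nonneg[of x] snd.N_nonneg[of x]
  by (metis order_refl order_antisym)

definition B where "B x y = jp x y - jp' x y"

lemma B_in [simp]: "x \<in> V \<Longrightarrow> y \<in> V \<Longrightarrow> B x y \<in> V"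
  by (simp add: B_def)

lemma B_simps:
  "x \<in> V \<Longrightarrow> y \<in> V \<Longrightarrow> z \<in> V \<Longrightarrow> B (x + y) z = B x z + B y z"
  "x \<in> V \<Longrightarrow> y \<in> V \<Longrightarrow> z \<in> V \<Longrightarrow> B z (x + y) = B z x + B z y"
  "x \<in> V \<Longrightarrow> y \<in> V \<Longrightarrow> z \<in> V \<Longrightarrow> B (x - y) z = B x z - B y z"
  "x \<in> V \<Longrightarrow> y \<in> V \<Longrightarrow> z \<in> V \<Longrightarrow> B z (x - y) = B z x - B z y"
  "x \<in> V \<Longrightarrow> y \<in> V \<Longrightarrow> B (- x) y = - B x y"
  "x \<in> V \<Longrightarrow> y \<in> V \<Longrightarrow> B x (- y) = - B x y"
  "x \<in> V \<Longrightarrow> y \<in> V \<Longrightarrow> B (scale r x) y = scale r (B x y)"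
  "x \<in> V \<Longrightarrow> y \<in> V \<Longrightarrow> B x (scale r y) = scale r (B x y)"
  by (simp_all add: B_def fst.jp_bilinear snd.jp_bilinear fst.scale_right_diff_distrib)

lemma B_commute: "x \<in> V \<Longrightarrow> y \<in> V \<Longrightarrow> B x y = B y x"
  by (simp add: B_def fst.jp_commute[of x y] snd.jp_commute[of x y])

lemma N_B: "x \<in> V \<Longrightarrow> y \<in> V \<Longrightarrow> N (B x y) \<le> 2 * N x * N y"
  using fst.N_triangle_diff[of "jp x y" "jp' x y"] fst.N_jp[of x y] snd.N_jp[of x y]
  by (simp add: B_def norms_agree)

text \<open>The shift is \<open>- k\<close> for one product and \<open>k\<close> for the other, so
  in the sum of the two inequalities the terms \<open>b\<close> cancel and only \<open>B b z\<close>
  remains. What results says that \<open>B b z\<close> is small where \<open>z\<close> is close to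
  its maximum.\<close>

lemma B_order_bound:
  assumes b: "b \<in> V" and z: "z \<in> V" "N z \<le> 1" and r: "scale r u - (z + B b z) \<in> C" and k: "0 < k"
  shows "scale ((r + (N b)\<^sup>2 / k + 2 * k) / (1 + 2 * k)) u - z \<in> C"
proof -
  let ?\<beta> = "(N b)\<^sup>2"
  let ?s = "scale (2 * ?\<beta>) u + scale (4 * k\<^sup>2) (u - z) + scale (2 * k) (B b z)"
  have "(scale ?\<beta> u + scale (2 * (- k)\<^sup>2) (u - z) - scale (2 * (- k)) (jp b z - b)) +
      (scale ?\<beta> u + scale (2 * k\<^sup>2) (u - z) - scale (2 * k) (jp' b z - b)) \<in> C"
    using fst.square_shift_bound[OF b z, of "-k"] snd.square_shift_bound[OF b, of z k] z
    by (intro fst.ord.cone_add) (simp_all add: norms_agree b)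
  moreover have "(scale ?\<beta> u + scale (2 * (- k)\<^sup>2) (u - z) - scale (2 * (- k)) (jp b z - b)) +
      (scale ?\<beta> u + scale (2 * k\<^sup>2) (u - z) - scale (2 * k) (jp' b z - b)) = ?s"
    using fst.scale_left_distrib[of ?\<beta> ?\<beta> u] fst.scale_left_distrib[of "2 * k\<^sup>2" "2 * k\<^sup>2" "u - z"]
    by (simp add: B_def fst.scale_right_diff_distrib)
  ultimately have "scale (1 / (2 * k)) ?s \<in> C"
    using k by (intro fst.ord.cone_scale) auto
  moreover have "scale (1 / (2 * k)) ?s = scale (?\<beta> / k) u + scale (2 * k) (u - z) + B b z"
    using k by (simp add: fst.scale_right_distrib power2_eq_square)
  ultimately have "(scale (?\<beta> / k) u + scale (2 * k) (u - z) + B b z) + (scale r u - (z + B b z)) \<in> C"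
    using fst.ord.cone_add[OF _ r] by (simp only:)
  moreover have "(scale (?\<beta> / k) u + scale (2 * k) (u - z) + B b z) + (scale r u - (z + B b z)) =
      scale (r + ?\<beta> / k + 2 * k) u - scale (1 + 2 * k) z"
    by (simp add: fst.scale_left_distrib fst.scale_right_diff_distrib algebra_simps)
  ultimately have "scale (1 / (1 + 2 * k)) (scale (r + ?\<beta> / k + 2 * k) u - scale (1 + 2 * k) z) \<in> C"
    using k by (intro fst.ord.cone_scale) auto
  then show ?thesis using k by (simp add: fst.scale_right_diff_distrib)
qed

text \<open>The operators \<open>B b\<close> generate isometries.\<close>

lemma N_le_N_add_B_unit:
  assumes b: "b \<in> V" and z: "z \<in> V" "N z = 1"
  shows "1 \<le> N (z + B b z)"
proof (rule ccontr)
  \<comment> \<open>This \<open>k\<close> makes \<open>(N b)^2 / k\<close> smaller than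
    \<open>1 - r\<close>. That is exactly what brings the factor \<open>c\<close> below 1.\<close>
  define r k c where "r = N (z + B b z)" and "k = ((N b)\<^sup>2 + 1) / (1 - r)"
    and "c = (r + (N b)\<^sup>2 / k + 2 * k) / (1 + 2 * k)"
  assume "\<not> 1 \<le> N (z + B b z)"
  then have r: "0 \<le> r" "r < 1" using b z by (simp_all add: r_def)
  then have k: "0 < k" by (simp add: k_def add_nonneg_pos)
  have "(N b)\<^sup>2 / k = (1 - r) * ((N b)\<^sup>2 / ((N b)\<^sup>2 + 1))" using r by (simp add: k_def)
  also have "\<dots> < (1 - r) * 1"
    using r by (intro mult_strict_left_mono) (simp_all add: add_nonneg_pos divide_less_eq)
  finally have "r + (N b)\<^sup>2 / k < 1" by simp
  then have c: "0 \<le> c" "c < 1" using r k by (simp_all add: c_def divide_less_eq)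
  have eq: "scale r u - (- z + B b (- z)) = scale r u + (z + B b z)" using b z by (simp add: B_simps)
  have "scale r u - (z + B b z) \<in> C" "scale r u + (z + B b z) \<in> C"
    using fst.N_le_iff[of "z + B b z" r] b z r by (simp_all add: r_def)
  then have "scale c u - z \<in> C" "scale c u - (- z) \<in> C"
    using B_order_bound[of b z r k] B_order_bound[of b "- z" r k, unfolded eq] b z k
    unfolding c_def by simp_all
  then have "N z \<le> c" using fst.N_le_iff[of z c] z c by simp
  with c z show False by simp
qed

lemma N_le_N_add_B:
  assumes b: "b \<in> V" and z: "z \<in> V"
  shows "N z \<le> N (z + B b z)"
proof (cases "z = 0")
  case False
  define n where "n = N z"
  have n: "0 < n" using False z fst.N_eq_0[OF z] fst.N_nonneg[OF z] by (simp add: n_def del: fst.N_nonneg)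
  have "1 \<le> N (scale (1/n) z + B b (scale (1/n) z))"
    using b z n by (intro N_le_N_add_B_unit) (simp_all add: fst.N_scale n_def)
  also have "\<dots> = N (z + B b z) / n"
    using b z n fst.N_scale[of "z + B b z" "1/n"] by (simp add: B_simps fst.scale_right_distrib)
  finally show ?thesis using n by (simp add: n_def pos_le_divide_eq)
qed (use b in \<open>simp add: B_def\<close>)

text \<open>Euler steps for the quadratic vector field \<open>y \<mapsto> B y y - B a a\<close>, whose flow would be
  isometric and fix \<open>a\<close>.\<close>

definition euler :: "'v \<Rightarrow> real \<Rightarrow> 'v \<Rightarrow> 'v" where
  "euler a h y = y + scale h (B y y - B a a)"

lemma euler_in [simp]: "a \<in> V \<Longrightarrow> y \<in> V \<Longrightarrow> euler a h y \<in> V"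
  by (simp add: euler_def)

text \<open>Since \<open>B\<close> is symmetric, the difference of the quadratic terms factors. A
  finite difference thus has exactly the form to which \<open>N_le_N_add_B\<close> applies.\<close>

lemma euler_diff:
  assumes "a \<in> V" "y \<in> V" "z \<in> V"
  shows "euler a h y - euler a h z = (y - z) + B (scale h (y + z)) (y - z)"
  using assms B_commute[of y z]
  by (simp add: euler_def B_simps fst.scale_right_diff_distrib fst.scale_right_distrib)

lemma euler_expands:
  assumes "a \<in> V" "y \<in> V" "z \<in> V"
  shows "N (y - z) \<le> N (euler a h y - euler a h z)"
  using assms by (simp add: euler_diff N_le_N_add_B)

text \<open>The expansion estimate is applied with \<open>- b\<close> to the image of
  \<open>y - z\<close>. As \<open>(1 - B b) (1 + B b) = 1 - (B b)^2\<close>, only a term of second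
  order in \<open>h\<close> is lost.\<close>

lemma euler_almost_contracts:
  assumes "a \<in> V" "y \<in> V" "z \<in> V"
  shows "N (euler a h y - euler a h z) \<le> (1 + 4 * h\<^sup>2 * (N (y + z))\<^sup>2) * N (y - z)"
proof -
  let ?d = "y - z" and ?b = "scale h (y + z)"
  let ?v = "?d + B ?b ?d"
  have "N ?v \<le> N (?v + B (- ?b) ?v)" using assms by (intro N_le_N_add_B) auto
  also have "?v + B (- ?b) ?v = ?d - B ?b (B ?b ?d)"
    using assms B_simps(5)[of ?b ?v] B_simps(2)[of ?d "B ?b ?d" ?b] by simp
  finally have "N ?v \<le> N (?d - B ?b (B ?b ?d))" .
  also have "\<dots> \<le> N ?d + N (B ?b (B ?b ?d))" using assms by (intro fst.N_triangle_diff) auto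
  also have "N (B ?b (B ?b ?d)) \<le> 2 * N ?b * N (B ?b ?d)" using assms by (intro N_B) auto
  also have "\<dots> \<le> 2 * N ?b * (2 * N ?b * N ?d)" using assms by (intro mult_left_mono N_B) auto
  also have "N ?b = \<bar>h\<bar> * N (y + z)" using assms by (simp add: fst.N_scale)
  also have "N ?d + 2 * (\<bar>h\<bar> * N (y + z)) * (2 * (\<bar>h\<bar> * N (y + z)) * N ?d) =
      (1 + 4 * h\<^sup>2 * (N (y + z))\<^sup>2) * N ?d"
    by (simp add: algebra_simps power2_eq_square flip: abs_mult)
  finally show ?thesis using assms by (simp add: euler_diff)
qed

context
  fixes a :: 'v and h :: real and K :: nat
  assumes a: "a \<in> V" "N a \<le> 1" and h: "0 \<le> h" and K: "(1 + 64 * h\<^sup>2) ^ K \<le> 2"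
begin

definition orbit :: "nat \<Rightarrow> 'v" where
  "orbit = rec_nat 0 (\<lambda>_. euler a h)"

lemma orbit_simps [simp]: "orbit 0 = 0" "orbit (Suc k) = euler a h (orbit k)"
  by (simp_all add: orbit_def)

lemma orbit_in [simp]: "orbit k \<in> V"
  by (induction k) (simp_all add: a)

text \<open>The point \<open>a\<close> is fixed by the Euler step, and the distance to it starts at
  no more than 1. While the orbit has norm at most 3, its sum with \<open>a\<close> has norm at most
  4, so a step stretches the distance by at most \<open>1 + 4 h^2 4^2\<close>, the base in the
  assumption on \<open>K\<close>. Up to step \<open>K\<close> the distance stays below 2, which
  restores the bound 3.\<close>

lemma orbit_bound: "k \<le> K \<Longrightarrow> N (orbit k) \<le> 3"
proof -
  have fix_a: "euler a h a = a" by (simp add: euler_def)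
  have pow: "(1 + 64 * h\<^sup>2) ^ k \<le> 2" if "k \<le> K" for k
    using power_increasing[OF that, of "1 + 64 * h\<^sup>2"] K by simp
  have 3: "N (orbit k) \<le> 3" if "N (orbit k - a) \<le> 2" for k
    using fst.N_triangle[of "orbit k - a" a] a that by simp
  have "k \<le> K \<Longrightarrow> N (orbit k - a) \<le> (1 + 64 * h\<^sup>2) ^ k" for k
  proof (induction k)
    case (Suc k)
    then have IH: "N (orbit k - a) \<le> (1 + 64 * h\<^sup>2) ^ k" by simp
    then have "N (orbit k) \<le> 3" using pow[of k] Suc.prems 3[of k] by simp
    then have "N (orbit k + a) \<le> 4" using fst.N_triangle[of "orbit k" a] a by simp
    then have "(N (orbit k + a))\<^sup>2 \<le> 4\<^sup>2" using a by (intro power_mono) auto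
    then have "4 * h\<^sup>2 * (N (orbit k + a))\<^sup>2 \<le> 4 * h\<^sup>2 * 4\<^sup>2" by (intro mult_left_mono) auto
    then have "(1 + 4 * h\<^sup>2 * (N (orbit k + a))\<^sup>2) * N (orbit k - a) \<le>
      (1 + 64 * h\<^sup>2) * (1 + 64 * h\<^sup>2) ^ k"
      using IH a by (intro mult_mono) auto
    then show ?case
      using euler_almost_contracts[of a "orbit k" a h] a by (simp add: fix_a)
  qed (use a in simp)
  then show "k \<le> K \<Longrightarrow> N (orbit k) \<le> 3" using pow 3 by (meson order_trans)
qed

text \<open>The reversed orbit is \<open>- orbit\<close> up to \<open>O(h\<^sup>2)\<close>, because the vector field is even.\<close>

lemma orbit_shift:
  assumes "j < K" "Suc m \<le> K"
  shows "N (orbit j + orbit (Suc m)) - 240 * h\<^sup>2 \<le> N (orbit (Suc j) + orbit m)"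
proof -
  let ?X = "\<lambda>y. B y y - B a a"
  define y d e where "y = orbit m" and "d = scale h (?X y)"
    and "e = scale h (B (orbit (Suc m) + y) d)"
  have V: "y \<in> V" "d \<in> V" using a by (simp_all add: y_def d_def)
  then have eV: "e \<in> V" using a by (simp add: e_def)
  have Sm: "orbit (Suc m) = y + d" by (simp add: euler_def y_def d_def)
  have Ny: "N y \<le> 3" "N (y + d) \<le> 3"
    using orbit_bound[of m] orbit_bound[of "Suc m"] assms Sm by (simp_all add: y_def)
  \<comment> \<open>By evenness, the step from \<open>- (y + d)\<close> moves by \<open>d\<close> up
    to the change of the field between \<open>y\<close> and \<open>y + d\<close>, and so returns to
    \<open>- y\<close> with the error \<open>e\<close>.\<close>
  have e: "euler a h (- orbit (Suc m)) = - y + e"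
    unfolding Sm e_def using V a B_commute[of y d]
    by (simp add: euler_def B_simps fst.scale_right_distrib fst.scale_right_diff_distrib)
      (simp add: d_def fst.scale_right_diff_distrib)
  \<comment> \<open>Here 20 is \<open>2 * 3 * 3 + 2 * 1 * 1\<close>, and 240 is
    \<open>2 * 6 * 20\<close>, with 6 bounding the norm of \<open>2 y + d\<close>.\<close>
  have "N (?X y) \<le> 2 * N y * N y + 2 * N a * N a"
    using fst.N_triangle_diff[of "B y y" "B a a"] N_B[of y y] N_B[of a a] V a by simp
  also have "\<dots> \<le> 2 * 3 * 3 + 2 * 1 * 1"
    using Ny a V by (intro add_mono mult_mono) auto
  finally have Nd: "N d \<le> h * 20"
    using h V a by (simp add: d_def fst.N_scale mult_left_mono)
  have "N (y + d + y) \<le> 6" using fst.N_triangle[of "y + d" y] V Ny by simp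
  then have "2 * N (y + d + y) * N d \<le> 2 * 6 * (h * 20)"
    using Nd V h by (intro mult_mono) auto
  moreover have "N (B (y + d + y) d) \<le> 2 * N (y + d + y) * N d" using V by (simp add: N_B)
  ultimately have "N (B (orbit (Suc m) + y) d) \<le> 240 * h" unfolding Sm by linarith
  then have "h * N (B (orbit (Suc m) + y) d) \<le> h * (240 * h)" using h by (intro mult_left_mono) auto
  then have Ne: "N e \<le> 240 * h\<^sup>2"
    using V h a by (simp add: e_def fst.N_scale power2_eq_square del: orbit_simps)
  have "N (orbit j + orbit (Suc m)) \<le> N (euler a h (orbit j) - euler a h (- orbit (Suc m)))"
    using euler_expands[of a "orbit j" "- orbit (Suc m)" h] a by (simp del: orbit_simps)
  also have "euler a h (orbit j) - euler a h (- orbit (Suc m)) = (orbit (Suc j) + orbit m) - e"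
    unfolding e by (simp add: y_def)
  also have "N \<dots> \<le> N (orbit (Suc j) + orbit m) + N e"
    using eV by (intro fst.N_triangle_diff) (simp_all del: orbit_simps)
  finally show ?thesis using Ne by linarith
qed

text \<open>Each application of \<open>orbit_shift\<close> moves one step from one summand to the
  other. After k of them \<open>orbit k + orbit k\<close> has turned into
  \<open>orbit (2 * k) + 0\<close>, at a cost of \<open>240 * h^2\<close> each.\<close>

lemma orbit_double:
  assumes "2 * k \<le> K"
  shows "2 * N (orbit k) - k * (240 * h\<^sup>2) \<le> N (orbit (2 * k))"
proof -
  have "2 * N (orbit k) - d * (240 * h\<^sup>2) \<le> N (orbit (k + d) + orbit (k - d))" if "d \<le> k" for d
    using that
  proof (induction d)
    case 0
    then show ?case using fst.N_scale[of "orbit k" 2] by (simp add: fst.scale_2)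
  next
    case (Suc d)
    then have "N (orbit (k + d) + orbit (k - d)) - 240 * h\<^sup>2 \<le> N (orbit (k + Suc d) + orbit (k - Suc d))"
      using orbit_shift[of "k + d" "k - Suc d"] assms by (simp add: Suc_diff_Suc del: orbit_simps)
    moreover have "2 * N (orbit k) - d * (240 * h\<^sup>2) \<le> N (orbit (k + d) + orbit (k - d))"
      using Suc by simp
    moreover have "real (Suc d) * (240 * h\<^sup>2) = d * (240 * h\<^sup>2) + 240 * h\<^sup>2"
      by (simp add: algebra_simps)
    ultimately show ?case by linarith
  qed
  from this[of k] show ?thesis by (simp flip: mult_2)
qed

text \<open>The first step has norm \<open>h * N (B a a)\<close>. Each doubling of time doubles both
  this term and the accumulated error, and adds one new error of size
  \<open>240 * 2^M * h^2\<close>; hence the factor \<open>M\<close>.\<close>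

lemma orbit_power:
  "2 ^ M \<le> K \<Longrightarrow> 2 ^ M * h * N (B a a) - 240 * real M * 2 ^ M * h\<^sup>2 \<le> N (orbit (2 ^ M))"
proof (induction M)
  case 0
  then show ?case using a h fst.N_minus[of "B a a"]
    by (simp add: euler_def fst.N_scale del: fst.N_minus) (simp add: B_def)
next
  case (Suc M)
  define P Q where "P = 2 ^ M * h\<^sup>2" and "Q = 2 ^ M * h * N (B a a)"
  have eq: "240 * real (Suc M) * 2 ^ Suc M * h\<^sup>2 = 480 * (real M * P) + 480 * P"
    "240 * real M * 2 ^ M * h\<^sup>2 = 240 * (real M * P)" "2 ^ M * (240 * h\<^sup>2) = 240 * P"
    "2 ^ Suc M * h * N (B a a) = 2 * Q"
    by (simp_all add: P_def Q_def algebra_simps)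
  have "2 * N (orbit (2 ^ M)) - 240 * P \<le> N (orbit (2 ^ Suc M))"
    using orbit_double[of "2 ^ M"] Suc.prems eq(3) by simp
  moreover have "Q - 240 * (real M * P) \<le> N (orbit (2 ^ M))"
    using Suc eq(2) by (simp add: Q_def)
  moreover have "0 \<le> P" by (simp add: P_def)
  ultimately show ?case unfolding eq by linarith
qed

end

lemma B_diag_eq_0:
  assumes a: "a \<in> V" "N a \<le> 1"
  shows "B a a = 0"
proof (rule ccontr)
  assume "B a a \<noteq> 0"
  \<comment> \<open>At time \<open>T\<close> the linear growth amounts to 4, while
    \<open>orbit_bound\<close> allows only 3. With \<open>h = T / 2^M\<close>, a large
    \<open>M\<close> makes the error smaller than 1 and also satisfies the assumption on the number
    of steps.\<close>
  define \<delta> T where "\<delta> = N (B a a)" and "T = 4 / \<delta>"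
  have \<delta>: "0 < \<delta>" using a \<open>B a a \<noteq> 0\<close> fst.N_eq_0[of "B a a"] fst.N_nonneg[of "B a a"]
    by (simp add: \<delta>_def del: fst.N_nonneg)
  then have T: "0 < T" by (simp add: T_def)
  have "(\<lambda>M. 64 * T\<^sup>2 * inverse (2 ^ M)) \<longlonglongrightarrow> 64 * T\<^sup>2 * 0"
    by (intro tendsto_intros LIMSEQ_inverse_realpow_zero) simp
  then have "\<forall>\<^sub>F M in sequentially. 64 * T\<^sup>2 * inverse (2 ^ M) < ln 2"
    by (intro order_tendstoD(2)) auto
  moreover have "(\<lambda>M. 240 * T\<^sup>2 * (of_nat M / 2 ^ M)) \<longlonglongrightarrow> 240 * T\<^sup>2 * 0"
    by (intro tendsto_mult tendsto_const lim_n_over_pown) simp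
  then have "\<forall>\<^sub>F M in sequentially. 240 * T\<^sup>2 * (of_nat M / 2 ^ M) < 1"
    by (intro order_tendstoD(2)) auto
  ultimately have "\<forall>\<^sub>F M in sequentially. 64 * T\<^sup>2 * inverse (2 ^ M) < ln 2 \<and> 240 * T\<^sup>2 * (of_nat M / 2 ^ M) < 1"
    by eventually_elim simp
  then obtain M where M: "64 * T\<^sup>2 * inverse (2 ^ M) < ln 2" "240 * T\<^sup>2 * (real M / 2 ^ M) < 1"
    using eventually_sequentially by auto
  define h where "h = T / 2 ^ M"
  have h: "0 \<le> h" using T by (simp add: h_def)
  have "(1 + 64 * h\<^sup>2) ^ (2 ^ M) \<le> exp (64 * h\<^sup>2) ^ (2 ^ M)"
    by (intro power_mono exp_ge_add_one_self) simp
  also have "\<dots> = exp (64 * T\<^sup>2 * inverse (2 ^ M))"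
    by (simp add: h_def exp_of_nat_mult[symmetric] field_simps power2_eq_square)
  also have "\<dots> \<le> exp (ln 2)" using M(1) by (subst exp_le_cancel_iff) simp
  finally have K: "(1 + 64 * h\<^sup>2) ^ (2 ^ M) \<le> 2" by simp
  have "2 ^ M * h * \<delta> - 240 * real M * 2 ^ M * h\<^sup>2 \<le> 3"
    using orbit_power[OF a h K, of M] orbit_bound[OF a h K, of "2 ^ M"] by (simp add: \<delta>_def)
  moreover have "2 ^ M * h * \<delta> = 4" using \<delta> by (simp add: h_def T_def)
  moreover have "240 * real M * 2 ^ M * h\<^sup>2 = 240 * T\<^sup>2 * (real M / 2 ^ M)"
    by (simp add: h_def field_simps power2_eq_square)
  ultimately show False using M(2) by simp
qed

lemma products_agree:
  assumes "x \<in> V" "y \<in> V"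
  shows "jp x y = jp' x y"
proof -
  have D: "B a a = 0" if "a \<in> V" for a
  proof (cases "N a = 0")
    case True
    then show ?thesis using fst.N_eq_0[OF that] by (simp add: B_def)
  next
    case False
    define n where "n = N a"
    have n: "0 < n" using False fst.N_nonneg[OF that] by (simp add: n_def del: fst.N_nonneg)
    have "B (scale (1/n) a) (scale (1/n) a) = 0"
      using n that by (intro B_diag_eq_0) (auto simp: fst.N_scale n_def)
    then show ?thesis using n that by (simp add: B_simps)
  qed
  have "B (x + y) (x + y) = 0" using assms by (intro D) simp
  then have "B x y + B x y = 0" using assms D[of x] D[of y] B_commute[of y x] by (simp add: B_simps)
  then have "B x y = 0" by (rule fst.double_eq_0)
  then show ?thesis by (simp add: B_def)
qed

end

lemma (in ordered_jb_algebra) compatible: "compatible_jb scale V C u jp"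
  unfolding compatible_jb_def jb_algebra_def
  by (intro conjI exI[of _ N] ballI real_jordan_algebra_axioms norm_N complete_N N_jp N_square
      N_square_add u_in u_jp C_squares)

lemma compatible_jb_ordered:
  assumes "order_unit_space scale V C v" "compatible_jb scale V C v jp"
  obtains N where "ordered_jb_algebra scale V jp v N C"
proof -
  obtain N where "norm_on scale V N \<and> complete_on V N \<and>
        (\<forall>a\<in>V. \<forall>b\<in>V. N (jp a b) \<le> N a * N b) \<and>
        (\<forall>a\<in>V. N (jp a a) = (N a)\<^sup>2) \<and>
        (\<forall>a\<in>V. \<forall>b\<in>V. N (jp a a) \<le> N (jp a a + jp b b))" and "real_jordan_algebra scale V jp"
    using assms(2) unfolding compatible_jb_def jb_algebra_def by auto
  then have "ordered_jb_algebra scale V jp v N C"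
    using assms(1) assms(2)[unfolded compatible_jb_def]
    by (auto simp: ordered_jb_algebra_def unital_jb_algebra_def unital_jordan_algebra_def
      unital_jb_algebra_axioms_def unital_jordan_algebra_axioms_def ordered_jb_algebra_axioms_def)
  then show ?thesis by (rule that)
qed

lemma compatible_jb_unique:
  assumes "order_unit_space scale V C v" "compatible_jb scale V C v jp" "compatible_jb scale V C v jp'"
    and "x \<in> V" "y \<in> V"
  shows "jp x y = jp' x y"
proof -
  obtain N N' where "ordered_jb_algebra scale V jp v N C" "ordered_jb_algebra scale V jp' v N' C"
    using compatible_jb_ordered assms by metis
  then interpret two_jb_products scale V jp jp' v N N' C by (simp add: two_jb_products_def)
  show ?thesis by (rule products_agree) fact+
qed

context ordered_jb_algebra
begin

text \<open>Transporting \<open>jp\<close> along \<open>T\<close> gives a second product with the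
  same unit and the same cone of squares, so uniqueness identifies it with
  \<open>jp\<close>.\<close>

lemma order_automorphism_is_jordan:
  assumes T: "\<And>x. x \<in> V \<Longrightarrow> T x \<in> V" "\<And>x y. x \<in> V \<Longrightarrow> y \<in> V \<Longrightarrow> T (x + y) = T x + T y"
      "\<And>r x. x \<in> V \<Longrightarrow> T (scale r x) = scale r (T x)" "\<And>x. x \<in> C \<Longrightarrow> T x \<in> C"
    and T': "\<And>x. x \<in> V \<Longrightarrow> T' x \<in> V" "\<And>x y. x \<in> V \<Longrightarrow> y \<in> V \<Longrightarrow> T' (x + y) = T' x + T' y"
      "\<And>r x. x \<in> V \<Longrightarrow> T' (scale r x) = scale r (T' x)" "\<And>x. x \<in> C \<Longrightarrow> T' x \<in> C"
    and inv: "\<And>x. x \<in> V \<Longrightarrow> T' (T x) = x" "\<And>x. x \<in> V \<Longrightarrow> T (T' x) = x" and Tu: "T u = u"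
    and xy: "x \<in> V" "y \<in> V"
  shows "T (jp x y) = jp (T x) (T y)"
proof -
  define jp' where "jp' x y = T' (jp (T x) (T y))" for x y
  have Tj: "T (jp' x y) = jp (T x) (T y)" if "x \<in> V" "y \<in> V" for x y
    using that by (simp add: jp'_def inv T)
  have Tm: "T (x - y) = T x - T y" if "x \<in> V" "y \<in> V" for x y
    using T(2)[of x "- y"] T(3)[of y "-1"] that by simp
  have T0: "T x = 0 \<longleftrightarrow> x = 0" if "x \<in> V" for x
  proof
    have "T' 0 = 0" using T'(3)[of 0 0] by simp
    then show "T x = 0 \<Longrightarrow> x = 0" using inv(1)[OF that] by simp
    show "x = 0 \<Longrightarrow> T x = 0" using T(3)[of 0 0] by simp
  qed
  have inj: "x = y" if "x \<in> V" "y \<in> V" "T x = T y" for x y using inv(1) that by metis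
  have "ordered_jb_algebra scale V jp' u (\<lambda>x. N (T x)) C"
  proof unfold_locales
    show "jp' a b \<in> V" if "a \<in> V" "b \<in> V" for a b using that by (simp add: jp'_def T T')
    show "jp' a b = jp' b a" if "a \<in> V" "b \<in> V" for a b
      using that jp_commute[of "T a" "T b"] by (simp add: jp'_def T)
    show "jp' (a + b) c = jp' a c + jp' b c" if "a \<in> V" "b \<in> V" "c \<in> V" for a b c
      using that by (simp add: jp'_def T T' jp_bilinear)
    show "jp' (scale r a) b = scale r (jp' a b)" if "a \<in> V" "b \<in> V" for r a b
      using that by (simp add: jp'_def T T' jp_bilinear)
    show "jp' a (jp' b (jp' a a)) = jp' (jp' a b) (jp' a a)" if "a \<in> V" "b \<in> V" for a b
      using that jordan_identity[of "T a" "T b"] by (simp add: jp'_def T T' inv)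
    show "jp' u x = x" if "x \<in> V" for x using that by (simp add: jp'_def T T' inv Tu)
    show "norm_on scale V (\<lambda>x. N (T x))"
      using N_nonneg N_triangle N_scale T T0 by (simp add: norm_on_def N_eq_0)
    show "complete_on V (\<lambda>x. N (T x))"
      unfolding complete_on_def
    proof (intro allI impI)
      fix X :: "nat \<Rightarrow> 'v" assume X: "range X \<subseteq> V"
        and cau: "\<forall>\<epsilon>>0. \<exists>M. \<forall>m\<ge>M. \<forall>n\<ge>M. N (T (X m - X n)) < \<epsilon>"
      have XV: "X n \<in> V" for n using X by auto
      have "range (\<lambda>n. T (X n)) \<subseteq> V" using XV T by auto
      moreover have "\<forall>\<epsilon>>0. \<exists>M. \<forall>m\<ge>M. \<forall>n\<ge>M. N (T (X m) - T (X n)) < \<epsilon>"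
        using cau XV by (simp add: Tm)
      ultimately obtain l where l: "l \<in> V" "(\<lambda>n. N (T (X n) - l)) \<longlonglongrightarrow> 0"
        using complete_N unfolding complete_on_def by metis
      then show "\<exists>l\<in>V. (\<lambda>n. N (T (X n - l))) \<longlonglongrightarrow> 0"
        using XV by (intro bexI[of _ "T' l"]) (simp_all add: Tm T' inv)
    qed
    show "C = {jp' x x |x. x \<in> V}"
    proof (intro equalityI subsetI)
      fix c assume c: "c \<in> C"
      then obtain a where a: "a \<in> V" "T c = jp a a" using T(4) C_squareE by blast
      then have "c = jp' (T' a) (T' a)" using c inv(1)[of c] by (simp add: jp'_def inv)
      then show "c \<in> {jp' x x |x. x \<in> V}" using a T' by blast
    next
      fix c assume "c \<in> {jp' x x |x. x \<in> V}"
      then obtain x where "x \<in> V" "c = T' (jp (T x) (T x))" by (auto simp: jp'_def)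
      then show "c \<in> C" using T(1) T'(4) square_in_C by simp
    qed
    show "N (T (jp' a b)) \<le> N (T a) * N (T b)" if "a \<in> V" "b \<in> V" for a b
      using that by (simp add: Tj N_jp T)
    show "N (T (jp' a a)) = (N (T a))\<^sup>2" if "a \<in> V" for a
      using that by (simp add: Tj N_square T)
    show "N (T (jp' a a)) \<le> N (T (jp' a a + jp' b b))" if "a \<in> V" "b \<in> V" for a b
    proof -
      have "jp' a a \<in> V" "jp' b b \<in> V" using that by (simp_all add: jp'_def T T')
      then show ?thesis using that N_square_add[of "T a" "T b"] by (simp add: Tj T)
    qed
  qed (simp_all add: subspace_V)
  then interpret P: ordered_jb_algebra scale V jp' u "\<lambda>x. N (T x)" C .
  have "jp x y = jp' x y"
    using compatible_jb_unique[OF ord.order_unit_space_axioms compatible P.compatible] xy .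
  then show ?thesis using Tj xy by simp
qed

end

context order_unit_space
begin

text \<open>Division by \<open>s\<close> gives \<open>y \<ge> - (l / s) v\<close>, and the
  Archimedean property lets \<open>s\<close> grow.\<close>

lemma nonneg_of_multiples:
  assumes y: "y \<in> V" "w \<in> V" and pos: "\<And>s. 0 < s \<Longrightarrow> scale s y + w \<in> C"
  shows "y \<in> C"
proof -
  obtain l where l: "0 \<le> l" "scale l v - w \<in> C" using order_unit[OF y(2)] by auto
  have "scale r v - (- y) \<in> C" if r: "0 < r" for r
  proof -
    define s where "s = (l + 1) / r"
    have s: "0 < s" using l r by (simp add: s_def)
    have "(scale s y + w) + (scale l v - w) \<in> C" by (rule cone_add[OF pos[OF s] l(2)])
    then have "scale s y + scale l v \<in> C" by simp
    then have "scale (1/s) (scale s y + scale l v) \<in> C" using s by (intro cone_scale) auto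
    then have 1: "y + scale (l / s) v \<in> C" using s by (simp add: scale_right_distrib)
    have "l / s \<le> r" using l r by (simp add: s_def divide_le_eq field_simps)
    then have "scale (r - l / s) v \<in> C" using unit_pos by (intro cone_scale) auto
    with 1 have "(y + scale (l / s) v) + scale (r - l / s) v \<in> C" by (rule cone_add)
    then show ?thesis by (simp add: scale_left_diff_distrib add.commute)
  qed
  then show ?thesis using archimedean[of "- y"] y subspace_neg[OF subspace_V] by simp
qed

text \<open>An affine function that is nonnegative on a whole line is constant. This is the device
  that annihilates off-diagonal parts below.\<close>

lemma zero_of_multiples:
  assumes y: "y \<in> V" "w \<in> V" and pos: "\<And>s. scale s y + w \<in> C"
  shows "y = 0"
proof (rule cone_proper)
  show "y \<in> C" by (rule nonneg_of_multiples[OF y pos])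
  have "scale s (- y) + w \<in> C" for s using pos[of "- s"] by simp
  then show "- y \<in> C" using y subspace_neg[OF subspace_V] by (intro nonneg_of_multiples[of "- y" w]) auto
qed

end

section \<open>Complementary compressions\<close>

text \<open>Here \<open>F\<close> and \<open>G\<close> behave like the compressions \<open>x \<mapsto> q x q\<close> and
  \<open>x \<mapsto> (1 - q) x (1 - q)\<close> by a scalar projection \<open>q\<close>.\<close>

locale complementary_compressions = ordered_jb_algebra scale V jp u N C
  for scale :: "real \<Rightarrow> 'v::ab_group_add \<Rightarrow> 'v" and V jp u N C +
  fixes F G :: "'v \<Rightarrow> 'v" and p :: 'v
  assumes F_in: "x \<in> V \<Longrightarrow> F x \<in> V" and G_in: "x \<in> V \<Longrightarrow> G x \<in> V"
    and F_add: "\<lbrakk>x \<in> V; y \<in> V\<rbrakk> \<Longrightarrow> F (x + y) = F x + F y"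
    and G_add: "\<lbrakk>x \<in> V; y \<in> V\<rbrakk> \<Longrightarrow> G (x + y) = G x + G y"
    and F_scale: "x \<in> V \<Longrightarrow> F (scale r x) = scale r (F x)"
    and G_scale: "x \<in> V \<Longrightarrow> G (scale r x) = scale r (G x)"
    and F_pos: "x \<in> C \<Longrightarrow> F x \<in> C" and G_pos: "x \<in> C \<Longrightarrow> G x \<in> C"
    and F_unit: "F u = p" and G_unit: "G u = u - p" and F_p: "F p = p" and G_p: "G p = 0"
    and G_kernel: "\<lbrakk>x \<in> C; G x = 0\<rbrakk> \<Longrightarrow> F x = x"
    and F_kernel: "\<lbrakk>x \<in> C; F x = 0\<rbrakk> \<Longrightarrow> G x = x"
begin

lemma F_diff: "x \<in> V \<Longrightarrow> y \<in> V \<Longrightarrow> F (x - y) = F x - F y"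
  using F_add[of x "- y"] F_scale[of y "-1"] by simp

lemma G_diff: "x \<in> V \<Longrightarrow> y \<in> V \<Longrightarrow> G (x - y) = G x - G y"
  using G_add[of x "- y"] G_scale[of y "-1"] by simp

lemma p_in [simp]: "p \<in> V"
  using F_in[of u] F_unit by simp

lemma swap: "complementary_compressions scale V jp u N C G F (u - p)"
  by unfold_locales (simp_all add: F_in G_in F_add G_add F_scale G_scale F_pos G_pos F_unit G_unit
      F_diff G_diff F_p G_p G_kernel F_kernel)

text \<open>Compressing \<open>(u - p)\<^sup>2 \<ge> 0\<close> and \<open>p\<^sup>2 \<le> u\<close> gives \<open>F (p\<^sup>2) = p\<close>, hence \<open>F ((u - p)\<^sup>2) = 0\<close>.\<close>

lemma p_idempotent: "jp p p = p"
proof -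
  have pC: "p \<in> C" "u - p \<in> C" using F_pos[of u] G_pos[of u] F_unit G_unit ord.unit_pos by simp_all
  have le_u: "u - jp q q \<in> C" if "q \<in> C" "u - q \<in> C" for q
    using that square_le_self[of q] ord.cone_add[of "q - jp q q" "u - q"] by simp
  have "F (u - jp p p) \<in> C" using F_pos le_u pC by simp
  then have 1: "p - F (jp p p) \<in> C" by (simp add: F_diff F_unit)
  have sq: "jp (u - p) (u - p) = u - (p + p) + jp p p" by (simp add: jp_bilinear algebra_simps)
  have "F (jp (u - p) (u - p)) \<in> C" by (intro F_pos square_in_C) simp
  then have 2: "F (jp p p) - p \<in> C" by (simp add: sq F_diff F_add F_unit F_p)
  have Fpp: "F (jp p p) = p" using ord.cone_proper[of "p - F (jp p p)"] 1 2 by simp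
  interpret sym: complementary_compressions scale V jp u N C G F "u - p" by (rule swap)
  have "G (u - jp (u - p) (u - p)) \<in> C" using G_pos le_u pC by simp
  then have 1: "(u - p) - G (jp (u - p) (u - p)) \<in> C" by (simp add: G_diff G_unit)
  have "G (jp p p) \<in> C" by (intro G_pos square_in_C) simp
  then have 2: "G (jp (u - p) (u - p)) - (u - p) \<in> C" by (simp add: sq G_diff G_add G_unit G_p)
  have "G (jp (u - p) (u - p)) = u - p" using ord.cone_proper[of "(u - p) - G (jp (u - p) (u - p))"] 1 2 by simp
  then have "G (u - jp (u - p) (u - p)) = 0" by (simp add: G_diff G_unit)
  then have "F (u - jp (u - p) (u - p)) = u - jp (u - p) (u - p)"
    using G_kernel le_u pC by simp
  then have "p + jp p p = p + p" by (simp add: sq F_diff F_add F_unit F_p Fpp)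
  then show ?thesis by simp
qed

text \<open>Square roots taken inside the corner show that a suitable multiple \<open>y\<close> of
  \<open>x\<close> lies between \<open>- p\<close> and \<open>p\<close>. Since
  \<open>G p = 0\<close>, this squeezes \<open>G y\<close> to 0, and \<open>G_kernel\<close> then
  applies to \<open>p - y\<close>. The 1 in \<open>n\<close> only prevents a division by
  zero.\<close>

lemma compress_peirce_one:
  assumes x: "x \<in> peirce p 1"
  shows "F x = x \<and> G x = 0"
proof -
  note V = peirce_in[OF x]
  interpret corner: unital_jb_algebra scale "peirce p 1" jp p N
    by (rule corner_jb_algebra) (simp_all add: p_idempotent)
  have bound: "p - y \<in> C" if y: "y \<in> peirce p 1" "N y \<le> 1" for y
    using corner.sqrt_exists[OF y] square_in_C peirce_in by metis
  define n where "n = N x + 1"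
  have n: "0 < n" using V by (simp add: n_def add_nonneg_pos)
  define y where "y = scale (1/n) x"
  have y: "y \<in> peirce p 1" "- y \<in> peirce p 1" "N y \<le> 1" "N (- y) \<le> 1" "y \<in> V"
    using x V n corner.V_closed by (simp_all add: y_def N_scale n_def)
  then have pos: "p - y \<in> C" "p + y \<in> C" using bound[of y] bound[of "- y"] by simp_all
  have "- G y \<in> C" "G y \<in> C" using G_pos[OF pos(1)] G_pos[OF pos(2)] y by (simp_all add: G_diff G_add G_p)
  then have Gy: "G y = 0" using ord.cone_proper by blast
  then have "G (p - y) = 0" using y by (simp add: G_diff G_p)
  then have "F (p - y) = p - y" using G_kernel pos by simp
  then have "F y = y" using y by (simp add: F_diff F_p)
  moreover have "x = scale n y" using n by (simp add: y_def)
  ultimately show ?thesis using Gy y by (simp add: F_scale G_scale)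
qed

lemma compress_peirce_zero:
  assumes x: "x \<in> peirce p 0"
  shows "F x = 0 \<and> G x = x"
proof -
  interpret sym: complementary_compressions scale V jp u N C G F "u - p" by (rule swap)
  show ?thesis using sym.compress_peirce_one peirce_complement[OF _ x] by simp
qed

text \<open>The square of \<open>s (u - p) + x\<close> is \<open>s^2 (u - p) + s x + x^2\<close>. As
  \<open>F\<close> kills the quadratic term, \<open>s F x + F (x^2)\<close> is positive for every
  real \<open>s\<close>.\<close>

lemma compress_peirce_half_F:
  assumes x: "x \<in> peirce p (1/2)"
  shows "F x = 0"
proof (rule ord.zero_of_multiples)
  note V = peirce_in[OF x]
  show "F x \<in> V" "F (jp x x) \<in> V" using V by (simp_all add: F_in)
  fix s
  have "F (jp (scale s (u - p) + x) (scale s (u - p) + x)) \<in> C"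
    using V by (intro F_pos square_in_C) simp
  also have "jp (scale s (u - p) + x) (scale s (u - p) + x) =
      scale (s * s) (u - p) + (scale s (jp (u - p) x) + scale s (jp (u - p) x)) + jp x x"
    using V p_idempotent by (simp add: jp_bilinear jp_commute[of x p] scale_right_distrib scale_right_diff_distrib)
  also have "jp (u - p) x = scale (1/2) x"
    using peirce_complement[OF _ x] by (simp add: peirce_def)
  also have "scale s (scale (1/2) x) + scale s (scale (1/2) x) = scale s x"
    using scale_half[of "scale s x"] by (simp add: mult.commute)
  finally show "scale s (F x) + F (jp x x) \<in> C"
    using V by (simp add: F_add F_scale F_diff F_unit F_p)
qed

lemma compress_peirce_half:
  assumes x: "x \<in> peirce p (1/2)"
  shows "F x = 0 \<and> G x = 0"
proof -
  interpret sym: complementary_compressions scale V jp u N C G F "u - p" by (rule swap)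
  show ?thesis
    using compress_peirce_half_F[OF x] sym.compress_peirce_half_F peirce_complement[OF _ x] by simp
qed

text \<open>On the three Peirce spaces the right-hand side has the eigenvalues 1, 1/2 and 0.
  Multiplication by \<open>p\<close> is thereby expressed through maps defined without the
  product.\<close>

lemma jp_p: "x \<in> V \<Longrightarrow> jp p x = scale (1/2) (x + F x - G x)"
proof -
  assume "x \<in> V"
  then obtain a b c where x: "a \<in> peirce p 1" "b \<in> peirce p (1/2)" "c \<in> peirce p 0" "x = a + b + c"
    using peirce_decomposition[OF p_in p_idempotent] by metis
  note V = x(1-3)[THEN peirce_in]
  have "jp p x = a + scale (1/2) b" using x V by (simp add: jp_bilinear) (simp add: peirce_def)
  moreover have "x + F x - G x = (a + a) + b"
    using compress_peirce_one[OF x(1)] compress_peirce_half[OF x(2)] compress_peirce_zero[OF x(3)] V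
    by (simp add: x(4) F_add G_add)
  ultimately show ?thesis using scale_half[of a] by (simp add: scale_right_distrib)
qed

end

section \<open>Matrices over an operator system\<close>

text \<open>Treats both scalar fields at once: \<open>kconj\<close> is later the identity on the
  reals or complex conjugation.\<close>

locale star_system = operator_system scale kconj star pos e
  for scale :: "'k::real_normed_field \<Rightarrow> 'e::ab_group_add \<Rightarrow> 'e" and kconj star pos e +
  assumes kconj_add: "kconj (a + b) = kconj a + kconj b"
    and kconj_mult: "kconj (a * b) = kconj a * kconj b"
    and kconj_kconj: "kconj (kconj a) = a"
    and kconj_of_real: "kconj (of_real r) = of_real r"
begin

declare of_real_divide [simp del] of_real_power [simp del]

lemma kconj_0: "kconj 0 = 0" and kconj_1: "kconj 1 = 1"
  using kconj_of_real[of 0] kconj_of_real[of 1] by simp_all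

lemmas kconj_simps = kconj_kconj kconj_of_real kconj_0 kconj_1

lemma kconj_minus: "kconj (- a) = - kconj a"
  using kconj_add[of a "- a"] by (simp add: kconj_simps eq_neg_iff_add_eq_0 add.commute)

lemma kconj_diff: "kconj (a - b) = kconj a - kconj b"
  using kconj_add[of a "- b"] by (simp add: kconj_minus kconj_simps)

lemma kconj_sum: "kconj (sum f A) = (\<Sum>x\<in>A. kconj (f x))"
  by (induction A rule: infinite_finite_induct) (simp_all add: kconj_add kconj_simps)

lemma star_0 [simp]: "star 0 = 0"
  using star_add[of 0 0] by simp

lemma star_minus: "star (- x) = - star x"
  using star_add[of x "- x"] by (simp add: eq_neg_iff_add_eq_0 add.commute)

lemma star_diff: "star (x - y) = star x - star y"
  using star_add[of x "- y"] by (simp add: star_minus)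

lemma star_sum: "star (sum f A) = (\<Sum>x\<in>A. star (f x))"
  by (induction A rule: infinite_finite_induct) (simp_all add: star_add)

abbreviation rscale :: "real \<Rightarrow> 'e \<Rightarrow> 'e" where "rscale r \<equiv> scale (of_real r)"

lemma star_rscale: "star (rscale r x) = rscale r (star x)"
  by (simp add: star_scale kconj_simps)

lemma half_half: "rscale (1/2) x + rscale (1/2) x = x"
  by (simp flip: scale_left_distrib of_real_add)

lemma star_e [simp]: "star e = e"
proof -
  interpret ou: order_unit_space "mat_rscale scale" "sa_mats star 1" "pos 1" "diag_mat e 1"
    by (rule order_unit_level) simp
  have "diag_mat e 1 \<in> sa_mats star 1" using ou.unit_pos ou.cone_subset by auto
  then have "mat_star star (diag_mat e 1) 0 0 = diag_mat e 1 0 0" by (simp add: sa_mats_def)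
  then show ?thesis by (simp add: mat_star_def diag_mat_def mat_def)
qed

abbreviation sa :: "nat \<Rightarrow> 'e matrix set" where "sa n \<equiv> sa_mats star n"
abbreviation mscale :: "real \<Rightarrow> 'e matrix \<Rightarrow> 'e matrix" where "mscale \<equiv> mat_rscale scale"

lemma sa_iff: "x \<in> sa n \<longleftrightarrow> (\<forall>i j. n \<le> i \<or> n \<le> j \<longrightarrow> x i j = 0) \<and> (\<forall>i j. star (x i j) = x j i)"
proof -
  have "mat_star star x = x \<longleftrightarrow> (\<forall>i j. star (x i j) = x j i)"
    unfolding mat_star_def fun_eq_iff by metis
  then show ?thesis by (auto simp: sa_mats_def mats_def)
qed

lemma sa_star: "x \<in> sa n \<Longrightarrow> star (x i j) = x j i"
  by (simp add: sa_iff)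

lemma sa_outside: "x \<in> sa n \<Longrightarrow> n \<le> i \<or> n \<le> j \<Longrightarrow> x i j = 0"
  by (auto simp: sa_iff)

lemma sa_mono: "m \<le> n \<Longrightarrow> sa m \<subseteq> sa n"
  by (auto simp: sa_iff)

lemma mscale_apply [simp]: "mscale r x i j = rscale r (x i j)"
  by (simp add: mat_rscale_def)

text \<open>Of unbounded size, so that one constant is the identity of every level and, in
  rectangular sandwiches, also the inclusion of and truncation to a smaller level.\<close>

definition E1 :: "'k matrix" where "E1 i j = (if i = j then 1 else 0)"

text \<open>The polarization of \<open>compress\<close>: separate outer factors permit the expansion
  of a compression by a sum, and one-sided products arise by putting \<open>E1\<close> on the other
  side.\<close>

definition sandwich :: "nat \<Rightarrow> nat \<Rightarrow> 'k matrix \<Rightarrow> 'k matrix \<Rightarrow> 'e matrix \<Rightarrow> 'e matrix" where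
  "sandwich m n a b x = mat n (\<lambda>i j. \<Sum>k<m. \<Sum>l<m. scale (kconj (a k i) * b l j) (x k l))"

lemma compress_sandwich: "compress scale kconj m n b x = sandwich m n b b x"
  by (simp add: compress_def sandwich_def)

lemma sandwich_apply:
  "i < n \<Longrightarrow> j < n \<Longrightarrow> sandwich m n a b x i j = (\<Sum>k<m. \<Sum>l<m. scale (kconj (a k i) * b l j) (x k l))"
  by (simp add: sandwich_def mat_def)

lemma sandwich_outside: "n \<le> i \<or> n \<le> j \<Longrightarrow> sandwich m n a b x i j = 0"
  by (auto simp: sandwich_def mat_def)

lemma sandwich_eqI:
  assumes "\<And>i j. i < n \<Longrightarrow> j < n \<Longrightarrow> sandwich m n a b x i j = y i j"
    and "\<And>i j. n \<le> i \<or> n \<le> j \<Longrightarrow> y i j = 0"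
  shows "sandwich m n a b x = y"
proof (intro ext)
  fix i j show "sandwich m n a b x i j = y i j"
    using assms sandwich_outside[of n i j] by (cases "i < n \<and> j < n") auto
qed

lemma sandwich_cong:
  assumes "\<And>k i. k < m \<Longrightarrow> i < n \<Longrightarrow> a k i = a' k i" "\<And>k i. k < m \<Longrightarrow> i < n \<Longrightarrow> b k i = b' k i"
    "\<And>k l. k < m \<Longrightarrow> l < m \<Longrightarrow> x k l = x' k l"
  shows "sandwich m n a b x = sandwich m n a' b' x'"
proof (rule sandwich_eqI)
  show "sandwich m n a b x i j = sandwich m n a' b' x' i j" if "i < n" "j < n" for i j
    using that assms by (simp add: sandwich_apply)
qed (rule sandwich_outside)

lemma sandwich_linear:
  "sandwich m n a b (x + y) = sandwich m n a b x + sandwich m n a b y"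
  "sandwich m n a b (mscale r x) = mscale r (sandwich m n a b x)"
  "sandwich m n (a + a') b x = sandwich m n a b x + sandwich m n a' b x"
  "sandwich m n a (b + b') x = sandwich m n a b x + sandwich m n a b' x"
  "sandwich m n (a - a') b x = sandwich m n a b x - sandwich m n a' b x"
  "sandwich m n a (b - b') x = sandwich m n a b x - sandwich m n a b' x"
  "sandwich m n (\<lambda>i j. of_real r * a i j) b x = mscale r (sandwich m n a b x)"
  "sandwich m n a (\<lambda>i j. of_real r * b i j) x = mscale r (sandwich m n a b x)"
  by (auto intro!: sandwich_eqI simp: sandwich_apply sandwich_outside scale_right_distrib sum.distrib
      kconj_add kconj_diff kconj_mult kconj_simps distrib_left distrib_right scale_left_distrib scale_sum_right
      left_diff_distrib right_diff_distrib scale_left_diff_distrib sum_subtractf mult_ac)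

lemma sandwich_star:
  assumes "x \<in> sa m"
  shows "star (sandwich m n a b x i j) = sandwich m n b a x j i"
proof (cases "i < n \<and> j < n")
  case True
  then have "star (sandwich m n a b x i j) = (\<Sum>k<m. \<Sum>l<m. scale (a k i * kconj (b l j)) (x l k))"
    by (simp add: sandwich_apply star_sum star_scale kconj_mult kconj_simps sa_star[OF assms])
  also have "\<dots> = sandwich m n b a x j i"
    using True by (subst sum.swap) (simp add: sandwich_apply mult.commute)
  finally show ?thesis .
qed (auto simp: sandwich_outside)

lemma sandwich_in: "x \<in> sa m \<Longrightarrow> sandwich m n b b x \<in> sa n"
  by (simp add: sa_iff[of _ n] sandwich_star) (auto simp: sandwich_outside)

lemma sandwich_pos: "1 \<le> m \<Longrightarrow> 1 \<le> n \<Longrightarrow> x \<in> pos m \<Longrightarrow> sandwich m n b b x \<in> pos n"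
  using pos_compress by (simp add: compress_sandwich)

definition kmul :: "nat \<Rightarrow> 'k matrix \<Rightarrow> 'k matrix \<Rightarrow> 'k matrix" where
  "kmul n a b i j = (\<Sum>k<n. a i k * b k j)"

lemma sandwich_sandwich:
  "sandwich n p a b (sandwich m n c d x) = sandwich m p (kmul n c a) (kmul n d b) x"
proof (rule sandwich_eqI)
  fix i j assume ij: "i < p" "j < p"
  have "sandwich n p a b (sandwich m n c d x) i j =
    (\<Sum>k<n. \<Sum>l<n. \<Sum>r<m. \<Sum>s<m. scale (kconj (a k i) * b l j * (kconj (c r k) * d s l)) (x r s))"
    using ij by (simp add: sandwich_apply scale_sum_right)
  also have "\<dots> = (\<Sum>k<n. \<Sum>r<m. \<Sum>l<n. \<Sum>s<m. scale (kconj (a k i) * b l j * (kconj (c r k) * d s l)) (x r s))"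
    by (intro sum.cong refl sum.swap)
  also have "\<dots> = (\<Sum>r<m. \<Sum>k<n. \<Sum>l<n. \<Sum>s<m. scale (kconj (a k i) * b l j * (kconj (c r k) * d s l)) (x r s))"
    by (rule sum.swap)
  also have "\<dots> = (\<Sum>r<m. \<Sum>k<n. \<Sum>s<m. \<Sum>l<n. scale (kconj (a k i) * b l j * (kconj (c r k) * d s l)) (x r s))"
    by (intro sum.cong refl sum.swap)
  also have "\<dots> = (\<Sum>r<m. \<Sum>s<m. \<Sum>k<n. \<Sum>l<n. scale (kconj (a k i) * b l j * (kconj (c r k) * d s l)) (x r s))"
    by (intro sum.cong refl sum.swap)
  also have "\<dots> = (\<Sum>r<m. \<Sum>s<m. scale (kconj (kmul n c a r i) * kmul n d b s j) (x r s))"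
    unfolding kmul_def kconj_sum sum_product scale_sum_left
    by (intro sum.cong refl) (simp add: kconj_mult kconj_simps mult_ac)
  finally show "sandwich n p a b (sandwich m n c d x) i j = sandwich m p (kmul n c a) (kmul n d b) x i j"
    using ij by (simp add: sandwich_apply)
qed (rule sandwich_outside)

lemma sandwich_E1 [simp]: "x \<in> sa n \<Longrightarrow> sandwich n n E1 E1 x = x"
proof (rule sandwich_eqI)
  fix i j assume "i < n" "j < n"
  then have "sandwich n n E1 E1 x i j = (\<Sum>k<n. \<Sum>l<n. if l = j then if k = i then x k l else 0 else 0)"
    unfolding sandwich_apply[OF \<open>i < n\<close> \<open>j < n\<close>] by (intro sum.cong refl) (simp add: E1_def kconj_simps)
  then show "sandwich n n E1 E1 x i j = x i j" using \<open>i < n\<close> \<open>j < n\<close> by (simp add: sum.delta)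
qed (auto simp: sa_outside)

lemma kmul_E1 [simp]: "i < n \<Longrightarrow> kmul n E1 b i j = b i j" "j < n \<Longrightarrow> kmul n b E1 i j = b i j"
  by (simp_all add: kmul_def E1_def kconj_simps if_distrib if_distribR sum.delta cong: if_cong)

lemma kmul_linear:
  "kmul n (a - a') b = kmul n a b - kmul n a' b" "kmul n b (a - a') = kmul n b a - kmul n b a'"
  by (simp_all add: kmul_def fun_eq_iff left_diff_distrib right_diff_distrib sum_subtractf)

definition scalar_mat :: "nat \<Rightarrow> 'k matrix \<Rightarrow> 'e matrix" where
  "scalar_mat n q = mat n (\<lambda>i j. scale (q i j) e)"

definition hermitian_projection :: "nat \<Rightarrow> 'k matrix \<Rightarrow> bool" where
  "hermitian_projection n q \<longleftrightarrow>
    (\<forall>i<n. \<forall>j<n. kconj (q j i) = q i j) \<and> (\<forall>i<n. \<forall>j<n. kmul n q q i j = q i j)"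

lemma hermitian_projection_complement:
  assumes "hermitian_projection n q"
  shows "hermitian_projection n (E1 - q)"
  using assms by (auto simp: hermitian_projection_def kmul_linear kconj_diff kconj_simps) (auto simp: E1_def kconj_simps)

lemma sandwich_unit:
  assumes "hermitian_projection n q"
  shows "sandwich n n q q (diag_mat e n) = scalar_mat n q"
proof (rule sandwich_eqI)
  fix i j assume ij: "i < n" "j < n"
  then have "sandwich n n q q (diag_mat e n) i j =
    (\<Sum>k<n. \<Sum>l<n. if l = k then scale (kconj (q k i) * q l j) e else 0)"
    unfolding sandwich_apply[OF ij] by (intro sum.cong refl) (simp add: diag_mat_def mat_def)
  also have "\<dots> = (\<Sum>k<n. scale (q i k * q k j) e)"
    using assms ij by (intro sum.cong refl) (simp add: hermitian_projection_def sum.delta)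
  also have "\<dots> = scale (kmul n q q i j) e" by (simp add: kmul_def scale_sum_left)
  finally show "sandwich n n q q (diag_mat e n) i j = scalar_mat n q i j"
    using assms ij by (simp add: hermitian_projection_def scalar_mat_def mat_def)
qed (auto simp: scalar_mat_def mat_def)

end

locale jb_level = star_system scale kconj star pos e +
  J: ordered_jb_algebra "mat_rscale scale" "sa_mats star n" jp "diag_mat e n" N "pos n"
  for scale :: "'k::real_normed_field \<Rightarrow> 'e::ab_group_add \<Rightarrow> 'e" and kconj star pos e
    and n :: nat and jp N +
  assumes n_pos: "1 \<le> n"
begin

text \<open>Compressing by \<open>q + s (1 - q)\<close> adds to the block \<open>q z q\<close> only
  \<open>s M\<close>, where \<open>M\<close> is the off-diagonal part, because the block of order
  \<open>s^2\<close> vanishes. Positivity for every real \<open>s\<close> forces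
  \<open>M = 0\<close>.\<close>

lemma compression_kernel:
  assumes q: "hermitian_projection n q" and z: "z \<in> pos n" "sandwich n n (E1 - q) (E1 - q) z = 0"
  shows "sandwich n n q q z = z"
proof -
  let ?q = "E1 - q"
  define M where "M = sandwich n n q ?q z + sandwich n n ?q q z"
  have zV: "z \<in> sa n" using z J.C_in by blast
  have "sandwich n n (q + ?q) (q + ?q) z = sandwich n n q q z + M"
    by (simp only: sandwich_linear(3,4) z M_def add_ac add_0_right add_0_left)
  moreover have "q + ?q = E1" by simp
  ultimately have sum: "z = sandwich n n q q z + M" using zV by simp
  have "mscale s M + sandwich n n q q z \<in> pos n" for s
  proof -
    let ?b = "\<lambda>i j. of_real s * ?q i j"
    have "sandwich n n (q + ?b) (q + ?b) z \<in> pos n" using n_pos z by (intro sandwich_pos) auto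
    also have "sandwich n n (q + ?b) (q + ?b) z = sandwich n n q q z + mscale s (sandwich n n q ?q z)
       + (mscale s (sandwich n n ?q q z) + mscale s (mscale s (sandwich n n ?q ?q z)))"
      by (simp only: sandwich_linear(3,4,7,8) J.scale_right_distrib add_ac)
    also have "\<dots> = mscale s M + sandwich n n q q z"
      unfolding z(2) M_def by (simp add: J.scale_right_distrib add_ac)
    finally show ?thesis .
  qed
  moreover have "sandwich n n q q z \<in> sa n" using zV by (rule sandwich_in)
  moreover have "M \<in> sa n" using sum zV \<open>sandwich n n q q z \<in> sa n\<close>
    by (metis J.V_closed(2) add_diff_cancel_left')
  ultimately have "M = 0" by (intro J.ord.zero_of_multiples)
  then show ?thesis using sum by simp
qed

lemma compressions:
  assumes q: "hermitian_projection n q"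
  shows "complementary_compressions (mat_rscale scale) (sa n) jp (diag_mat e n) N (pos n)
    (sandwich n n q q) (sandwich n n (E1 - q) (E1 - q)) (scalar_mat n q)"
proof -
  note q' = hermitian_projection_complement[OF q]
  have uV: "diag_mat e n \<in> sa n" by simp
  have qq: "sandwich n n (kmul n q q) (kmul n q q) x = sandwich n n q q x" for x
    using q by (intro sandwich_cong) (auto simp: hermitian_projection_def)
  have qq': "sandwich n n (kmul n q (E1 - q)) b x = 0" for x b
  proof -
    have "sandwich n n (kmul n q (E1 - q)) b x = sandwich n n 0 b x"
      using q by (intro sandwich_cong) (auto simp: hermitian_projection_def kmul_linear)
    then show ?thesis using sandwich_linear(5)[of n n 0 0 b x] by simp
  qed
  show ?thesis
  proof unfold_locales
    show "sandwich n n (E1 - q) (E1 - q) (diag_mat e n) = diag_mat e n - scalar_mat n q"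
      unfolding sandwich_unit[OF q']
      by (auto simp: fun_eq_iff scalar_mat_def diag_mat_def mat_def E1_def kconj_simps scale_left_diff_distrib)
    show "sandwich n n q q (scalar_mat n q) = scalar_mat n q"
      unfolding sandwich_unit[OF q, symmetric] sandwich_sandwich qq ..
    show "sandwich n n (E1 - q) (E1 - q) (scalar_mat n q) = 0"
      unfolding sandwich_unit[OF q, symmetric] sandwich_sandwich qq' ..
    show "sandwich n n (E1 - q) (E1 - q) x = x" if "x \<in> pos n" "sandwich n n q q x = 0" for x
      using compression_kernel[OF q'] that by simp
  qed (use n_pos in \<open>auto simp: sandwich_in sandwich_linear(1,2) sandwich_pos sandwich_unit[OF q] compression_kernel[OF q]\<close>)
qed

text \<open>Expanding \<open>(1 - q) x (1 - q)\<close> in \<open>jp_p\<close> leaves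
  \<open>q x + x q\<close>. This is the first product by which \<open>jp\<close> is tied to matrix
  multiplication.\<close>

lemma scalar_projection_jp:
  assumes q: "hermitian_projection n q" and x: "x \<in> sa n"
  shows "jp (scalar_mat n q) x = mscale (1/2) (sandwich n n q E1 x + sandwich n n E1 q x)"
proof -
  interpret complementary_compressions "mat_rscale scale" "sa n" jp "diag_mat e n" N "pos n"
    "sandwich n n q q" "sandwich n n (E1 - q) (E1 - q)" "scalar_mat n q"
    by (rule compressions[OF q])
  have "sandwich n n (E1 - q) (E1 - q) x = x - sandwich n n q E1 x - (sandwich n n E1 q x - sandwich n n q q x)"
    using x by (simp only: sandwich_linear(5,6) sandwich_E1)
  then have eq: "x + sandwich n n q q x - sandwich n n (E1 - q) (E1 - q) x = sandwich n n q E1 x + sandwich n n E1 q x"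
    by simp
  show ?thesis unfolding jp_p[OF x] eq ..
qed

end

section \<open>Matrix units, scalar projections and monomial conjugations\<close>

context star_system
begin

text \<open>The elementary tensor of \<open>a\<close> with a matrix unit. It mentions no level, so
  the same matrix is used at all of them.\<close>

definition su :: "'e \<Rightarrow> nat \<Rightarrow> nat \<Rightarrow> 'e matrix" where
  "su a i j = (\<lambda>k l. if k = i \<and> l = j then a else 0)"

lemma su_apply: "su a i j k l = (if k = i \<and> l = j then a else 0)"
  by (simp add: su_def)

text \<open>For \<open>i \<noteq> j\<close> this is the matrix with entries \<open>a\<close> and \<open>a\<^sup>*\<close> at \<open>(i, j)\<close> and \<open>(j, i)\<close>, but
  \<open>hm a i i\<close> has the single entry \<open>a + a\<^sup>*\<close>.\<close>

definition hm :: "'e \<Rightarrow> nat \<Rightarrow> nat \<Rightarrow> 'e matrix" where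
  "hm a i j = su a i j + su (star a) j i"

lemma hm_apply: "hm a i j k l = (if k = i \<and> l = j then a else 0) + (if k = j \<and> l = i then star a else 0)"
  by (simp add: hm_def su_def)

lemma hm_in [simp]: "i < m \<Longrightarrow> j < m \<Longrightarrow> hm a i j \<in> sa m"
  by (cases "i = j") (auto simp: sa_iff hm_apply star_add star_star add.commute)

lemma su_in [simp]: "i < m \<Longrightarrow> star a = a \<Longrightarrow> su a i i \<in> sa m"
  by (auto simp: sa_iff su_def)

lemma hm_star: "hm (star a) i j = hm a j i"
  by (simp add: hm_def star_star add.commute)

lemma hm_linear:
  "hm (a + b) i j = hm a i j + hm b i j" "hm (a - b) i j = hm a i j - hm b i j"
  "hm (- a) i j = - hm a i j" "hm (rscale r a) i j = mscale r (hm a i j)" "hm 0 i j = 0"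
proof -
  have hm: "hm a i j = (\<lambda>k l. (if k = i \<and> l = j then a else 0) + (if k = j \<and> l = i then star a else 0))" for a
    by (intro ext) (rule hm_apply)
  have if_lin: "(if P then x + y else 0) = (if P then x else 0) + (if P then y else 0)"
    "(if P then x - y else 0) = (if P then x else 0) - (if P then y else 0)"
    "(if P then - x else 0) = - (if P then x else 0)"
    "(if P then rscale r x else 0) = rscale r (if P then x else 0)" for P and x y :: 'e
    by simp_all
  show "hm (a + b) i j = hm a i j + hm b i j" "hm (a - b) i j = hm a i j - hm b i j"
    "hm (- a) i j = - hm a i j" "hm (rscale r a) i j = mscale r (hm a i j)"
    unfolding hm fun_eq_iff plus_fun_apply minus_apply uminus_apply mscale_apply
      star_add star_diff star_minus star_rscale if_lin scale_right_distrib
    by (simp_all only: add_ac diff_conv_add_uminus minus_add_distrib simp_thms)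
  show "hm 0 i j = 0"
    unfolding hm by (simp add: fun_eq_iff)
qed

lemma su_linear:
  "su (a + b) i j = su a i j + su b i j" "su (a - b) i j = su a i j - su b i j"
  "su (rscale r a) i j = mscale r (su a i j)" "su 0 i j = 0"
  by (simp_all add: fun_eq_iff su_def)

lemma hm_diag: "hm a i i = su (a + star a) i i"
  by (simp add: hm_def su_linear)

lemma hm_entry: "i \<noteq> j \<Longrightarrow> hm a i j i j = a" "i \<noteq> j \<Longrightarrow> hm a i j j i = star a"
  by (simp_all add: hm_apply)

lemma eq_hmI:
  assumes x: "x \<in> sa m" and "i < m" "j < m" "i \<noteq> j"
    and "\<And>k l. x k l \<noteq> 0 \<Longrightarrow> k = i \<and> l = j \<or> k = j \<and> l = i"
  shows "x = hm (x i j) i j"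
proof (intro ext)
  fix k l show "x k l = hm (x i j) i j k l"
    using assms(4) assms(5)[of k l] sa_star[OF x, of i j] by (auto simp: hm_apply)
qed

lemma eq_suI:
  assumes "\<And>k l. x k l \<noteq> 0 \<Longrightarrow> k = i \<and> l = i"
  shows "x = su (x i i) i i"
  using assms by (fastforce simp: fun_eq_iff su_def)

definition ind :: "nat set \<Rightarrow> 'k matrix" where
  "ind A i j = (if i = j \<and> i \<in> A then 1 else 0)"

definition coord :: "nat \<Rightarrow> nat set \<Rightarrow> 'e matrix" where
  "coord m A = mat m (\<lambda>i j. if i = j \<and> i \<in> A then e else 0)"

lemma coord_scalar: "coord m A = scalar_mat m (ind A)"
  by (auto simp: coord_def scalar_mat_def mat_def ind_def kconj_simps fun_eq_iff)

lemma ind_projection: "hermitian_projection m (ind A)"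
proof -
  have "kmul m (ind A) (ind A) i j = ind A i j" if "i < m" "j < m" for i j
  proof -
    have "kmul m (ind A) (ind A) i j = (\<Sum>k<m. if k = i then ind A i j else 0)"
      unfolding kmul_def by (intro sum.cong refl) (auto simp: ind_def kconj_simps)
    then show ?thesis using that by simp
  qed
  then show ?thesis by (auto simp: hermitian_projection_def) (auto simp: ind_def kconj_simps)
qed

lemma sandwich_left:
  assumes ij: "i < m" "j < m"
  shows "sandwich m m a E1 x i j = (\<Sum>k<m. scale (kconj (a k i)) (x k j))"
proof -
  have "sandwich m m a E1 x i j = (\<Sum>k<m. \<Sum>l<m. if l = j then scale (kconj (a k i)) (x k l) else 0)"
    unfolding sandwich_apply[OF ij] by (intro sum.cong refl) (simp add: E1_def kconj_simps)
  then show ?thesis using ij by (simp add: sum.delta)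
qed

lemma sandwich_ind:
  assumes "x \<in> sa m"
  shows "sandwich m m (ind A) E1 x i j = (if i \<in> A then x i j else 0)"
    and "sandwich m m E1 (ind A) x i j = (if j \<in> A then x i j else 0)"
proof -
  have *: "sandwich m m (ind A) E1 x i j = (if i \<in> A then x i j else 0)" for i j
  proof (cases "i < m \<and> j < m")
    case True
    then have "sandwich m m (ind A) E1 x i j = (\<Sum>k<m. scale (kconj (ind A k i)) (x k j))"
      by (intro sandwich_left) auto
    also have "\<dots> = (\<Sum>k<m. if k = i then if i \<in> A then x k j else 0 else 0)"
      by (intro sum.cong refl) (auto simp: ind_def kconj_simps)
    finally show ?thesis using True by (simp add: sum.delta)
  qed (use assms in \<open>auto simp: sandwich_outside sa_outside\<close>)
  then show "sandwich m m (ind A) E1 x i j = (if i \<in> A then x i j else 0)" .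
  show "sandwich m m E1 (ind A) x i j = (if j \<in> A then x i j else 0)"
    using sandwich_star[OF assms, of m "ind A" E1 j i]
    by (simp only: * sa_star[OF assms] if_distrib[of star] star_0)
qed

text \<open>The projection onto the line through the sum of the basis vectors \<open>i\<close> and
  \<open>j\<close>. Twice it minus the coordinate projection onto \<open>{i, j}\<close> is the
  symmetric matrix unit, which makes products with \<open>hm e i j\<close> computable.\<close>

definition pair_projection :: "nat \<Rightarrow> nat \<Rightarrow> 'k matrix" where
  "pair_projection i j k l = (if k \<in> {i, j} \<and> l \<in> {i, j} then of_real (1/2) else 0)"

lemma sum_pair: "i < (m::nat) \<Longrightarrow> j < m \<Longrightarrow> i \<noteq> j \<Longrightarrow> (\<Sum>k<m. if k \<in> {i, j} then f k else 0) = f i + (f j :: 'b::comm_monoid_add)"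
  by (subst sum.inter_restrict[symmetric]) (auto simp: Int_absorb1)

lemma pair_projection: 
  assumes "i < m" "j < m" "i \<noteq> j"
  shows "hermitian_projection m (pair_projection i j)"
proof -
  have "kmul m (pair_projection i j) (pair_projection i j) k l = pair_projection i j k l" for k l
  proof -
    have "kmul m (pair_projection i j) (pair_projection i j) k l =
      (\<Sum>r<m. if r \<in> {i, j} then pair_projection i j k l * of_real (1/2) else 0)"
      unfolding kmul_def by (intro sum.cong refl) (simp add: pair_projection_def kconj_simps)
    also have "\<dots> = pair_projection i j k l * of_real (1/2) + pair_projection i j k l * of_real (1/2)"
      using assms by (rule sum_pair)
    finally show ?thesis by (simp add: pair_projection_def kconj_simps of_real_divide)
  qed
  then show ?thesis
    by (auto simp: hermitian_projection_def) (auto simp: pair_projection_def kconj_simps)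
qed

lemma sandwich_pair:
  assumes ij: "i < m" "j < m" "i \<noteq> j" and x: "x \<in> sa m"
  shows "sandwich m m (pair_projection i j) E1 x k l =
      (if k \<in> {i, j} then rscale (1/2) (x i l + x j l) else 0)"
    and "sandwich m m E1 (pair_projection i j) x k l =
      (if l \<in> {i, j} then rscale (1/2) (x k i + x k j) else 0)"
proof -
  have *: "sandwich m m (pair_projection i j) E1 x k l =
      (if k \<in> {i, j} then rscale (1/2) (x i l + x j l) else 0)" for k l
  proof (cases "k < m \<and> l < m")
    case True
    then have "sandwich m m (pair_projection i j) E1 x k l =
      (\<Sum>r<m. scale (kconj (pair_projection i j r k)) (x r l))"
      by (intro sandwich_left) auto
    also have "\<dots> = (\<Sum>r<m. if r \<in> {i, j} then if k \<in> {i, j} then rscale (1/2) (x r l) else 0 else 0)"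
      by (intro sum.cong refl) (auto simp: pair_projection_def kconj_simps simp del: of_real_divide)
    also have "\<dots> = (if k \<in> {i, j} then rscale (1/2) (x i l + x j l) else 0)"
      by (subst sum_pair[OF ij]) (simp add: scale_right_distrib)
    finally show ?thesis .
  qed (use ij x in \<open>auto simp: sandwich_outside sa_outside\<close>)
  then show "sandwich m m (pair_projection i j) E1 x k l =
      (if k \<in> {i, j} then rscale (1/2) (x i l + x j l) else 0)" .
  show "sandwich m m E1 (pair_projection i j) x k l =
      (if l \<in> {i, j} then rscale (1/2) (x k i + x k j) else 0)"
    using sandwich_star[OF x, of m "pair_projection i j" E1 l k]
    by (simp only: * sa_star[OF x] star_rscale star_add if_distrib[of star] star_0)
qed

text \<open>Conjugation by a monomial matrix. Trivial coefficients \<open>c\<close> give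
  permutations of the indices, and \<open>\<pi> = id\<close> gives diagonal phases.\<close>

definition monomial :: "nat \<Rightarrow> (nat \<Rightarrow> 'k) \<Rightarrow> (nat \<Rightarrow> nat) \<Rightarrow> 'e matrix \<Rightarrow> 'e matrix" where
  "monomial m c \<pi> x = mat m (\<lambda>i j. scale (kconj (c i) * c j) (x (\<pi> i) (\<pi> j)))"

lemma monomial_sandwich:
  assumes "\<And>i. i < m \<Longrightarrow> \<pi> i < m"
  shows "monomial m c \<pi> x = sandwich m m (\<lambda>k i. if k = \<pi> i then c i else 0) (\<lambda>k i. if k = \<pi> i then c i else 0) x"
proof (rule sym, rule sandwich_eqI)
  fix i j assume ij: "i < m" "j < m"
  have "sandwich m m (\<lambda>k i. if k = \<pi> i then c i else 0) (\<lambda>k i. if k = \<pi> i then c i else 0) x i j =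
    (\<Sum>k<m. \<Sum>l<m. if l = \<pi> j then if k = \<pi> i then scale (kconj (c i) * c j) (x (\<pi> i) (\<pi> j)) else 0 else 0)"
    unfolding sandwich_apply[OF ij] by (intro sum.cong refl) (auto simp: kconj_simps)
  then show "sandwich m m (\<lambda>k i. if k = \<pi> i then c i else 0) (\<lambda>k i. if k = \<pi> i then c i else 0) x i j = monomial m c \<pi> x i j"
    using ij assms by (simp add: monomial_def mat_def sum.delta)
qed (auto simp: monomial_def mat_def)

lemma monomial_facts:
  assumes "\<And>i. i < m \<Longrightarrow> \<pi> i < m" "1 \<le> m"
  shows "x \<in> sa m \<Longrightarrow> monomial m c \<pi> x \<in> sa m" "x \<in> pos m \<Longrightarrow> monomial m c \<pi> x \<in> pos m"
    "monomial m c \<pi> (x + y) = monomial m c \<pi> x + monomial m c \<pi> y"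
    "monomial m c \<pi> (mscale r x) = mscale r (monomial m c \<pi> x)"
proof -
  note eq = monomial_sandwich[of m \<pi>, OF assms(1)]
  show "x \<in> sa m \<Longrightarrow> monomial m c \<pi> x \<in> sa m" "x \<in> pos m \<Longrightarrow> monomial m c \<pi> x \<in> pos m"
    using assms(2) by (simp_all add: eq sandwich_in sandwich_pos)
  show "monomial m c \<pi> (x + y) = monomial m c \<pi> x + monomial m c \<pi> y"
    by (simp only: eq sandwich_linear(1))
  show "monomial m c \<pi> (mscale r x) = mscale r (monomial m c \<pi> x)"
    by (simp only: eq sandwich_linear(2))
qed

lemma monomial_inverse:
  assumes "\<And>i. i < m \<Longrightarrow> \<sigma> i < m" "\<And>i. i < m \<Longrightarrow> \<pi> (\<sigma> i) = i" "\<And>i. i < m \<Longrightarrow> kconj (c i) * c i = 1" "x \<in> sa m"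
  shows "monomial m (\<lambda>i. kconj (c (\<sigma> i))) \<sigma> (monomial m c \<pi> x) = x"
proof (intro ext)
  fix i j
  show "monomial m (\<lambda>i. kconj (c (\<sigma> i))) \<sigma> (monomial m c \<pi> x) i j = x i j"
  proof (cases "i < m \<and> j < m")
    case True
    have "c (\<sigma> i) * kconj (c (\<sigma> j)) * (kconj (c (\<sigma> i)) * c (\<sigma> j)) =
      (kconj (c (\<sigma> i)) * c (\<sigma> i)) * (kconj (c (\<sigma> j)) * c (\<sigma> j))" by simp
    also have "\<dots> = 1" using True assms by simp
    finally show ?thesis using True assms by (simp add: monomial_def mat_def kconj_simps)
  qed (use assms(4) in \<open>auto simp: monomial_def mat_def sa_outside\<close>)
qed

end

section \<open>Peirce spaces in terms of matrix positions; passage to lower levels\<close>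

context jb_level
begin

lemma coord_in [simp]: "coord n A \<in> sa n"
  and coord_idem [simp]: "jp (coord n A) (coord n A) = coord n A"
proof -
  interpret complementary_compressions "mat_rscale scale" "sa n" jp "diag_mat e n" N "pos n"
    "sandwich n n (ind A) (ind A)" "sandwich n n (E1 - ind A) (E1 - ind A)" "coord n A"
    unfolding coord_scalar by (rule compressions[OF ind_projection])
  show "coord n A \<in> sa n" "jp (coord n A) (coord n A) = coord n A"
    by (simp_all add: p_idempotent)
qed

text \<open>The eigenvalue of multiplication by \<open>coord n A\<close> on the entry at
  \<open>(i, j)\<close>. Peirce spaces become sets of allowed positions.\<close>

definition weight :: "nat set \<Rightarrow> nat \<Rightarrow> nat \<Rightarrow> real" where
  "weight A i j = (if i \<in> A then 1/2 else 0) + (if j \<in> A then 1/2 else 0)"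

lemma jp_coord: "x \<in> sa n \<Longrightarrow> jp (coord n A) x i j = rscale (weight A i j) (x i j)"
  unfolding coord_scalar
  by (simp add: scalar_projection_jp[OF ind_projection] sandwich_ind weight_def)
    (simp add: scale_right_distrib scale_left_distrib[symmetric])

lemma peirce_coord_iff:
  "x \<in> J.peirce (coord n A) r \<longleftrightarrow> x \<in> sa n \<and> (\<forall>i j. x i j \<noteq> 0 \<longrightarrow> weight A i j = r)"
proof -
  have "jp (coord n A) x = mscale r x \<longleftrightarrow> (\<forall>i j. x i j \<noteq> 0 \<longrightarrow> weight A i j = r)" if "x \<in> sa n"
    unfolding fun_eq_iff jp_coord[OF that] mscale_apply by auto
  then show ?thesis by (auto simp: J.peirce_def)
qed

lemma jp_pair:
  assumes ij: "i < n" "j < n" "i \<noteq> j" and x: "x \<in> sa n"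
  shows "jp (hm e i j) x k l = rscale (1/2)
    ((if k = i then x j l else if k = j then x i l else 0) + (if l = i then x k j else if l = j then x k i else 0))"
proof -
  let ?q = "pair_projection i j"
  note q = pair_projection[OF ij]
  have hm: "hm e i j = scalar_mat n ?q + scalar_mat n ?q - coord n {i, j}"
  proof (intro ext)
    fix k l
    have "scale (of_real (1/2)) e + scale (of_real (1/2)) e = e"
      by (simp flip: scale_left_distrib of_real_add)
    then show "hm e i j k l = (scalar_mat n ?q + scalar_mat n ?q - coord n {i, j}) k l"
      using ij by (auto simp: hm_apply scalar_mat_def mat_def coord_def pair_projection_def kconj_simps simp del: of_real_divide)
  qed
  have V: "scalar_mat n ?q \<in> sa n"
  proof -
    interpret complementary_compressions "mat_rscale scale" "sa n" jp "diag_mat e n" N "pos n"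
      "sandwich n n ?q ?q" "sandwich n n (E1 - ?q) (E1 - ?q)" "scalar_mat n ?q"
      by (rule compressions[OF q])
    show ?thesis by simp
  qed
  have "jp (hm e i j) x k l = jp (scalar_mat n ?q) x k l + jp (scalar_mat n ?q) x k l - jp (coord n {i, j}) x k l"
    using V x by (simp add: hm J.jp_bilinear)
  also have "\<dots> = rscale (1/2) (sandwich n n ?q E1 x k l + sandwich n n E1 ?q x k l)
     + rscale (1/2) (sandwich n n ?q E1 x k l + sandwich n n E1 ?q x k l) - rscale (weight {i, j} k l) (x k l)"
    using x by (simp add: scalar_projection_jp[OF q] jp_coord)
  also have "\<dots> = sandwich n n ?q E1 x k l + sandwich n n E1 ?q x k l - rscale (weight {i, j} k l) (x k l)"
    by (simp flip: scale_left_distrib of_real_add)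
  also have "\<dots> = rscale (1/2)
    ((if k = i then x j l else if k = j then x i l else 0) + (if l = i then x k j else if l = j then x k i else 0))"
  proof -
    have w: "rscale (weight {i, j} k l) (x k l) =
      (if k = i \<or> k = j then rscale (1/2) (x k l) else 0) + (if l = i \<or> l = j then rscale (1/2) (x k l) else 0)"
      unfolding weight_def of_real_add scale_left_distrib by auto
    show ?thesis unfolding sandwich_pair[OF ij x] w using ij
      by (auto simp: scale_right_distrib simp del: of_real_divide)
  qed
  finally show ?thesis .
qed

lemma monomial_automorphism:
  assumes p: "\<And>i. i < n \<Longrightarrow> \<pi> i < n" "\<And>i. i < n \<Longrightarrow> \<sigma> i < n"
      "\<And>i. i < n \<Longrightarrow> \<sigma> (\<pi> i) = i" "\<And>i. i < n \<Longrightarrow> \<pi> (\<sigma> i) = i"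
    and c: "\<And>i. i < n \<Longrightarrow> kconj (c i) * c i = 1" and xy: "x \<in> sa n" "y \<in> sa n"
  shows "monomial n c \<pi> (jp x y) = jp (monomial n c \<pi> x) (monomial n c \<pi> y)"
proof -
  let ?c = "\<lambda>i. kconj (c (\<sigma> i))"
  show ?thesis
  proof (rule J.order_automorphism_is_jordan[where T = "monomial n c \<pi>" and T' = "monomial n ?c \<sigma>"])
    show "monomial n ?c \<sigma> (monomial n c \<pi> x) = x" if "x \<in> sa n" for x
      using p c that by (intro monomial_inverse) auto
    have c': "kconj (?c i) * ?c i = 1" if "i < n" for i using c p that by (simp add: kconj_simps mult.commute)
    have "monomial n c \<pi> x = monomial n (\<lambda>i. kconj (?c (\<pi> i))) \<pi> x" for x
      using p by (auto simp: monomial_def mat_def fun_eq_iff kconj_simps)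
    then show "monomial n c \<pi> (monomial n ?c \<sigma> x) = x" if "x \<in> sa n" for x
      using monomial_inverse[of n \<pi> \<sigma> ?c x, OF p(1,3) c' that] by simp
    show "monomial n c \<pi> (diag_mat e n) = diag_mat e n"
    proof (intro ext)
      fix i j
      have "i < n \<Longrightarrow> j < n \<Longrightarrow> \<pi> i = \<pi> j \<longleftrightarrow> i = j" using p(3) by metis
      then show "monomial n c \<pi> (diag_mat e n) i j = diag_mat e n i j"
        using p c by (auto simp: monomial_def diag_mat_def mat_def)
    qed
  qed (rule monomial_facts xy p n_pos, assumption?)+
qed

text \<open>Because of this symmetry, a product defined from the indices 0, 1, 2 governs all
  positions.\<close>

lemma permutation_transport:
  assumes "bij_betw \<pi> {..<n} {..<n}" and xy: "x \<in> sa n" "y \<in> sa n" and ij: "i < n" "j < n"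
  shows "jp x y (\<pi> i) (\<pi> j) = jp (\<lambda>i j. if i < n \<and> j < n then x (\<pi> i) (\<pi> j) else 0) (\<lambda>i j. if i < n \<and> j < n then y (\<pi> i) (\<pi> j) else 0) i j"
proof -
  define \<sigma> where "\<sigma> = inv_into {..<n} \<pi>"
  have p: "\<pi> i < n" "\<sigma> i < n" "\<sigma> (\<pi> i) = i" "\<pi> (\<sigma> i) = i" if "i < n" for i
    using assms(1) that bij_betw_inv_into_left[OF assms(1), of i] bij_betw_inv_into_right[OF assms(1), of i]
      bij_betwE[OF assms(1)] bij_betwE[OF bij_betw_inv_into[OF assms(1)]] by (auto simp: \<sigma>_def)
  have m: "monomial n (\<lambda>_. 1) \<pi> x = (\<lambda>i j. if i < n \<and> j < n then x (\<pi> i) (\<pi> j) else 0)" for x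
    by (simp add: monomial_def mat_def kconj_simps)
  have "monomial n (\<lambda>_. 1) \<pi> (jp x y) i j = jp (monomial n (\<lambda>_. 1) \<pi> x) (monomial n (\<lambda>_. 1) \<pi> y) i j"
    using p xy by (subst monomial_automorphism[of \<pi> \<sigma>]) (auto simp: kconj_simps)
  then show ?thesis unfolding m using ij by simp
qed

text \<open>As matrices vanish outside their level, level \<open>m\<close> is literally the corner
  of \<open>coord n {..<m}\<close>, with \<open>jp\<close> and \<open>N\<close> unchanged. What
  needs an argument is that a positive matrix is a square inside the corner: once it is scaled below
  the unit, monotonicity of \<open>N\<close> at level \<open>n\<close> bounds its complement in the
  corner, and the corner supplies the root.\<close>

lemma lower_level:
  assumes m: "1 \<le> m" "m \<le> n"
  shows "jb_level scale kconj star pos e m jp N"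
proof -
  interpret ou: order_unit_space "mat_rscale scale" "sa m" "pos m" "diag_mat e m"
    by (rule order_unit_level) fact
  have coord: "coord n {..<m} = diag_mat e m"
    using m by (auto simp: coord_def diag_mat_def mat_def fun_eq_iff)
  have "x \<in> J.peirce (coord n {..<m}) 1 \<longleftrightarrow> x \<in> sa m" for x
    using m unfolding peirce_coord_iff sa_iff weight_def
    by (auto simp: not_less) (metis not_less)+
  then have peirce: "J.peirce (diag_mat e m) 1 = sa m" unfolding coord by auto
  interpret corner: unital_jb_algebra "mat_rscale scale" "sa m" jp "diag_mat e m" N
    using J.corner_jb_algebra[of "coord n {..<m}"] unfolding coord peirce[symmetric]
    using coord_in coord_idem coord by metis
  have up: "z \<in> pos n" if "z \<in> pos m" for z
  proof -
    have z: "z \<in> sa m" using that ou.cone_subset by auto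
    have "sandwich m n E1 E1 z = z"
    proof (rule sandwich_eqI)
      fix i j assume ij: "i < n" "j < n"
      have "sandwich m n E1 E1 z i j = (\<Sum>k<m. \<Sum>l<m. if l = j then if k = i then z i j else 0 else 0)"
        unfolding sandwich_apply[OF ij] by (intro sum.cong refl) (simp add: E1_def kconj_simps)
      then show "sandwich m n E1 E1 z i j = z i j"
        using sa_outside[OF z, of i j] by (cases "i < m"; cases "j < m") (simp_all add: not_less)
    qed (use z m in \<open>auto simp: sa_outside\<close>)
    then show ?thesis using sandwich_pos[of m n z E1] m that by simp
  qed
  have down: "z \<in> pos m" if "z \<in> pos n" "z \<in> sa m" for z
  proof -
    have "sandwich n m E1 E1 z = z"
    proof (rule sandwich_eqI)
      fix i j assume ij: "i < m" "j < m"
      have "sandwich n m E1 E1 z i j = (\<Sum>k<n. \<Sum>l<n. if l = j then if k = i then z i j else 0 else 0)"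
        unfolding sandwich_apply[OF ij] by (intro sum.cong refl) (simp add: E1_def kconj_simps)
      then show "sandwich n m E1 E1 z i j = z i j"
        using m ij by (auto simp: sum.delta)
    qed (use that in \<open>auto simp: sa_outside\<close>)
    then show ?thesis using sandwich_pos[of n m z E1] m that by simp
  qed
  have "pos m = {jp x x | x. x \<in> sa m}"
  proof (intro equalityI subsetI)
    fix z assume "z \<in> {jp x x | x. x \<in> sa m}"
    then obtain x where x: "x \<in> sa m" "z = jp x x" by blast
    then show "z \<in> pos m" using down J.square_in_C[of x] sa_mono[OF m(2)] by auto
  next
    fix z assume z: "z \<in> pos m"
    then have zV: "z \<in> sa m" using ou.cone_subset by auto
    obtain l where l: "0 \<le> l" "mscale l (diag_mat e m) - z \<in> pos m" using ou.order_unit[OF zV] by auto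
    define y where "y = mscale (1 / (l + 1)) z"
    have "(mscale l (diag_mat e m) - z) + diag_mat e m \<in> pos m" using ou.cone_add[OF l(2) ou.unit_pos] .
    moreover have "(mscale l (diag_mat e m) - z) + diag_mat e m = mscale (l + 1) (diag_mat e m) - z"
      by (simp add: J.scale_left_distrib)
    ultimately have "mscale (1 / (l + 1)) (mscale (l + 1) (diag_mat e m) - z) \<in> pos m"
      using l by (intro ou.cone_scale) auto
    then have y: "diag_mat e m - y \<in> pos m" "y \<in> pos m" "y \<in> sa m"
      using l z zV ou.cone_scale[of "1 / (l + 1)" z] corner.V_closed(3)[OF zV]
      by (simp_all add: J.scale_right_diff_distrib y_def)
    then have "N (diag_mat e m - y) \<le> N (diag_mat e m)"
      using up[of y] up[of "diag_mat e m - y"] by (intro J.N_mono) auto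
    then have "N (diag_mat e m - y) \<le> 1" using corner.N_u by simp
    then obtain c where c: "c \<in> sa m" "jp c c = y"
      using corner.sqrt_exists[of "diag_mat e m - y"] y by auto
    have "z = jp (mscale (sqrt (l + 1)) c) (mscale (sqrt (l + 1)) c)"
      using c l by (simp add: corner.jp_bilinear y_def real_sqrt_mult_self)
    then show "z \<in> {jp x x | x. x \<in> sa m}" using c corner.V_closed(3) by blast
  qed
  then have "ordered_jb_algebra (mat_rscale scale) (sa m) jp (diag_mat e m) N (pos m)"
    by unfold_locales
  then interpret L: ordered_jb_algebra "mat_rscale scale" "sa m" jp "diag_mat e m" N "pos m" .
  show ?thesis using m by unfold_locales
qed

end

lemma bij_betw_extend:
  assumes "inj_on f S" "S \<subseteq> {..<n}" "f ` S \<subseteq> {..<n::nat}"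
  obtains \<pi> where "bij_betw \<pi> {..<n} {..<n}" "\<And>s. s \<in> S \<Longrightarrow> \<pi> s = f s"
proof -
  have fin: "finite S" using assms(2) finite_subset by auto
  have "card ({..<n} - S) = card ({..<n} - f ` S)"
    using assms fin by (simp add: card_Diff_subset card_image)
  then obtain g where g: "bij_betw g ({..<n} - S) ({..<n} - f ` S)"
    using finite_same_card_bij[of "{..<n} - S" "{..<n} - f ` S"] by auto
  define \<pi> where "\<pi> s = (if s \<in> S then f s else g s)" for s
  have 1: "bij_betw \<pi> S (f ` S)"
    using assms(1) inj_on_imp_bij_betw bij_betw_cong[of S \<pi> f] by (simp add: \<pi>_def)
  have 2: "bij_betw \<pi> ({..<n} - S) ({..<n} - f ` S)"
    using g bij_betw_cong[of "{..<n} - S" \<pi> g] by (simp add: \<pi>_def)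
  have "bij_betw \<pi> (S \<union> ({..<n} - S)) (f ` S \<union> ({..<n} - f ` S))"
    using 1 2 by (rule bij_betw_combine) auto
  moreover have "S \<union> ({..<n} - S) = {..<n}" "f ` S \<union> ({..<n} - f ` S) = {..<n}"
    using assms by auto
  ultimately show ?thesis using that[of \<pi>] by (simp add: \<pi>_def)
qed

section \<open>Products of elementary self-adjoint matrices\<close>

context jb_level
begin

lemma weight_commute: "weight A i j = weight A j i"
  by (simp add: weight_def)

lemma hm_peirce: "i < n \<Longrightarrow> j < n \<Longrightarrow> weight A i j = r \<Longrightarrow> hm a i j \<in> J.peirce (coord n A) r"
  using weight_commute[of A i j] by (cases "i = j") (auto simp: peirce_coord_iff hm_apply split: if_splits)

lemma su_peirce: "i < n \<Longrightarrow> star a = a \<Longrightarrow> weight A i i = r \<Longrightarrow> su a i i \<in> J.peirce (coord n A) r"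
  by (auto simp: peirce_coord_iff su_apply split: if_splits)

lemmas peirce_rules = J.peirce_closed[OF coord_in coord_idem] J.peirce_one_zero[OF coord_in coord_idem]
  J.peirce_half_hom[OF coord_in coord_idem] J.peirce_operators_commute[OF coord_in coord_idem]

lemma hm_permute:
  assumes "bij_betw \<pi> {..<n} {..<n}" "i < n" "j < n"
  shows "(\<lambda>k l. if k < n \<and> l < n then hm a (\<pi> i) (\<pi> j) (\<pi> k) (\<pi> l) else 0) = hm a i j"
proof (intro ext)
  fix k l
  have inj: "\<pi> k = \<pi> i \<longleftrightarrow> k = i" if "k < n" "i < n" for k i
    using assms(1) that by (auto simp: bij_betw_def inj_on_def)
  show "(if k < n \<and> l < n then hm a (\<pi> i) (\<pi> j) (\<pi> k) (\<pi> l) else 0) = hm a i j k l"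
  proof (cases "k < n \<and> l < n")
    case True
    then have "\<pi> k = \<pi> i \<longleftrightarrow> k = i" "\<pi> k = \<pi> j \<longleftrightarrow> k = j" "\<pi> l = \<pi> i \<longleftrightarrow> l = i" "\<pi> l = \<pi> j \<longleftrightarrow> l = j"
      using inj assms by auto
    then show ?thesis using True by (simp only: hm_apply if_True simp_thms)
  next
    case False
    then have "\<not> (k = i \<and> l = j)" "\<not> (k = j \<and> l = i)" using assms by auto
    then show ?thesis using False by (simp only: hm_apply if_False simp_thms) simp
  qed
qed

lemma su_permute:
  assumes "bij_betw \<pi> {..<n} {..<n}" "i < n"
  shows "(\<lambda>k l. if k < n \<and> l < n then su a (\<pi> i) (\<pi> i) (\<pi> k) (\<pi> l) else 0) = su a i i"
proof (intro ext)
  fix k l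
  have inj: "\<pi> k = \<pi> i \<longleftrightarrow> k = i" if "k < n" for k
    using assms that by (auto simp: bij_betw_def inj_on_def)
  show "(if k < n \<and> l < n then su a (\<pi> i) (\<pi> i) (\<pi> k) (\<pi> l) else 0) = su a i i k l"
    using assms inj by (auto simp: su_def)
qed

text \<open>Up to a factor \<open>1/2\<close> these are the products \<open>a b\<close>, the second one for self-adjoint \<open>a\<close> only.\<close>

definition tri :: "'e \<Rightarrow> 'e \<Rightarrow> 'e" where "tri a b = jp (hm a 0 1) (hm b 1 2) 0 2"
definition dia :: "'e \<Rightarrow> 'e \<Rightarrow> 'e" where "dia a b = jp (su a 0 0) (hm b 0 1) 0 1"

text \<open>The Peirce rules for \<open>{i, j}\<close>, \<open>{j, k}\<close> and
  \<open>{i, j, k}\<close> leave only the positions \<open>(i, k)\<close> and \<open>(k, i)\<close>.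
  A permutation taking 0, 1, 2 to the three indices shows that the entry does not depend on
  them.\<close>

lemma jp_hm_hm:
  assumes d: "i < n" "j < n" "k < n" "i \<noteq> j" "j \<noteq> k" "i \<noteq> k"
  shows "jp (hm a i j) (hm b j k) = hm (tri a b) i k"
proof -
  have n3: "3 \<le> n"
    using d card_mono[of "{..<n}" "{i, j, k}"] by simp
  define y where "y = jp (hm a i j) (hm b j k)"
  have p1: "y \<in> J.peirce (coord n {i, j}) (1/2)" unfolding y_def
    using d by (intro peirce_rules(1)[where i = 1] hm_peirce) (auto simp: weight_def)
  have p2: "y \<in> J.peirce (coord n {j, k}) (1/2)" unfolding y_def
    using d by (intro peirce_rules(2)[where i = 1] hm_peirce) (auto simp: weight_def)
  have p3: "y \<in> J.peirce (coord n {i, j, k}) 1" unfolding y_def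
    using d by (intro peirce_rules(1)[where i = 1] hm_peirce) (auto simp: weight_def)
  have supp: "r = i \<and> s = k \<or> r = k \<and> s = i" if "y r s \<noteq> 0" for r s
  proof -
    have "weight {i, j} r s = 1/2" "weight {j, k} r s = 1/2" "weight {i, j, k} r s = 1"
      using p1 p2 p3 that by (auto simp: peirce_coord_iff)
    then have "(r \<in> {i, j}) \<noteq> (s \<in> {i, j})" "(r \<in> {j, k}) \<noteq> (s \<in> {j, k})" "r \<in> {i, j, k}" "s \<in> {i, j, k}"
      unfolding weight_def by (auto split: if_splits)
    then show ?thesis using d by auto
  qed
  have "y \<in> sa n" using d by (simp add: y_def)
  then have y: "y = hm (y i k) i k" using d supp by (intro eq_hmI[of y n]) auto
  define f where "f = (\<lambda>r::nat. if r = 0 then i else if r = 1 then j else k)"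
  obtain \<pi> where \<pi>: "bij_betw \<pi> {..<n} {..<n}" "\<And>s. s \<in> {0, 1, 2} \<Longrightarrow> \<pi> s = f s"
    using d n3 by (rule_tac bij_betw_extend[of f "{0, 1, 2}" n]) (auto simp: f_def inj_on_def)
  have \<pi>': "i = \<pi> 0" "j = \<pi> 1" "k = \<pi> 2" using \<pi>(2) by (simp_all add: f_def)
  have "y i k = tri a b"
    unfolding y_def \<pi>' using \<pi>(1) n3 bij_betwE[OF \<pi>(1)]
    by (subst permutation_transport[OF \<pi>(1)]) (simp_all add: hm_permute tri_def)
  with y show ?thesis by (simp add: y_def)
qed

lemma jp_su_hm:
  assumes d: "i < n" "l < n" "i \<noteq> l" and a: "star a = a"
  shows "jp (su a i i) (hm b i l) = hm (dia a b) i l"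
proof -
  have n2: "2 \<le> n" using d by simp
  define y where "y = jp (su a i i) (hm b i l)"
  have p1: "y \<in> J.peirce (coord n {i}) (1/2)" unfolding y_def
    using d a by (intro peirce_rules(1)[where i = 1] hm_peirce su_peirce) (auto simp: weight_def)
  have p2: "y \<in> J.peirce (coord n {i, l}) 1" unfolding y_def
    using d a by (intro peirce_rules(1)[where i = 1] hm_peirce su_peirce) (auto simp: weight_def)
  have supp: "r = i \<and> s = l \<or> r = l \<and> s = i" if "y r s \<noteq> 0" for r s
  proof -
    have "weight {i} r s = 1/2" "weight {i, l} r s = 1"
      using p1 p2 that by (auto simp: peirce_coord_iff)
    then have "(r = i) \<noteq> (s = i)" "r \<in> {i, l}" "s \<in> {i, l}"
      unfolding weight_def by (auto split: if_splits)
    then show ?thesis by auto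
  qed
  have "y \<in> sa n" using d a by (simp add: y_def)
  then have y: "y = hm (y i l) i l" using d supp by (intro eq_hmI[of y n]) auto
  define f where "f = (\<lambda>r::nat. if r = 0 then i else l)"
  obtain \<pi> where \<pi>: "bij_betw \<pi> {..<n} {..<n}" "\<And>s. s \<in> {0, 1} \<Longrightarrow> \<pi> s = f s"
    using d n2 by (rule_tac bij_betw_extend[of f "{0, 1}" n]) (auto simp: f_def inj_on_def)
  have \<pi>': "i = \<pi> 0" "l = \<pi> 1" using \<pi>(2) by (simp_all add: f_def)
  have "y i l = dia a b"
    unfolding y_def \<pi>' using \<pi>(1) n2 bij_betwE[OF \<pi>(1)] a
    by (subst permutation_transport[OF \<pi>(1)]) (simp_all add: hm_permute su_permute dia_def)
  with y show ?thesis by (simp add: y_def)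
qed

lemma jp_disjoint:
  assumes "i < n" "j < n" "k < n" "l < n" "{i, j} \<inter> {k, l} = {}"
  shows "jp (hm a i j) (hm b k l) = 0"
  using assms
  by (intro peirce_rules(3)[of _ "{i, j}"] hm_peirce) (auto simp: weight_def)

lemma jp_su_hm_disjoint:
  assumes "i < n" "k < n" "l < n" "i \<noteq> k" "i \<noteq> l" "star a = a"
  shows "jp (su a i i) (hm b k l) = 0"
  using assms
  by (intro peirce_rules(3)[of _ "{i}"] hm_peirce su_peirce) (auto simp: weight_def)

lemma tri_linear:
  assumes "3 \<le> n"
  shows "tri (a + a') b = tri a b + tri a' b" "tri a (b + b') = tri a b + tri a b'"
    "tri (rscale r a) b = rscale r (tri a b)" "tri a (rscale r b) = rscale r (tri a b)"
  using assms by (simp_all add: tri_def hm_linear J.jp_bilinear)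

lemma dia_linear:
  assumes "2 \<le> n" "star a = a"
  shows "dia a (b + b') = dia a b + dia a b'" "dia a (b - b') = dia a b - dia a b'"
    "dia (rscale r a) b = rscale r (dia a b)" "dia a (rscale r b) = rscale r (dia a b)"
  using assms by (simp_all add: dia_def hm_linear su_linear J.jp_bilinear star_rscale)

lemma dia_add_left:
  assumes "2 \<le> n" "star a = a" "star a' = a'"
  shows "dia (a + a') b = dia a b + dia a' b"
  using assms by (simp add: dia_def su_linear J.jp_bilinear)

lemma tri_e: "3 \<le> n \<Longrightarrow> tri e b = rscale (1/2) b"
  unfolding tri_def by (subst jp_pair) (simp_all add: hm_apply)

lemma dia_e: "2 \<le> n \<Longrightarrow> dia e b = rscale (1/2) b"
proof -
  assume n: "2 \<le> n"
  then have "su e 0 0 = coord n {0}" by (auto simp: su_def coord_def mat_def fun_eq_iff)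
  then show ?thesis using n by (simp add: dia_def jp_coord weight_def hm_apply)
qed

lemma dia_e_right: "2 \<le> n \<Longrightarrow> star a = a \<Longrightarrow> dia a e = rscale (1/2) a"
  unfolding dia_def by (subst J.jp_commute) (simp_all add: jp_pair su_apply)

lemma phase_automorphism:
  assumes "\<And>i. i < n \<Longrightarrow> kconj (c i) * c i = 1" "x \<in> sa n" "y \<in> sa n"
  shows "monomial n c id (jp x y) = jp (monomial n c id x) (monomial n c id y)"
  using assms by (intro monomial_automorphism[where \<sigma> = id]) auto

lemma phase_hm:
  assumes "i < n" "j < n"
  shows "monomial n c id (hm a i j) = hm (scale (kconj (c i) * c j) a) i j"
proof (intro ext)
  fix k l
  show "monomial n c id (hm a i j) k l = hm (scale (kconj (c i) * c j) a) i j k l"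
    using assms by (cases "i = j")
      (auto simp: monomial_def mat_def hm_apply star_scale kconj_mult kconj_simps scale_right_distrib mult.commute)
qed

lemma phase_su:
  assumes "i < n" "kconj (c i) * c i = 1"
  shows "monomial n c id (su a i i) = su a i i"
  using assms by (auto simp: monomial_def mat_def su_def fun_eq_iff)

text \<open>The phase sits at index 0, so conjugation multiplies the positions \<open>(0, 1)\<close>
  and \<open>(0, 2)\<close> by \<zeta> and leaves \<open>(1, 2)\<close> alone. The conjugate appears
  in \<open>c\<close> because \<open>monomial\<close> conjugates the row factor.\<close>

lemma tri_phase:
  assumes n: "3 \<le> n" and z: "kconj \<zeta> * \<zeta> = 1"
  shows "tri (scale \<zeta> a) b = scale \<zeta> (tri a b)"
proof -
  define c where "c i = (if i = 0 then kconj \<zeta> else 1)" for i :: nat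
  have c: "kconj (c i) * c i = 1" for i using z by (simp add: c_def kconj_simps mult.commute)
  have "jp (monomial n c id (hm a 0 1)) (monomial n c id (hm b 1 2)) = monomial n c id (jp (hm a 0 1) (hm b 1 2))"
    using n c by (subst phase_automorphism) auto
  then have "jp (hm (scale \<zeta> a) 0 1) (hm b 1 2) = hm (scale \<zeta> (tri a b)) 0 2"
    using n by (simp add: phase_hm jp_hm_hm c_def kconj_simps)
  then show ?thesis using n by (simp add: tri_def hm_apply)
qed

text \<open>Now the phase sits at index 1: it changes \<open>(0, 1)\<close> but not the diagonal
  factor.\<close>

lemma dia_phase:
  assumes n: "2 \<le> n" and z: "kconj \<zeta> * \<zeta> = 1" and a: "star a = a"
  shows "dia a (scale \<zeta> b) = scale \<zeta> (dia a b)"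
proof -
  define c where "c i = (if i = 1 then \<zeta> else 1)" for i :: nat
  have c: "kconj (c i) * c i = 1" for i using z by (simp add: c_def kconj_simps)
  have "jp (monomial n c id (su a 0 0)) (monomial n c id (hm b 0 1)) = monomial n c id (jp (su a 0 0) (hm b 0 1))"
    using n c a by (subst phase_automorphism) auto
  then have "jp (su a 0 0) (hm (scale \<zeta> b) 0 1) = hm (scale \<zeta> (dia a b)) 0 1"
    using n a by (simp add: phase_hm phase_su jp_su_hm c_def kconj_simps)
  then show ?thesis using n by (simp add: dia_def hm_apply)
qed

text \<open>Changing the sign at index \<open>i\<close> negates both factors and hence fixes the
  product, yet it negates the entry at \<open>(i, j)\<close>.\<close>

lemma hm_square_support:
  assumes d: "i < n" "j < n" "i \<noteq> j"
  shows "jp (hm a i j) (hm b i j) = su (jp (hm a i j) (hm b i j) i i) i i + su (jp (hm a i j) (hm b i j) j j) j j"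
proof -
  define y where "y = jp (hm a i j) (hm b i j)"
  have yV: "y \<in> sa n" using d by (simp add: y_def)
  have *: "y \<in> J.peirce (coord n {i, j}) 1" unfolding y_def
    using d by (intro peirce_rules(1)[where i = 1] hm_peirce) (auto simp: weight_def)
  have supp: "r \<in> {i, j} \<and> s \<in> {i, j}" if "y r s \<noteq> 0" for r s
  proof -
    have "weight {i, j} r s = 1" using * that by (auto simp: peirce_coord_iff)
    then show ?thesis unfolding weight_def by (auto split: if_splits)
  qed
  define c :: "nat \<Rightarrow> 'k" where "c r = (if r = i then -1 else 1)" for r
  have c: "kconj (c r) * c r = 1" for r by (simp add: c_def kconj_simps kconj_minus kconj_simps)
  have "monomial n c id y = jp (monomial n c id (hm a i j)) (monomial n c id (hm b i j))"
    using d c by (simp add: y_def phase_automorphism)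
  also have "\<dots> = y" using d by (simp add: phase_hm c_def kconj_simps kconj_minus kconj_simps hm_linear J.jp_bilinear y_def)
  finally have "monomial n c id y i j = y i j" by simp
  then have "- y i j = y i j" using d by (simp add: monomial_def mat_def c_def kconj_simps kconj_minus kconj_simps)
  then have "y i j + y i j = 0" by (metis add.left_inverse)
  then have "scale 2 (y i j) = 0" using scale_left_distrib[of 1 1 "y i j"] by simp
  then have ij: "y i j = 0" by simp
  then have ji: "y j i = 0" using sa_star[OF yV, of i j] by simp
  have "y = su (y i i) i i + su (y j j) j j"
  proof (intro ext)
    fix r s show "y r s = (su (y i i) i i + su (y j j) j j) r s"
      using supp[of r s] ij ji d by (auto simp: su_def)
  qed
  then show ?thesis by (simp add: y_def)
qed

end

context star_system
begin

lemma sum_matrix: "(\<Sum>k\<in>A. f k) i j = (\<Sum>k\<in>A. f k i j)" for f :: "'b \<Rightarrow> 'e matrix"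
  by (induction A rule: infinite_finite_induct) simp_all

text \<open>The factor 1/2 compensates that each off-diagonal pair is met twice and that
  \<open>hm\<close> doubles a self-adjoint diagonal entry.\<close>

lemma sa_decomposition:
  assumes x: "x \<in> sa m"
  shows "x = (\<Sum>i<m. \<Sum>j<m. hm (rscale (1/2) (x i j)) i j)"
proof (intro ext)
  fix k l
  have t: "(if k = i \<and> l = j then rscale (1/2) (x i j) else 0) =
      (if j = l then if i = k then rscale (1/2) (x k l) else 0 else 0)"
    "(if k = j \<and> l = i then star (rscale (1/2) (x i j)) else 0) =
      (if j = k then if i = l then rscale (1/2) (x k l) else 0 else 0)" for i j
    using sa_star[OF x] by (auto simp: star_rscale)
  have "(\<Sum>i<m. \<Sum>j<m. hm (rscale (1/2) (x i j)) i j) k l =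
      (if k < m \<and> l < m then rscale (1/2) (x k l) + rscale (1/2) (x k l) else 0)"
    unfolding sum_matrix hm_apply t by (cases "k < m"; cases "l < m") (simp_all add: sum.distrib)
  also have "\<dots> = x k l"
    using x by (auto simp: sa_outside not_less simp flip: scale_left_distrib of_real_add)
  finally show "x k l = (\<Sum>i<m. \<Sum>j<m. hm (rscale (1/2) (x i j)) i j) k l" ..
qed

lemma zero_in_sa: "0 \<in> sa m"
  by (auto simp: sa_iff)

lemma add_in_sa: "x \<in> sa m \<Longrightarrow> y \<in> sa m \<Longrightarrow> x + y \<in> sa m"
  by (auto simp: sa_iff star_add)

lemma sa_induct [consumes 1, case_names zero hm add]:
  assumes x: "x \<in> sa m" and "P 0" "\<And>a i j. i < m \<Longrightarrow> j < m \<Longrightarrow> P (hm a i j)"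
    "\<And>x y. x \<in> sa m \<Longrightarrow> y \<in> sa m \<Longrightarrow> P x \<Longrightarrow> P y \<Longrightarrow> P (x + y)"
  shows "P x"
proof -
  have sum: "(\<Sum>i<k. f i) \<in> sa m \<and> P (\<Sum>i<k. f i)" if "\<And>i. i < k \<Longrightarrow> f i \<in> sa m \<and> P (f i)" for f and k :: nat
    using that by (induction k) (simp_all add: zero_in_sa add_in_sa assms)
  have "(\<Sum>i<m. \<Sum>j<m. hm (rscale (1/2) (x i j)) i j) \<in> sa m \<and> P (\<Sum>i<m. \<Sum>j<m. hm (rscale (1/2) (x i j)) i j)"
    by (intro sum conjI) (simp_all add: assms)
  then show ?thesis using sa_decomposition[OF x] by simp
qed

end

section \<open>From the Jordan product to an associative product\<close>

locale star_algebra = star_system scale kconj star pos e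
  for scale :: "'k::real_normed_field \<Rightarrow> 'e::ab_group_add \<Rightarrow> 'e" and kconj star pos e +
  fixes mult :: "'e \<Rightarrow> 'e \<Rightarrow> 'e"
  assumes mult_add_left: "mult (a + b) c = mult a c + mult b c"
    and mult_add_right: "mult a (b + c) = mult a b + mult a c"
    and mult_scale_left: "mult (scale r a) b = scale r (mult a b)"
    and mult_scale_right: "mult a (scale r b) = scale r (mult a b)"
    and e_mult [simp]: "mult e a = a"
    and star_mult: "star (mult a b) = mult (star b) (star a)"
    and mult_assoc: "mult (mult a b) c = mult a (mult b c)"
begin

lemma mult_0 [simp]: "mult 0 a = 0" "mult a 0 = 0"
  using mult_scale_left[of 0 0 a] mult_scale_right[of a 0 0] by simp_all

lemma mult_e [simp]: "mult a e = a"
proof -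
  have "star (mult e (star a)) = mult a e" by (subst star_mult) (simp add: star_star)
  then show ?thesis by (simp add: star_star)
qed

lemma mat_mult_su:
  assumes "i < m" "j < m" "k < m" "l < m"
  shows "mat_mult mult m (su a i j) (su b k l) = (if j = k then su (mult a b) i l else 0)"
proof (intro ext)
  fix r s
  have "(\<Sum>t<m. mult (su a i j r t) (su b k l t s)) = (\<Sum>t<m. if t = j then (if j = k then su (mult a b) i l r s else 0) else 0)"
    by (intro sum.cong refl) (auto simp: su_apply)
  then have "(\<Sum>t<m. mult (su a i j r t) (su b k l t s)) = (if j = k then su (mult a b) i l r s else 0)"
    using assms by (simp add: sum.delta)
  then show "mat_mult mult m (su a i j) (su b k l) r s = (if j = k then su (mult a b) i l else 0) r s"
    using assms by (auto simp: mat_mult_def mat_def su_apply)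
qed

lemma mat_mult_linear:
  "mat_mult mult m (x + y) z = mat_mult mult m x z + mat_mult mult m y z"
  "mat_mult mult m z (x + y) = mat_mult mult m z x + mat_mult mult m z y"
  "mat_mult mult m 0 z = 0" "mat_mult mult m z 0 = 0"
  by (auto simp: mat_mult_def mat_def fun_eq_iff mult_add_left mult_add_right sum.distrib)

abbreviation mj :: "nat \<Rightarrow> 'e matrix \<Rightarrow> 'e matrix \<Rightarrow> 'e matrix" where
  "mj m \<equiv> mat_jordan scale mult m"

lemma mscale_add: "mscale r (x + y) = mscale r x + mscale r y"
  by (simp add: fun_eq_iff scale_right_distrib)

lemma mj_linear:
  "mj m (x + y) z = mj m x z + mj m y z" "mj m z (x + y) = mj m z x + mj m z y"
  "mj m 0 z = 0" "mj m z 0 = 0"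
  unfolding mat_jordan_def mat_mult_linear
  by (simp_all only: mscale_add add_ac add_0_right) (simp_all add: fun_eq_iff)

lemma mj_commute: "mj m x y = mj m y x"
  by (simp add: mat_jordan_def add.commute)

lemma mj_restrict:
  assumes "x \<in> sa m" "y \<in> sa m" "m \<le> n"
  shows "mj n x y = mj m x y"
proof -
  have "mat_mult mult n x y = mat_mult mult m x y" if "x \<in> sa m" "y \<in> sa m" for x y
  proof (intro ext)
    fix i j
    have "(\<Sum>k<n. mult (x i k) (y k j)) = (\<Sum>k<m. mult (x i k) (y k j))"
      using assms(3) that by (intro sum.mono_neutral_right) (auto simp: sa_outside)
    moreover have "m \<le> i \<or> m \<le> j \<Longrightarrow> (\<Sum>k<n. mult (x i k) (y k j)) = 0"
      using that by (intro sum.neutral) (auto simp: sa_outside)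
    ultimately show "mat_mult mult n x y i j = mat_mult mult m x y i j"
      using assms(3) by (auto simp: mat_mult_def mat_def not_less)
  qed
  then show ?thesis using assms by (simp add: mat_jordan_def)
qed

lemma mj_hm:
  assumes "i < m" "j < m" "k < m" "l < m"
  shows "mj m (hm a i j) (hm b k l) = mscale (1/2) (
      ((if j = k then hm (mult a b) i l else 0) + (if j = l then hm (mult a (star b)) i k else 0)) +
      ((if i = k then hm (mult (star a) b) j l else 0) + (if i = l then hm (mult (star a) (star b)) j k else 0)))"
proof -
  have if_add: "(if P then x + y else 0) = (if P then x else 0) + (if P then y else 0)" for P and x y :: "'e matrix"
    by simp
  show ?thesis
    unfolding mat_jordan_def hm_def mat_mult_linear using assms
    by (simp only: mat_mult_su star_mult star_star if_add eq_commute[of k] eq_commute[of l] add_ac)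
qed

end

text \<open>The interface shared by the real and the complex construction: together with the Peirce
  rules, these three families of products determine \<open>jp\<close> on all pairs of elementary
  matrices.\<close>

locale jb_product = jb_level scale kconj star pos e n jp N + star_algebra scale kconj star pos e mult
  for scale :: "'k::real_normed_field \<Rightarrow> 'e::ab_group_add \<Rightarrow> 'e" and kconj star pos e n jp N mult +
  assumes n2: "2 \<le> n"
    and dia_mult: "star a = a \<Longrightarrow> dia a b = rscale (1/2) (mult a b)"
    and tri_mult: "3 \<le> n \<Longrightarrow> tri a b = rscale (1/2) (mult a b)"
    and square_mult: "\<lbrakk>i < n; j < n; i \<noteq> j\<rbrakk> \<Longrightarrow>
      jp (hm a i j) (hm b i j) i i = rscale (1/2) (mult a (star b) + mult b (star a))"
begin

text \<open>The product is supported at \<open>(i, i)\<close>, and its entry is read off from its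
  action on \<open>hm e i l\<close>, computed with the homomorphism property on the half space. A
  second index \<open>l\<close> exists since \<open>2 \<le> n\<close>.\<close>

lemma jp_su_su:
  assumes i: "i < n" and ab: "star a = a" "star b = b"
  shows "jp (su a i i) (su b i i) = su (rscale (1/2) (mult a b + mult b a)) i i"
proof -
  obtain l where l: "l < n" "l \<noteq> i" using n2 that[of 0] that[of 1] by (cases "i = 0") auto
  define y where "y = jp (su a i i) (su b i i)"
  have P: "su a i i \<in> J.peirce (coord n {i}) 1" "su b i i \<in> J.peirce (coord n {i}) 1"
    using i ab by (auto intro!: su_peirce simp: weight_def)
  have z: "hm e i l \<in> J.peirce (coord n {i}) (1/2)"
    using i l by (intro hm_peirce) (auto simp: weight_def)
  have "y \<in> J.peirce (coord n {i}) 1"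
    unfolding y_def by (rule peirce_rules(1)[OF _ P]) simp
  then have "r = i \<and> s = i" if "y r s \<noteq> 0" for r s
    using that unfolding peirce_coord_iff weight_def by (auto split: if_splits)
  then have y: "y = su (y i i) i i" by (rule eq_suI)
  have "y \<in> sa n" using i ab by (simp add: y_def)
  then have sy: "star (y i i) = y i i" by (rule sa_star)
  have "jp y (hm e i l) = jp (su a i i) (jp (su b i i) (hm e i l)) + jp (su b i i) (jp (su a i i) (hm e i l))"
    unfolding y_def by (rule peirce_rules(5)[OF P z])
  also have "\<dots> = hm (dia a (dia b e) + dia b (dia a e)) i l"
    using i l ab by (simp add: jp_su_hm hm_linear)
  also have "jp y (hm e i l) = hm (dia (y i i) e) i l"
    using i l sy y jp_su_hm[of i l "y i i" e] by simp
  finally have "hm (dia (y i i) e) i l i l = hm (dia a (dia b e) + dia b (dia a e)) i l i l" by simp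
  then have "rscale (1/2) (y i i) = rscale (1/2) (rscale (1/2) (mult a b + mult b a))"
    using l sy ab by (simp add: hm_entry dia_mult mult_scale_right scale_right_distrib)
  then have "y i i = rscale (1/2) (mult a b + mult b a)"
    by (rule scale_left_imp_eq[of "of_real (1/2)", rotated]) simp
  then show ?thesis using y by (simp add: y_def)
qed

lemma hm_halves: "su (rscale (1/2) (c + star c)) i i = mscale (1/2) (hm c i i)"
  by (simp only: su_linear hm_diag)

lemma jp_hm_same:
  assumes d: "i < n" "j < n" "i \<noteq> j"
  shows "jp (hm a i j) (hm b i j) = mj n (hm a i j) (hm b i j)"
proof -
  have ii: "jp (hm a i j) (hm b i j) i i = rscale (1/2) (mult a (star b) + star (mult a (star b)))"
    using d by (simp add: square_mult star_mult star_star)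
  have jj: "jp (hm a i j) (hm b i j) j j = rscale (1/2) (mult (star a) b + star (mult (star a) b))"
    using square_mult[of j i "star a" "star b"] d by (simp add: hm_star star_mult star_star)
  have "jp (hm a i j) (hm b i j) = mscale (1/2) (hm (mult a (star b)) i i + hm (mult (star a) b) j j)"
    by (subst hm_square_support[OF d]) (simp only: ii jj hm_halves mscale_add)
  then show ?thesis using d by (simp add: mj_hm)
qed

lemma jp_hm_diag:
  assumes d: "i < n" "l < n" "i \<noteq> l"
  shows "jp (hm a i i) (hm b i l) = mj n (hm a i i) (hm b i l)"
proof -
  have "jp (hm a i i) (hm b i l) = mscale (1/2) (hm (mult a b) i l + hm (mult (star a) b) i l)"
    using d by (simp add: hm_diag jp_su_hm star_add star_star add.commute dia_mult mult_add_left hm_linear)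
  then show ?thesis using d by (simp add: mj_hm)
qed

lemma jp_hm_diag_diag:
  assumes i: "i < n"
  shows "jp (hm a i i) (hm b i i) = mj n (hm a i i) (hm b i i)"
proof -
  let ?a = "a + star a" and ?b = "b + star b"
  have "jp (hm a i i) (hm b i i) = su (rscale (1/2) (mult ?a ?b + star (mult ?a ?b))) i i"
    unfolding hm_diag using i by (subst jp_su_su) (simp_all add: star_add star_star star_mult add.commute)
  also have "\<dots> = mscale (1/2) (hm (mult ?a ?b) i i)" by (rule hm_halves)
  also have "\<dots> = mj n (hm a i i) (hm b i i)"
    using i by (simp add: mj_hm mult_add_left mult_add_right hm_linear add_ac)
  finally show ?thesis .
qed

text \<open>Swapping the indices within a factor (\<open>R1\<close>, \<open>R3\<close>) and
  exchanging the factors (\<open>R2\<close>) reduce every pattern of coincidences to the five cases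
  \<open>A\<close> to \<open>E\<close>.\<close>

lemma jp_hm_eq:
  assumes d: "i < n" "j < n" "k < n" "l < n"
  shows "jp (hm a i j) (hm b k l) = mj n (hm a i j) (hm b k l)"
proof -
  define R where "R i j k l \<longleftrightarrow> (\<forall>a b. jp (hm a i j) (hm b k l) = mj n (hm a i j) (hm b k l))" for i j k l
  have R1: "R i j k l" if "R j i k l" for i j k l
    unfolding R_def using that by (metis R_def hm_star star_star)
  have R2: "R i j k l" if "R k l i j" "i < n" "j < n" "k < n" "l < n" for i j k l
    unfolding R_def using that by (metis R_def hm_in J.jp_commute mj_commute)
  have R3: "R i j k l" if "R i j l k" for i j k l
    unfolding R_def using that by (metis R_def hm_star star_star)
  have A: "R i j k l" if "i < n" "j < n" "k < n" "l < n" "i \<noteq> k" "i \<noteq> l" "j \<noteq> k" "j \<noteq> l" for i j k l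
    using that unfolding R_def by (auto simp: jp_disjoint mj_hm)
  have B: "R i j j l" if "i < n" "j < n" "l < n" "i \<noteq> j" "j \<noteq> l" "i \<noteq> l" for i j l
  proof -
    have "3 \<le> n" using that card_mono[of "{..<n}" "{i, j, l}"] by simp
    then show ?thesis
      using that unfolding R_def by (auto simp: jp_hm_hm mj_hm tri_mult hm_linear)
  qed
  have C: "R i j i j" if "i < n" "j < n" "i \<noteq> j" for i j
    using that unfolding R_def by (auto simp: jp_hm_same)
  have D: "R i i i l" if "i < n" "l < n" "i \<noteq> l" for i l
    using that unfolding R_def by (auto simp: jp_hm_diag)
  have E: "R i i i i" if "i < n" for i
    using that unfolding R_def by (auto simp: jp_hm_diag_diag)
  have same: "R i j k j" if "i < n" "j < n" "k < n" for i j k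
  proof -
    consider "i = j" "j = k" | "i = j" "j \<noteq> k" | "i \<noteq> j" "j = k" | "i \<noteq> j" "i = k" | "i \<noteq> j" "j \<noteq> k" "i \<noteq> k"
      by auto
    then show ?thesis
      using that A B C D E R1 R2 R3 by cases metis+
  qed
  have "R i j k l"
  proof (cases "i \<noteq> k \<and> i \<noteq> l \<and> j \<noteq> k \<and> j \<noteq> l")
    case False
    then consider "j = l" | "j = k" | "i = k" | "i = l" by auto
    then show ?thesis
    proof cases
      case 1 then show ?thesis using same d by simp
    next
      case 2 then show ?thesis using R3 same d by simp
    next
      case 3
      have "R j i l i" using same d by simp
      then show ?thesis using R1 R3 3 by blast
    next
      case 4
      have "R j i k i" using same d by simp
      then show ?thesis using R1 4 by blast
    qed
  qed (use A d in blast)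
  then show ?thesis by (simp add: R_def)
qed

lemma jp_eq_mj:
  assumes x: "x \<in> sa n" and y: "y \<in> sa n"
  shows "jp x y = mj n x y"
  using x
proof (induction rule: sa_induct)
  case zero
  show ?case using y by (simp only: mj_linear J.jp_zero)
next
  case (add x x')
  then show ?case using y by (simp only: mj_linear J.jp_add)
next
  case (hm a i j)
  note hV = hm_in[OF hm]
  show ?case using y
  proof (induction rule: sa_induct)
    case zero
    show ?case using hV by (simp only: mj_linear J.jp_zero)
  next
    case (add x x')
    then show ?case using hV by (simp only: mj_linear J.jp_add_right)
  next
    case (hm b k l)
    then show ?case using \<open>i < n\<close> \<open>j < n\<close> by (intro jp_hm_eq)
  qed
qed

end

section \<open>Identities of the candidate products\<close>

context jb_level
begin

lemma hm_eqD: "i \<noteq> j \<Longrightarrow> hm a i j = hm b i j \<Longrightarrow> a = b"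
  using hm_entry(1) by metis

text \<open>Commutativity of \<open>jp\<close>, read at the transposed positions.\<close>

lemma tri_star:
  assumes n: "3 \<le> n"
  shows "star (tri a b) = tri (star b) (star a)"
proof -
  have "hm (tri a b) 0 2 = jp (hm b 1 2) (hm a 0 1)"
    using n jp_hm_hm[of 0 1 2 a b] by (subst J.jp_commute) simp_all
  also have "\<dots> = jp (hm (star b) 2 1) (hm (star a) 1 0)" by (simp add: hm_star)
  also have "\<dots> = hm (tri (star b) (star a)) 2 0" using n by (intro jp_hm_hm) auto
  finally have "hm (star (tri a b)) 2 0 = hm (tri (star b) (star a)) 2 0" by (simp add: hm_star)
  then show ?thesis by (rule hm_eqD[rotated]) simp
qed

text \<open>The elements with entries at \<open>(0, 1)\<close> and at \<open>(2, 3)\<close> operator-commute; this is where four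
  indices are needed.\<close>

lemma tri_assoc:
  assumes n: "4 \<le> n"
  shows "tri (tri a b) c = tri a (tri b c)"
proof -
  have "jp (hm c 2 3) (jp (hm a 0 1) (hm b 1 2)) = jp (hm a 0 1) (jp (hm c 2 3) (hm b 1 2))"
    using n by (intro peirce_rules(6)[of _ "{0, 1}"] hm_peirce) (auto simp: weight_def)
  moreover have "jp (hm c 2 3) (jp (hm a 0 1) (hm b 1 2)) = hm (tri (tri a b) c) 0 3"
    using n by (subst J.jp_commute) (simp_all add: jp_hm_hm)
  moreover have "jp (hm c 2 3) (hm b 1 2) = hm (tri b c) 1 3"
    using n by (subst J.jp_commute) (simp_all add: jp_hm_hm)
  ultimately have "hm (tri (tri a b) c) 0 3 = hm (tri a (tri b c)) 0 3"
    using n by (simp add: jp_hm_hm)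
  then show ?thesis by (rule hm_eqD[rotated]) simp
qed

text \<open>For self-adjoint \<open>a\<close> the product of \<open>hm e 0 1\<close> and
  \<open>hm a 0 1\<close> is the diagonal matrix with \<open>a\<close> at 0 and 1, and the entry at
  1 does not touch position \<open>(0, 2)\<close>. Acting on \<open>hm b 0 2\<close>, it can
  therefore be evaluated both by \<open>dia\<close> and, through the half space, by
  \<open>tri\<close>.\<close>

lemma dia_eq_tri:
  assumes n: "3 \<le> n" and a: "star a = a"
  shows "dia a b = tri a b"
proof -
  have "jp (hm e 0 1) (hm a 0 1) = su a 0 0 + su a 1 1"
  proof (intro ext)
    fix k l show "jp (hm e 0 1) (hm a 0 1) k l = (su a 0 0 + su a 1 1) k l"
      using n a half_half[of a] by (auto simp: jp_pair hm_apply su_apply scale_right_distrib)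
  qed
  then have "jp (hm a 0 1) (hm e 0 1) = su a 0 0 + su a 1 1"
    using n by (subst J.jp_commute) simp_all
  moreover have "jp (jp (hm a 0 1) (hm e 0 1)) (hm b 0 2) =
    jp (hm a 0 1) (jp (hm e 0 1) (hm b 0 2)) + jp (hm e 0 1) (jp (hm a 0 1) (hm b 0 2))"
    using n by (intro peirce_rules(5)[of _ "{0, 1}"] hm_peirce) (auto simp: weight_def)
  moreover have "jp (hm c 0 1) (hm d 0 2) = hm (tri c d) 1 2" if "star c = c" for c d
    using jp_hm_hm[of 1 0 2 c d] n hm_star[of c 1 0] that by simp
  ultimately have "jp (su a 0 0) (hm b 0 2) + jp (su a 1 1) (hm b 0 2) =
    hm (tri a (tri e b)) 0 2 + hm (tri e (tri a b)) 0 2"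
    using n a by (simp add: jp_hm_hm J.jp_add)
  moreover have "tri a (tri e b) + tri e (tri a b) = tri a b"
    using n half_half[of "tri a b"] by (simp add: tri_e tri_linear)
  ultimately have "hm (dia a b) 0 2 = hm (tri a b) 0 2"
    using n a by (simp add: jp_su_hm jp_su_hm_disjoint hm_linear(1)[symmetric])
  then show ?thesis by (rule hm_eqD[rotated]) simp
qed

text \<open>A third index \<open>l\<close> gives a test element \<open>hm e i l\<close>. The product
  has no entry at \<open>(l, l)\<close>, so its action on the test element exposes the entry at
  \<open>(i, i)\<close>.\<close>

lemma square_tri:
  assumes n: "3 \<le> n" and d: "i < n" "j < n" "i \<noteq> j"
  shows "jp (hm a i j) (hm b i j) i i = tri a (star b) + tri b (star a)"
proof -
  have "card {i, j} < card {..<n}" using n d by simp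
  then obtain l where l: "l < n" "l \<noteq> i" "l \<noteq> j"
    by (metis card_mono finite.emptyI finite.insertI insert_iff lessThan_iff not_le subsetI)
  let ?y = "jp (hm a i j) (hm b i j)"
  have yV: "?y \<in> sa n" using d by simp
  have "jp ?y (hm e i l) = jp (hm a i j) (jp (hm b i j) (hm e i l)) + jp (hm b i j) (jp (hm a i j) (hm e i l))"
    using d l by (intro peirce_rules(5)[of _ "{i, j}"] hm_peirce) (auto simp: weight_def)
  moreover have "jp (hm c i j) (hm e i l) = hm (tri (star c) e) j l" for c
    using jp_hm_hm[of j i l "star c" e] d l by (simp add: hm_star)
  ultimately have "jp ?y (hm e i l) = hm (tri a (tri (star b) e) + tri b (tri (star a) e)) i l"
    using d l by (simp add: jp_hm_hm hm_linear)
  then have "jp ?y (hm e i l) i l = tri a (tri (star b) e) + tri b (tri (star a) e)"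
    using l by (simp add: hm_entry)
  moreover have "jp ?y (hm e i l) i l = rscale (1/2) (?y l l + ?y i i)"
    using d l yV by (subst J.jp_commute) (simp_all add: jp_pair)
  moreover have "?y l l = 0"
    by (subst hm_square_support[OF d]) (use l in \<open>simp add: su_apply\<close>)
  moreover have "tri c e = rscale (1/2) c" for c
    using tri_star[OF n, of e "star c"] n by (simp add: tri_e star_rscale star_star)
  ultimately have "rscale (1/2) (?y i i) = rscale (1/2) (tri a (star b) + tri b (star a))"
    using n by (simp add: tri_linear scale_right_distrib)
  then show ?thesis by (rule scale_left_imp_eq[of "of_real (1/2)", rotated]) simp
qed

text \<open>Up to the factor 1/2, \<open>star (dia b (star x))\<close> is right multiplication by
  \<open>b\<close>, realized by \<open>b\<close> at \<open>(1, 1)\<close>. The identity says that it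
  commutes with left multiplication, realized by \<open>a\<close> at \<open>(0, 0)\<close>.\<close>

lemma dia_commute:
  assumes n: "2 \<le> n" and ab: "star a = a" "star b = b"
  shows "star (dia b (star (dia a c))) = dia a (star (dia b (star c)))"
proof -
  have 1: "jp (su b 1 1) (hm x 0 1) = hm (star (dia b (star x))) 0 1" for x
    using jp_su_hm[of 1 0 b "star x"] n ab by (simp add: hm_star)
  have "jp (su b 1 1) (jp (su a 0 0) (hm c 0 1)) = jp (su a 0 0) (jp (su b 1 1) (hm c 0 1))"
    using n ab by (intro peirce_rules(6)[of _ "{0}"] hm_peirce su_peirce) (auto simp: weight_def)
  then have "hm (star (dia b (star (dia a c)))) 0 1 = hm (dia a (star (dia b (star c)))) 0 1"
    using n ab by (simp add: 1[unfolded One_nat_def] jp_su_hm)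
  then show ?thesis by (rule hm_eqD[rotated]) simp
qed

text \<open>With two indices there is no third one to test with. Instead \<open>hm a i j\<close> is
  written as twice the product of \<open>su a i i\<close> and \<open>hm e i j\<close>, and the
  entries at \<open>(j, j)\<close>, which form the Peirce space of 0 for \<open>coord n {i}\<close>
  when only \<open>i\<close> and \<open>j\<close> occur, are compared in
  \<open>peirce_half_exchange\<close>. This moves \<open>su a i i\<close> over to
  \<open>hm b i j\<close>, leaving a product with \<open>hm e i j\<close>.\<close>

lemma square_dia:
  assumes d: "i < n" "j < n" "i \<noteq> j" and a: "star a = a"
  shows "jp (hm a i j) (hm b i j) j j = dia a b + star (dia a b)"
proof -
  have n: "2 \<le> n" using d by simp
  let ?p = "coord n {i}"
  have P: "su a i i \<in> J.peirce ?p 1" "hm e i j \<in> J.peirce ?p (1/2)" "hm b i j \<in> J.peirce ?p (1/2)"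
    using d a by (auto intro!: hm_peirce su_peirce simp: weight_def)
  let ?x = "su a i i" and ?z = "hm e i j" and ?w = "hm b i j"
  have V: "?x \<in> sa n" "?z \<in> sa n" "?w \<in> sa n" using d a by simp_all
  have ex: "jp (jp ?x ?z) ?w + mscale 2 (jp ?p (jp (jp ?x ?w) ?z)) = jp (jp ?x ?w) ?z + jp ?x (jp ?z ?w)"
    by (rule J.peirce_half_exchange[OF coord_in coord_idem P])
  have 1: "jp ?p (jp (jp ?x ?w) ?z) j j = 0"
    using V d by (simp add: jp_coord weight_def)
  have 2: "jp ?x (jp ?z ?w) j j = 0"
  proof -
    define A B where "A = jp ?z ?w i i" and "B = jp ?z ?w j j"
    have eq: "jp ?z ?w = su A i i + su B j j" unfolding A_def B_def using d by (rule hm_square_support)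
    have "jp ?z ?w \<in> sa n" using V by simp
    then have AB: "star A = A" "star B = B" unfolding A_def B_def by (simp_all only: sa_star)
    have "jp ?x (su A i i) \<in> J.peirce ?p 1"
      using d AB by (intro peirce_rules(1)[where i = 1] P su_peirce) (auto simp: weight_def)
    then have "jp ?x (su A i i) j j = 0"
      using d unfolding peirce_coord_iff weight_def by fastforce
    moreover have "jp ?x (su B j j) = 0"
      using d AB by (intro peirce_rules(3)[of _ "{i}"] P su_peirce) (auto simp: weight_def)
    moreover have "jp ?x (su A i i + su B j j) = jp ?x (su A i i) + jp ?x (su B j j)"
      using V AB d by (intro J.jp_add_right) simp_all
    ultimately show ?thesis unfolding eq by simp
  qed
  have "jp (jp ?x ?z) ?w j j = jp (jp ?x ?w) ?z j j"
    using fun_cong[OF fun_cong[OF ex, of j], of j] 1 2 by simp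
  then have "rscale (1/2) (jp (hm a i j) ?w j j) = jp (hm (dia a b) i j) ?z j j"
    using d a n by (simp add: jp_su_hm dia_e_right hm_linear J.jp_scale)
  also have "\<dots> = rscale (1/2) (dia a b + star (dia a b))"
    using d by (subst J.jp_commute) (simp_all add: jp_pair hm_apply add.commute)
  finally show ?thesis by (rule scale_left_imp_eq[of "of_real (1/2)", rotated]) simp
qed

text \<open>A phase at \<open>j\<close> multiplies both factors and does not affect the entry at
  \<open>(i, i)\<close>.\<close>

lemma square_phase:
  assumes d: "i < n" "j < n" "i \<noteq> j" and z: "kconj \<zeta> * \<zeta> = 1"
  shows "jp (hm (scale \<zeta> a) i j) (hm (scale \<zeta> b) i j) i i = jp (hm a i j) (hm b i j) i i"
proof -
  define c where "c r = (if r = j then \<zeta> else 1)" for r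
  have c: "kconj (c r) * c r = 1" for r using z by (simp add: c_def kconj_simps)
  have "jp (monomial n c id (hm a i j)) (monomial n c id (hm b i j)) = monomial n c id (jp (hm a i j) (hm b i j))"
    using d c by (subst phase_automorphism) auto
  then have "jp (hm (scale \<zeta> a) i j) (hm (scale \<zeta> b) i j) = monomial n c id (jp (hm a i j) (hm b i j))"
    using d by (simp add: phase_hm c_def kconj_simps)
  then show ?thesis using d by (simp add: monomial_def mat_def c_def kconj_simps)
qed

end

section \<open>The multiplication in the real case\<close>

locale real_jb_level = jb_level scale "\<lambda>c. c" star pos e n jp N
  for scale :: "real \<Rightarrow> 'e::ab_group_add \<Rightarrow> 'e" and star pos e n jp N +
  assumes n4: "4 \<le> n"
begin

definition rmult :: "'e \<Rightarrow> 'e \<Rightarrow> 'e" where "rmult a b = scale 2 (tri a b)"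

lemma tri_rscale: "tri (scale r a) b = scale r (tri a b)" "tri a (scale r b) = scale r (tri a b)"
  using tri_linear(3)[of r a b] tri_linear(4)[of a r b] n4 by simp_all

lemma jb_product: "jb_product scale (\<lambda>c. c) star pos e n jp N rmult"
proof unfold_locales
  show "rmult (a + b) c = rmult a c + rmult b c" "rmult a (b + c) = rmult a b + rmult a c" for a b c
    using n4 by (simp_all add: rmult_def tri_linear scale_right_distrib)
  show "rmult (scale r a) b = scale r (rmult a b)" "rmult a (scale r b) = scale r (rmult a b)" for r a b
    by (simp_all add: rmult_def tri_rscale mult.commute)
  show "rmult e a = a" for a
  proof -
    have "tri e a = scale (of_real (1/2)) a" using n4 by (intro tri_e) simp
    then show ?thesis by (simp only: rmult_def) simp
  qed
  show "star (rmult a b) = rmult (star b) (star a)" for a b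
    using n4 by (simp add: rmult_def star_scale tri_star)
  show "rmult (rmult a b) c = rmult a (rmult b c)" for a b c
    using n4 by (simp add: rmult_def tri_rscale tri_assoc)
  show "dia a b = scale (of_real (1/2)) (rmult a b)" if "star a = a" for a b
    using n4 that by (simp add: rmult_def dia_eq_tri)
  show "tri a b = scale (of_real (1/2)) (rmult a b)" for a b
    by (simp add: rmult_def)
  show "jp (hm a i j) (hm b i j) i i = scale (of_real (1/2)) (rmult a (star b) + rmult b (star a))"
    if "i < n" "j < n" "i \<noteq> j" for a b i j
    using n4 that by (simp add: rmult_def square_tri scale_right_distrib)
qed (use n4 in simp)

end

section \<open>The multiplication in the complex case\<close>

locale complex_jb_level = jb_level scale cnj star pos e n jp N
  for scale :: "complex \<Rightarrow> 'e::ab_group_add \<Rightarrow> 'e" and star pos e n jp N +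
  assumes n2: "2 \<le> n"
begin

lemma scale_complex: "scale c x = rscale (Re c) x + scale \<i> (rscale (Im c) x)"
  using complex_eq[of c] by (metis scale_left_distrib scale_scale)

definition re :: "'e \<Rightarrow> 'e" where "re a = rscale (1/2) (a + star a)"
definition im :: "'e \<Rightarrow> 'e" where "im a = re (scale (- \<i>) a)"

lemma star_re [simp]: "star (re a) = re a" and star_im [simp]: "star (im a) = im a"
  by (simp_all add: im_def re_def star_rscale star_add star_diff star_minus star_star add.commute)

lemma re_add: "re (a + b) = re a + re b" and im_add: "im (a + b) = im a + im b"
  by (simp_all add: im_def re_def star_add star_diff star_minus scale_right_distrib scale_right_diff_distrib)

lemma re_rscale: "re (rscale r a) = rscale r (re a)"
  by (simp add: re_def star_rscale scale_right_distrib mult.commute)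

lemma im_rscale: "im (rscale r a) = rscale r (im a)"
proof -
  have "scale (- \<i>) (rscale r a) = rscale r (scale (- \<i>) a)" by (simp add: mult.commute)
  then show ?thesis by (simp only: im_def re_rscale)
qed

lemma im_i: "im (scale \<i> a) = re a" and re_i: "re (scale \<i> a) = - im a"
  by (simp_all add: im_def re_def star_minus scale_right_distrib scale_right_diff_distrib star_scale)

lemma re_sa: "star a = a \<Longrightarrow> re a = a" and im_sa: "star a = a \<Longrightarrow> im a = 0"
  using half_half[of a] by (simp_all add: im_def re_def star_minus star_scale scale_right_distrib)

lemma re_im: "a = re a + scale \<i> (im a)"
proof -
  have "scale \<i> (im a) = rscale (1/2) (a - star a)"
    by (simp add: im_def re_def star_minus star_scale scale_right_distrib scale_right_diff_distrib mult.commute)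
  then show ?thesis using half_half[of a] by (simp add: re_def scale_right_distrib scale_right_diff_distrib)
qed

text \<open>Since \<open>dia\<close> describes multiplication by self-adjoint left factors only, it
  is extended complex linearly along \<open>a = re a + scale \<i> (im a)\<close>. The factor 2
  undoes the 1/2 of the Jordan product.\<close>

definition cmult :: "'e \<Rightarrow> 'e \<Rightarrow> 'e" where
  "cmult a b = rscale 2 (dia (re a) b + scale \<i> (dia (im a) b))"

lemma dia_i: "star a = a \<Longrightarrow> dia a (scale \<i> b) = scale \<i> (dia a b)"
  using n2 by (intro dia_phase) simp_all

lemma dia_scale: "star a = a \<Longrightarrow> dia a (scale c b) = scale c (dia a b)"
  unfolding scale_complex[of c] using n2 by (simp add: dia_linear dia_i del: scale_scale)

lemma cmult_sa: "star a = a \<Longrightarrow> cmult a b = rscale 2 (dia a b)"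
  using n2 by (simp add: cmult_def re_sa im_sa dia_def su_linear(4))

lemma cmult_add: "cmult (a + b) c = cmult a c + cmult b c" "cmult a (b + c) = cmult a b + cmult a c"
  using n2 by (simp_all add: cmult_def re_add im_add dia_linear dia_add_left scale_right_distrib add_ac)

lemma cmult_scale_right: "cmult a (scale c b) = scale c (cmult a b)"
  by (simp add: cmult_def dia_scale scale_right_distrib mult_ac)

lemma cmult_diff: "cmult a (b - c) = cmult a b - cmult a c"
  using cmult_add(2)[of a "b - c" c] by simp

lemma dia_minus: "star a = a \<Longrightarrow> dia (- a) b = - dia a b"
  using dia_linear(3)[OF n2, of a "-1" b] by simp

lemma cmult_i: "cmult (scale \<i> a) b = scale \<i> (cmult a b)"
proof -
  have "cmult (scale \<i> a) b = rscale 2 (scale \<i> (dia (re a) b) - dia (im a) b)"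
    by (simp add: cmult_def re_i im_i dia_minus)
  moreover have "scale \<i> (scale \<i> x) = - x" for x by simp
  then have "scale \<i> (dia (re a) b + scale \<i> (dia (im a) b)) = scale \<i> (dia (re a) b) - dia (im a) b"
    by (simp only: scale_right_distrib) simp
  then have "scale \<i> (cmult a b) = rscale 2 (scale \<i> (dia (re a) b) - dia (im a) b)"
    unfolding cmult_def by (metis scale_left_commute)
  ultimately show ?thesis by simp
qed

lemma cmult_rscale: "cmult (rscale r a) b = rscale r (cmult a b)"
  using n2 by (simp add: cmult_def re_rscale im_rscale dia_linear scale_right_distrib mult_ac)

lemma cmult_scale_left: "cmult (scale c a) b = scale c (cmult a b)"
  unfolding scale_complex[of c] cmult_add cmult_i cmult_rscale ..

text \<open>The case of the middle factor \<open>e\<close> in \<open>dia_commute\<close>.\<close>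

lemma star_cmult_sa: "star a = a \<Longrightarrow> star b = b \<Longrightarrow> star (cmult b a) = cmult a b"
proof -
  assume ab: "star a = a" "star b = b"
  have "star (dia b (star (dia a e))) = dia a (star (dia b (star e)))"
    using n2 ab by (intro dia_commute)
  then have "rscale (1/2) (star (dia b a)) = rscale (1/2) (dia a b)"
    using n2 ab by (simp add: dia_e_right star_rscale dia_linear)
  then have "star (dia b a) = dia a b" by (rule scale_left_imp_eq[of "of_real (1/2)", rotated]) simp
  then show ?thesis using ab by (simp add: cmult_sa star_scale)
qed

lemma star_cmult: "star (cmult a b) = cmult (star b) (star a)"
proof -
  have sa: "star (cmult x y) = cmult y x" if "star x = x" "star y = y" for x y
    using that star_cmult_sa by simp
  have "star (cmult (x + scale \<i> x') (y + scale \<i> y')) =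
      cmult (star (y + scale \<i> y')) (star (x + scale \<i> x'))"
    if "star x = x" "star x' = x'" "star y = y" "star y' = y'" for x x' y y'
    using that by (simp add: cmult_add cmult_scale_left cmult_scale_right star_add star_scale sa
        scale_right_distrib add_ac del: scale_minus_left)
  from this[of "re a" "im a" "re b" "im b"] show ?thesis by (simp flip: re_im)
qed

text \<open>For self-adjoint outer factors this is \<open>dia_commute\<close> rewritten by means of
  the involution. The middle factor is arbitrary there, and complex bilinearity takes care of the
  outer ones.\<close>

lemma cmult_assoc: "cmult (cmult a b) c = cmult a (cmult b c)"
proof -
  have 1: "cmult (cmult x b) y = cmult x (cmult b y)" if xy: "star x = x" "star y = y" for x y
  proof -
    have "star (cmult y (star (cmult x b))) = cmult x (star (cmult y (star b)))"
      using dia_commute[OF n2 xy] xy by (simp add: cmult_sa star_scale dia_scale)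
    then show ?thesis using xy by (simp add: star_cmult star_star)
  qed
  have "cmult (cmult (x + scale \<i> x') b) (y + scale \<i> y') = cmult (x + scale \<i> x') (cmult b (y + scale \<i> y'))"
    if "star x = x" "star x' = x'" "star y = y" "star y' = y'" for x x' y y'
    using that by (simp add: cmult_add cmult_scale_left cmult_scale_right 1 scale_right_distrib add_ac)
  from this[of "re a" "im a" "re c" "im c"] show ?thesis by (simp flip: re_im)
qed

lemma jb_product: "jb_product scale cnj star pos e n jp N cmult"
proof unfold_locales
  show "cmult (a + b) c = cmult a c + cmult b c" "cmult a (b + c) = cmult a b + cmult a c"
    "cmult (scale r a) b = scale r (cmult a b)" "cmult a (scale r b) = scale r (cmult a b)"
    "star (cmult a b) = cmult (star b) (star a)" "cmult (cmult a b) c = cmult a (cmult b c)" for a b c r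
    by (fact cmult_add cmult_scale_left cmult_scale_right star_cmult cmult_assoc)+
  show "cmult e a = a" for a
    using n2 by (simp add: cmult_sa dia_e of_real_divide)
  show dia: "dia a b = scale (of_real (1/2)) (cmult a b)" if "star a = a" for a b
    using that by (simp add: cmult_sa of_real_divide)
  show "tri a b = scale (of_real (1/2)) (cmult a b)" if n: "3 \<le> n" for a b
  proof -
    have "tri (re a + scale \<i> (im a)) b = scale (of_real (1/2)) (cmult (re a + scale \<i> (im a)) b)"
      using n by (simp add: tri_linear tri_phase dia_eq_tri[symmetric] dia cmult_add cmult_i
          scale_right_distrib mult.commute)
    then show ?thesis by (simp flip: re_im)
  qed
  show "jp (hm a i j) (hm b i j) i i = scale (of_real (1/2)) (cmult a (star b) + cmult b (star a))"
    if d: "i < n" "j < n" "i \<noteq> j" for a b i j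
  proof -
    have sa: "jp (hm x i j) (hm y i j) i i = scale (of_real (1/2)) (cmult x (star y) + cmult y x)"
      if "star x = x" for x y
      using square_dia[of j i x "star y"] d that
      by (simp add: hm_star dia star_rscale star_cmult star_star scale_right_distrib hm_star[of x j i, unfolded that])
    \<comment> \<open>A common phase may be removed from both factors by
      \<open>square_phase\<close>. Writing \<open>b\<close> as \<i> times its multiple by
      \<open>- \<i>\<close> turns the skew factor \<open>scale \<i> (im a)\<close> into the
      self-adjoint \<open>im a\<close>.\<close>
    have "hm b i j = hm (scale \<i> (scale (- \<i>) b)) i j" by simp
    then have "jp (hm (scale \<i> (im a)) i j) (hm b i j) i i = jp (hm (im a) i j) (hm (scale (- \<i>) b) i j) i i"
      using square_phase[OF d, of \<i> "im a" "scale (- \<i>) b"] by simp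
    also have "\<dots> = scale (of_real (1/2)) (scale \<i> (cmult (im a) (star b)) - scale \<i> (cmult b (im a)))"
      using sa[of "im a" "scale (- \<i>) b"]
      by (simp add: star_scale star_minus cmult_scale_left cmult_scale_right del: scale_minus_left)
        (simp add: scale_right_diff_distrib)
    finally have "jp (hm (re a + scale \<i> (im a)) i j) (hm b i j) i i =
      scale (of_real (1/2)) (cmult (re a + scale \<i> (im a)) (star b) + cmult b (star (re a + scale \<i> (im a))))"
      using d sa[of "re a" b]
      by (simp add: hm_linear J.jp_add cmult_add cmult_diff star_add star_scale cmult_scale_left cmult_scale_right
          scale_right_distrib scale_right_diff_distrib)
    then show ?thesis by (simp flip: re_im)
  qed
qed (use n2 in simp)

end

section \<open>The C*-norm\<close>

lemma real_eq_of_upper_bounds: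
  fixes x y :: real
  assumes "0 \<le> x" "0 \<le> y" "\<And>r. 0 \<le> r \<Longrightarrow> x \<le> r \<longleftrightarrow> y \<le> r"
  shows "x = y"
  using assms(1,2) assms(3)[of x] assms(3)[of y] by simp

locale jb_star_algebra = jb_level scale kconj star pos e 2 jp N + star_algebra scale kconj star pos e mult
  for scale :: "'k::real_normed_field \<Rightarrow> 'e::ab_group_add \<Rightarrow> 'e" and kconj star pos e jp N mult +
  assumes jp_mj: "x \<in> sa 2 \<Longrightarrow> y \<in> sa 2 \<Longrightarrow> jp x y = mj 2 x y"
    and kconj_norm: "kconj c * c = of_real ((norm c)\<^sup>2)"
begin

sublocale L: jb_level scale kconj star pos e 1 jp N
  by (rule lower_level) simp_all

definition P :: "'e set" where "P = {a. su a 0 0 \<in> pos 1}"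

lemma P_sa: "a \<in> P \<Longrightarrow> star a = a"
proof -
  assume "a \<in> P"
  then have "su a 0 0 \<in> sa 1" unfolding P_def using L.J.C_in by blast
  then show ?thesis using sa_star[of "su a 0 0" 1 0 0] by (simp add: su_apply)
qed

lemma P_add: "a \<in> P \<Longrightarrow> b \<in> P \<Longrightarrow> a + b \<in> P"
  using L.J.ord.cone_add by (simp add: P_def su_linear)

lemma P_rscale: "0 \<le> r \<Longrightarrow> a \<in> P \<Longrightarrow> rscale r a \<in> P"
  using L.J.ord.cone_scale by (simp add: P_def su_linear)

lemma unit_su: "diag_mat e (Suc 0) = su e 0 0" "diag_mat e 2 = su e 0 0 + su e 1 1"
  by (auto simp: diag_mat_def mat_def su_apply fun_eq_iff less_2_cases_iff)

lemma P_e: "0 \<le> r \<Longrightarrow> rscale r e \<in> P"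
  using P_rscale L.J.ord.unit_pos by (simp add: P_def unit_su)

lemma sandwich_column:
  assumes "i < 2" "x \<in> sa 2"
  shows "sandwich 2 1 (\<lambda>k _. if k = i then 1 else 0) (\<lambda>k _. if k = i then 1 else 0) x = su (x i i) 0 0"
proof (rule sandwich_eqI)
  fix k l :: nat assume kl: "k < 1" "l < 1"
  have "sandwich 2 1 (\<lambda>k _. if k = i then 1 else 0) (\<lambda>k _. if k = i then 1 else 0) x k l =
    (\<Sum>r<2. \<Sum>s<2. if s = i then if r = i then x r s else 0 else 0)"
    unfolding sandwich_apply[OF kl] by (intro sum.cong refl) (simp add: kconj_simps)
  then show "sandwich 2 1 (\<lambda>k _. if k = i then 1 else 0) (\<lambda>k _. if k = i then 1 else 0) x k l = su (x i i) 0 0 k l"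
    using assms(1) kl by (simp add: su_apply sum.delta)
qed (auto simp: su_apply)

lemma sandwich_row:
  assumes "i < 2"
  shows "sandwich 1 2 (\<lambda>_ k. if k = i then 1 else 0) (\<lambda>_ k. if k = i then 1 else 0) (su a 0 0) = su a i i"
proof (rule sandwich_eqI)
  show "sandwich 1 2 (\<lambda>_ k. if k = i then 1 else 0) (\<lambda>_ k. if k = i then 1 else 0) (su a 0 0) k l = su a i i k l"
    if "k < 2" "l < 2" for k l
    using that by (simp add: sandwich_apply su_apply kconj_simps)
qed (use assms in \<open>auto simp: su_apply\<close>)

lemma diag_pos_iff:
  assumes "star a = a" "star b = b"
  shows "su a 0 0 + su b 1 1 \<in> pos 2 \<longleftrightarrow> a \<in> P \<and> b \<in> P"
proof
  assume pos: "su a 0 0 + su b 1 1 \<in> pos 2"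
  have V: "su a 0 0 + su b 1 1 \<in> sa 2" using assms by (intro add_in_sa) simp_all
  have entries: "(su a 0 0 + su b 1 1) 0 0 = a" "(su a 0 0 + su b 1 1) 1 1 = b"
    by (simp_all add: su_apply)
  have "su ((su a 0 0 + su b 1 1) i i) 0 0 \<in> pos 1" if "i < 2" for i
    unfolding sandwich_column[OF that V, symmetric] using pos by (intro sandwich_pos) simp_all
  from this[of 0] this[of 1] show "a \<in> P \<and> b \<in> P" unfolding entries P_def by simp
next
  assume "a \<in> P \<and> b \<in> P"
  then have "su a 0 0 \<in> pos 1" "su b 0 0 \<in> pos 1" by (simp_all add: P_def)
  then have "su a 0 0 \<in> pos 2" "su b 1 1 \<in> pos 2"
    using sandwich_pos[of 1 2 "su a 0 0" "\<lambda>_ k. if k = 0 then 1 else 0"]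
      sandwich_pos[of 1 2 "su b 0 0" "\<lambda>_ k. if k = 1 then 1 else 0"]
    by (simp_all add: sandwich_row del: One_nat_def)
  then show "su a 0 0 + su b 1 1 \<in> pos 2" by (rule J.ord.cone_add)
qed

lemma jp_hm_square: "jp (hm a 0 1) (hm a 0 1) = su (mult a (star a)) 0 0 + su (mult (star a) a) 1 1"
proof -
  have half: "mscale (1/2) (hm c i i) = su c i i" if "star c = c" for c i
  proof -
    have "rscale (1/2) (c + c) = c" using half_half[of c] by (simp add: scale_right_distrib)
    then show ?thesis using that by (simp only: hm_diag su_linear[symmetric])
  qed
  have "jp (hm a 0 1) (hm a 0 1) = mj 2 (hm a 0 1) (hm a 0 1)" by (simp add: jp_mj)
  also have "\<dots> = mscale (1/2) (hm (mult a (star a)) 0 0) + mscale (1/2) (hm (mult (star a) a) 1 1)"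
    by (simp add: mj_hm mscale_add)
  finally show ?thesis by (simp only: half star_mult star_star)
qed

text \<open>Both products are diagonal entries of the square of the off-diagonal matrix of
  \<open>a\<close>: positivity of \<open>mult (star a) a\<close> is a fact about level 2.\<close>

lemma square_P: "mult (star a) a \<in> P" "mult a (star a) \<in> P"
proof -
  have "jp (hm a 0 1) (hm a 0 1) \<in> pos 2" by (rule J.square_in_C) simp
  then show "mult (star a) a \<in> P" "mult a (star a) \<in> P"
    by (simp_all add: jp_hm_square diag_pos_iff star_mult star_star del: One_nat_def)
qed

lemma jp_su_square: "star a = a \<Longrightarrow> jp (su a 0 0) (su a 0 0) = su (mult a a) 0 0"
proof -
  assume a: "star a = a"
  then have "jp (su a 0 0) (su a 0 0) = mj 2 (su a 0 0) (su a 0 0)" by (intro jp_mj) simp_all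
  also have "\<dots> = su (mult a a) 0 0"
    by (simp add: mat_jordan_def mat_mult_su J.scale_right_distrib J.scale_half)
  finally show ?thesis .
qed

lemma P_sqrt:
  assumes "a \<in> P"
  obtains d where "star d = d" "mult d d = a"
proof -
  obtain x where x: "x \<in> sa 1" "su a 0 0 = jp x x"
    using assms L.J.C_squareE unfolding P_def by blast
  have x_su: "x = su (x 0 0) 0 0" using x by (intro eq_suI) (auto simp: sa_iff Suc_le_eq)
  have sx: "star (x 0 0) = x 0 0" using x by (simp add: sa_star)
  have "su a 0 0 = su (mult (x 0 0) (x 0 0)) 0 0"
    using x(2) jp_su_square[OF sx] x_su by metis
  then have "su a 0 0 0 0 = su (mult (x 0 0) (x 0 0)) 0 0 0 0" by simp
  then have "mult (x 0 0) (x 0 0) = a" by (simp add: su_apply)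
  with sx show ?thesis by (rule that)
qed

text \<open>With \<open>x\<close> the square of a self-adjoint \<open>d\<close>, the conjugate is
  \<open>mult (star c) c\<close> for \<open>c = mult d b\<close>.\<close>

lemma conjugate_P: "x \<in> P \<Longrightarrow> mult (mult (star b) x) b \<in> P"
proof -
  assume "x \<in> P"
  then obtain d where d: "star d = d" "mult d d = x" by (rule P_sqrt)
  have "mult (mult (star b) x) b = mult (star (mult d b)) (mult d b)"
    by (simp add: star_mult d(1) mult_assoc d(2)[symmetric])
  then show ?thesis using square_P by simp
qed

text \<open>The usual off-diagonal embedding of \<open>a\<close> as a self-adjoint matrix of size 2,
  where the JB-norm is available.\<close>

definition norm_e :: "'e \<Rightarrow> real" where "norm_e a = N (hm a 0 1)"

lemma norm_e_nonneg [simp]: "0 \<le> norm_e a"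
  by (simp add: norm_e_def)

text \<open>The square of the off-diagonal matrix is diagonal with entries
  \<open>mult a (star a)\<close> and \<open>mult (star a) a\<close>, so \<open>N_square\<close> and
  \<open>N_le_iff\<close> translate the bound into two order relations in \<open>P\<close>.\<close>

lemma norm_e_le_iff:
  assumes r: "0 \<le> r"
  shows "norm_e a \<le> r \<longleftrightarrow> rscale (r\<^sup>2) e - mult a (star a) \<in> P \<and> rscale (r\<^sup>2) e - mult (star a) a \<in> P"
proof -
  let ?h = "hm a 0 1"
  let ?s = "jp ?h ?h"
  have s: "?s \<in> pos 2" by (rule J.square_in_C) simp
  have "mscale (r\<^sup>2) (diag_mat e 2) + ?s \<in> pos 2"
    using J.ord.unit_pos s by (intro J.ord.cone_add J.ord.cone_scale) simp_all
  moreover have "norm_e a \<le> r \<longleftrightarrow> N ?s \<le> r\<^sup>2"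
    using r by (simp add: norm_e_def J.N_square power_mono_iff)
  moreover have "N ?s \<le> r\<^sup>2 \<longleftrightarrow> mscale (r\<^sup>2) (diag_mat e 2) - ?s \<in> pos 2 \<and> mscale (r\<^sup>2) (diag_mat e 2) + ?s \<in> pos 2"
    by (rule J.N_le_iff) simp_all
  moreover have "mscale (r\<^sup>2) (diag_mat e 2) - ?s =
      su (rscale (r\<^sup>2) e - mult a (star a)) 0 0 + su (rscale (r\<^sup>2) e - mult (star a) a) 1 1"
    unfolding unit_su jp_hm_square su_linear mscale_add by simp
  ultimately show ?thesis
    using diag_pos_iff[of "rscale (r\<^sup>2) e - mult a (star a)" "rscale (r\<^sup>2) e - mult (star a) a"]
    by (simp add: star_diff star_rscale star_mult star_star)
qed

text \<open>The diagonal and the off-diagonal matrix of \<open>b\<close> have norms governed by the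
  same condition \<open>rscale (r\<^sup>2) e - mult b b \<in> P\<close>; the level 1 order norm
  applies to the former.\<close>

lemma norm_e_sa_le_iff:
  assumes b: "star b = b" and r: "0 \<le> r"
  shows "norm_e b \<le> r \<longleftrightarrow> rscale r e - b \<in> P \<and> rscale r e + b \<in> P"
proof -
  have level1: "N (su c 0 0) \<le> s \<longleftrightarrow> rscale s e - c \<in> P \<and> rscale s e + c \<in> P"
    if "star c = c" "0 \<le> s" for c s
    using L.J.N_le_iff[of "su c 0 0" s] that by (simp add: unit_su P_def su_linear)
  have bb: "mult b b \<in> P" using square_P[of b] b by simp
  have "N (su b 0 0) \<le> r \<longleftrightarrow> N (su (mult b b) 0 0) \<le> r\<^sup>2"
    using r b J.N_square[of "su b 0 0"] by (simp add: jp_su_square power_mono_iff)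
  also have "\<dots> \<longleftrightarrow> rscale (r\<^sup>2) e - mult b b \<in> P"
    using level1[of "mult b b" "r\<^sup>2"] bb P_e[of "r\<^sup>2"] P_add b by (simp add: star_mult)
  also have "\<dots> \<longleftrightarrow> norm_e b \<le> r"
    using norm_e_le_iff[OF r, of b] b by simp
  finally show ?thesis using level1[OF b r] by simp
qed

lemma norm_e_star: "norm_e (star a) = norm_e a"
  by (rule real_eq_of_upper_bounds) (auto simp: norm_e_le_iff star_star)

lemma norm_e_self: "rscale ((norm_e a)\<^sup>2) e - mult a (star a) \<in> P" "rscale ((norm_e a)\<^sup>2) e - mult (star a) a \<in> P"
  using norm_e_le_iff[of "norm_e a" a] by simp_all

lemma norm_e_P: "a \<in> P \<Longrightarrow> rscale (norm_e a) e - a \<in> P"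
  using norm_e_sa_le_iff[of a "norm_e a"] P_sa by simp

lemma norm_e_P_le: "a \<in> P \<Longrightarrow> 0 \<le> r \<Longrightarrow> rscale r e - a \<in> P \<Longrightarrow> norm_e a \<le> r"
  using norm_e_sa_le_iff[of a r] P_sa P_add P_e by simp

lemma mult_diff: "mult a (b - c) = mult a b - mult a c" "mult (a - b) c = mult a c - mult b c"
  using mult_add_right[of a "b - c" c] mult_add_left[of "a - b" b c] by simp_all

text \<open>With A and B the two norms and \<open>c = mult a b\<close>, the gap
  \<open>A\<^sup>2 B\<^sup>2 - c (star c)\<close> is the sum of
  \<open>a (B\<^sup>2 - b (star b)) (star a)\<close> and
  \<open>B\<^sup>2 (A\<^sup>2 - a (star a))\<close>, both positive. The second bound is the mirror
  image.\<close>

lemma norm_e_mult: "norm_e (mult a b) \<le> norm_e a * norm_e b"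
proof -
  let ?A = "norm_e a" and ?B = "norm_e b"
  have "mult (mult a (rscale (?B\<^sup>2) e - mult b (star b))) (star a) \<in> P"
    using conjugate_P[OF norm_e_self(1)[of b], of "star a"] by (simp add: star_star)
  then have "mult (mult a (rscale (?B\<^sup>2) e - mult b (star b))) (star a)
      + rscale (?B\<^sup>2) (rscale (?A\<^sup>2) e - mult a (star a)) \<in> P"
    using norm_e_self(1)[of a] by (intro P_add P_rscale) auto
  then have 1: "rscale ((?A * ?B)\<^sup>2) e - mult (mult a b) (star (mult a b)) \<in> P"
    by (simp add: mult_diff mult_scale_right mult_scale_left star_mult mult_assoc scale_right_diff_distrib
        power_mult_distrib mult.commute)
  have "mult (mult (star b) (rscale (?A\<^sup>2) e - mult (star a) a)) b
      + rscale (?A\<^sup>2) (rscale (?B\<^sup>2) e - mult (star b) b) \<in> P"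
    using norm_e_self(2)[of b] conjugate_P[OF norm_e_self(2)[of a], of b] by (intro P_add P_rscale) auto
  then have 2: "rscale ((?A * ?B)\<^sup>2) e - mult (star (mult a b)) (mult a b) \<in> P"
    by (simp add: mult_diff mult_scale_right mult_scale_left star_mult mult_assoc scale_right_diff_distrib
        power_mult_distrib mult.commute)
  show ?thesis using 1 2 by (subst norm_e_le_iff) simp_all
qed

lemma norm_e_sa_square: "star b = b \<Longrightarrow> norm_e (mult b b) = (norm_e b)\<^sup>2"
proof -
  assume b: "star b = b"
  have bb: "mult b b \<in> P" using square_P[of b] b by simp
  have "norm_e (mult b b) \<le> (norm_e b)\<^sup>2"
    using norm_e_self[of b] b bb by (intro norm_e_P_le) simp_all
  moreover have "norm_e b \<le> sqrt (norm_e (mult b b))"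
    using norm_e_P[OF bb] b by (subst norm_e_le_iff) simp_all
  then have "(norm_e b)\<^sup>2 \<le> norm_e (mult b b)"
    using power_mono[of "norm_e b" "sqrt (norm_e (mult b b))" 2] by simp
  ultimately show ?thesis by simp
qed

text \<open>The norm identity for off-diagonal matrices only gives \<open>N a\<^sup>2 = max (N (a a\<^sup>*)) (N (a\<^sup>* a))\<close>.\<close>

lemma norm_e_cstar: "norm_e (mult (star a) a) = (norm_e a)\<^sup>2"
proof -
  define \<alpha> \<beta> A where "\<alpha> = norm_e (mult a (star a))" and "\<beta> = norm_e (mult (star a) a)" and "A = norm_e a"
  have nonneg: "0 \<le> \<alpha>" "0 \<le> \<beta>" "0 \<le> A" by (simp_all add: \<alpha>_def \<beta>_def A_def)
  have le: "\<beta> \<le> A\<^sup>2"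
    using norm_e_mult[of "star a" a] by (simp add: \<beta>_def A_def norm_e_star power2_eq_square)
  have max_bound: "A\<^sup>2 \<le> max \<alpha> \<beta>"
  proof -
    have "rscale (max \<alpha> \<beta>) e - c \<in> P" if "c \<in> P" "norm_e c \<le> max \<alpha> \<beta>" for c
    proof -
      have "rscale (max \<alpha> \<beta> - norm_e c) e + (rscale (norm_e c) e - c) \<in> P"
        using that norm_e_P by (intro P_add P_e) auto
      then show ?thesis by (simp add: scale_left_diff_distrib)
    qed
    then have "A \<le> sqrt (max \<alpha> \<beta>)"
      unfolding A_def using nonneg square_P[of a]
      by (subst norm_e_le_iff) (simp_all add: \<alpha>_def \<beta>_def le_max_iff_disj)
    then show ?thesis using power_mono[of A "sqrt (max \<alpha> \<beta>)" 2] nonneg by (simp add: le_max_iff_disj)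
  qed
  have "\<alpha> \<le> \<beta>"
  proof (rule ccontr)
    \<comment> \<open>The square of \<open>mult a (star a)\<close> contains
      \<open>mult (star a) a\<close> as its middle part, which gives \<alpha>^2 \<le> A^2 \<beta>.
      If \<alpha> were the larger of the two, then A^2 \<le> \<alpha>, and cancelling \<alpha> would
      give \<alpha> \<le> \<beta>.\<close>
    assume *: "\<not> \<alpha> \<le> \<beta>"
    have "\<alpha>\<^sup>2 = norm_e (mult (mult a (mult (star a) a)) (star a))"
      unfolding \<alpha>_def by (subst norm_e_sa_square[symmetric]) (simp_all add: star_mult star_star mult_assoc)
    also have "\<dots> \<le> norm_e (mult a (mult (star a) a)) * norm_e (star a)" by (rule norm_e_mult)
    also have "\<dots> \<le> (A * \<beta>) * A"
      unfolding norm_e_star A_def[symmetric] \<beta>_def using nonneg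
      by (intro mult_right_mono) (simp_all add: norm_e_mult A_def)
    also have "\<dots> = A\<^sup>2 * \<beta>" by (simp add: power2_eq_square)
    also have "\<dots> \<le> \<alpha> * \<beta>" using max_bound * nonneg by (intro mult_right_mono) auto
    finally have "\<alpha> * \<alpha> \<le> \<alpha> * \<beta>" by (simp add: power2_eq_square)
    then show False using * nonneg by simp
  qed
  then show ?thesis using le max_bound by (simp add: \<beta>_def A_def)
qed

lemma norm_e_scale: "norm_e (scale c a) = norm c * norm_e a"
proof (cases "c = 0")
  case True
  have "N 0 = 0" by simp
  then show ?thesis using True by (simp add: norm_e_def hm_linear)
next
  case False
  have eq: "mult (scale c a) (star (scale c a)) = rscale ((norm c)\<^sup>2) (mult a (star a))"
    "mult (star (scale c a)) (scale c a) = rscale ((norm c)\<^sup>2) (mult (star a) a)"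
    by (simp_all only: star_scale mult_scale_left mult_scale_right scale_scale kconj_norm mult.commute[of c])
  show ?thesis
  proof (rule real_eq_of_upper_bounds)
    fix r :: real assume r: "0 \<le> r"
    have P_iff: "rscale (r\<^sup>2) e - rscale ((norm c)\<^sup>2) x \<in> P \<longleftrightarrow> rscale ((r / norm c)\<^sup>2) e - x \<in> P" for x
    proof -
      have "rscale ((norm c)\<^sup>2) (rscale ((r / norm c)\<^sup>2) e - x) = rscale (r\<^sup>2) e - rscale ((norm c)\<^sup>2) x"
        "rscale (1 / (norm c)\<^sup>2) (rscale (r\<^sup>2) e - rscale ((norm c)\<^sup>2) x) = rscale ((r / norm c)\<^sup>2) e - x"
        using False by (simp_all add: scale_right_diff_distrib power_divide flip: of_real_mult of_real_power)
      then show ?thesis using P_rscale[of "(norm c)\<^sup>2" "rscale ((r / norm c)\<^sup>2) e - x"]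
        P_rscale[of "1 / (norm c)\<^sup>2" "rscale (r\<^sup>2) e - rscale ((norm c)\<^sup>2) x"] by auto
    qed
    have "norm_e (scale c a) \<le> r \<longleftrightarrow> norm_e a \<le> r / norm c"
      using r by (simp add: norm_e_le_iff eq P_iff)
    then show "norm_e (scale c a) \<le> r \<longleftrightarrow> norm c * norm_e a \<le> r"
      using False by (simp add: pos_le_divide_eq mult.commute)
  qed simp_all
qed

lemma norm_e_norm_on: "norm_on scale UNIV norm_e"
  unfolding norm_on_def
proof (intro conjI ballI allI)
  fix x y c
  show "norm_e x = 0 \<longleftrightarrow> x = 0"
    using J.N_eq_0[of "hm x 0 1"] hm_eqD[of 0 1 x 0] by (auto simp: norm_e_def hm_linear)
  show "norm_e (x + y) \<le> norm_e x + norm_e y"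
    unfolding norm_e_def hm_linear by (intro J.N_triangle) simp_all
qed (simp_all add: norm_e_scale)

text \<open>The operator system norm asks for one sign of the off-diagonal matrix only,
  \<open>N_le_iff\<close> for both. Conjugation by the diagonal matrix with entries 1 and -1
  exchanges the signs. Completeness of the C*-norm follows from this equality.\<close>

lemma opsys_norm_eq: "opsys_norm scale star pos e = norm_e"
proof (rule ext)
  fix x
  let ?M = "\<lambda>r. mat 2 (\<lambda>i j. if i = j then rscale r e else if i < j then x else star x)"
  have M: "?M r = mscale r (diag_mat e 2) + hm x 0 1" for r
    by (auto simp: mat_def diag_mat_def hm_apply fun_eq_iff less_2_cases_iff)
  define c :: "nat \<Rightarrow> 'k" where "c i = (if i = 0 then 1 else -1)" for i
  have flip: "mscale r (diag_mat e 2) - hm x 0 1 \<in> pos 2" if "mscale r (diag_mat e 2) + hm x 0 1 \<in> pos 2" for r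
  proof -
    have "monomial 2 c id (mscale r (diag_mat e 2) + hm x 0 1) \<in> pos 2"
      using that by (intro monomial_facts) simp_all
    also have "monomial 2 c id (mscale r (diag_mat e 2) + hm x 0 1) = mscale r (diag_mat e 2) - hm x 0 1"
      by (auto simp: monomial_def mat_def diag_mat_def hm_apply fun_eq_iff less_2_cases_iff c_def
          kconj_simps kconj_minus)
    finally show ?thesis .
  qed
  have "{r. 0 \<le> r \<and> ?M r \<in> pos 2} = {norm_e x..}"
    using J.N_le_iff[of "hm x 0 1"] flip order_trans[OF norm_e_nonneg[of x]]
    unfolding M by (auto simp: norm_e_def)
  then show "opsys_norm scale star pos e x = norm_e x"
    unfolding opsys_norm_def by simp
qed

lemma cstar_algebra:
  assumes "complete_on UNIV (opsys_norm scale star pos e)"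
  shows "unital_cstar_algebra scale kconj mult e star norm_e"
  using assms unfolding opsys_norm_eq
  by unfold_locales (simp_all add: mult_assoc mult_add_left mult_add_right mult_scale_left mult_scale_right
      star_add star_scale star_star star_mult norm_e_norm_on norm_e_mult norm_e_cstar)

lemma norm_e_sum: "norm_e (mult (star a) a) \<le> norm_e (mult (star a) a + mult (star b) b)"
proof (rule norm_e_P_le)
  let ?s = "mult (star a) a + mult (star b) b"
  have "(rscale (norm_e ?s) e - ?s) + mult (star b) b \<in> P"
    by (intro P_add norm_e_P square_P)
  then show "rscale (norm_e ?s) e - mult (star a) a \<in> P" by simp
qed (simp_all add: square_P)

end

section \<open>Comparison of the levels\<close>

lemma (in star_system) compatible_jb_level:
  assumes "1 \<le> m" "compatible_jb (mat_rscale scale) (sa_mats star m) (pos m) (diag_mat e m) jp"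
  shows "\<exists>N. jb_level scale kconj star pos e m jp N"
proof -
  obtain N where "ordered_jb_algebra (mat_rscale scale) (sa m) jp (diag_mat e m) N (pos m)"
    using compatible_jb_ordered[OF order_unit_level] assms by metis
  then interpret J: ordered_jb_algebra "mat_rscale scale" "sa m" jp "diag_mat e m" N "pos m" .
  have "jb_level scale kconj star pos e m jp N" by unfold_locales (rule assms(1))
  then show ?thesis by blast
qed

lemma (in star_system) jb_levels_downward:
  assumes "1 \<le> m" "m < n" "n \<in> jb_levels scale star pos e"
  shows "m \<in> jb_levels scale star pos e"
proof -
  obtain jp N where "jb_level scale kconj star pos e n jp N"
    using assms compatible_jb_level unfolding jb_levels_def by blast
  then interpret jb_level scale kconj star pos e n jp N .
  interpret L: jb_level scale kconj star pos e m jp N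
    using assms by (intro lower_level) simp_all
  show ?thesis using assms(1) L.J.compatible unfolding jb_levels_def by blast
qed

context jb_product
begin

lemma jp_lower_eq_mj:
  assumes m: "1 \<le> m" "m \<le> n"
    and jp': "compatible_jb (mat_rscale scale) (sa_mats star m) (pos m) (diag_mat e m) jp'"
    and xy: "x \<in> sa m" "y \<in> sa m"
  shows "jp' x y = mj m x y"
proof -
  interpret L: jb_level scale kconj star pos e m jp N by (rule lower_level[OF m])
  have "jp' x y = jp x y"
    by (rule compatible_jb_unique[OF order_unit_level[OF m(1)] jp' L.J.compatible xy])
  also have "\<dots> = mj n x y" using xy sa_mono[OF m(2)] by (intro jp_eq_mj) auto
  also have "\<dots> = mj m x y" using xy m by (intro mj_restrict)
  finally show ?thesis .
qed

lemma jb_star_algebra: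
  assumes "\<And>c. kconj c * c = of_real ((norm c)\<^sup>2)"
  shows "jb_star_algebra scale kconj star pos e jp N mult"
proof -
  interpret L: jb_level scale kconj star pos e 2 jp N using n2 by (intro lower_level) simp_all
  show ?thesis
    by unfold_locales (use jp_lower_eq_mj[OF _ n2 L.J.compatible] assms in simp_all)
qed

end

section \<open>The theorem\<close>

lemma jb_algebra_cong:
  assumes "jb_algebra scale V jp" and eq: "\<And>x y. x \<in> V \<Longrightarrow> y \<in> V \<Longrightarrow> jp x y = jp' x y"
  shows "jb_algebra scale V jp'"
proof -
  interpret real_jordan_algebra scale V jp using assms(1) by (simp add: jb_algebra_def)
  have "real_jordan_algebra scale V jp'"
    by unfold_locales (simp_all add: subspace_V eq[symmetric] jp_bilinear jordan_identity jp_commute)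
  moreover have "jp' x y = jp x y" if "x \<in> V" "y \<in> V" for x y using eq that by simp
  ultimately show ?thesis using assms(1) unfolding jb_algebra_def by auto
qed

lemma jb_iso_identity:
  assumes "compatible_jb scale V C v jp" and eq: "\<And>x y. x \<in> V \<Longrightarrow> y \<in> V \<Longrightarrow> jp x y = jp' x y"
  shows "jb_iso scale V jp' scale V jp id"
  using assms jb_algebra_cong[OF _ eq] by (auto simp: jb_iso_def compatible_jb_def)

text \<open>Levels up to \<open>n\<close> follow by restriction. A level above \<open>n\<close>
  could a priori yield another multiplication \<open>mult'\<close>, but by uniqueness both describe
  the Jordan product of level \<open>n\<close>, and its value on \<open>hm a 0 1\<close> and
  \<open>hm b 1 2\<close> determines the multiplication.\<close>

lemma real_levels:
  fixes scale :: "real \<Rightarrow> 'e::ab_group_add \<Rightarrow> 'e"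
  assumes sys: "complete_operator_system scale (\<lambda>c. c) star pos e"
    and n: "n \<in> jb_levels scale star pos e" "4 \<le> n"
  shows "\<exists>mult N. unital_real_cstar_algebra scale mult e star N \<and>
    (\<forall>m\<ge>1. \<forall>jp. compatible_jb (mat_rscale scale) (sa_mats star m) (pos m) (diag_mat e m) jp \<longrightarrow>
      (\<forall>x\<in>sa_mats star m. \<forall>y\<in>sa_mats star m. jp x y = mat_jordan scale mult m x y))"
proof -
  interpret operator_system scale "\<lambda>c. c" star pos e
    using sys by (simp add: complete_operator_system_def)
  interpret star_system scale "\<lambda>c. c" star pos e by unfold_locales simp_all
  have product: "\<exists>N mult. jb_product scale (\<lambda>c. c) star pos e m jp N mult"
    if level: "4 \<le> m" "compatible_jb (mat_rscale scale) (sa_mats star m) (pos m) (diag_mat e m) jp" for m jp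
  proof -
    obtain N where "jb_level scale (\<lambda>c. c) star pos e m jp N"
      using compatible_jb_level[of m jp] level by auto
    then interpret real_jb_level scale star pos e m jp N
      using level by (simp add: real_jb_level_def real_jb_level_axioms_def)
    show ?thesis using jb_product by blast
  qed
  obtain jp N mult where "jb_product scale (\<lambda>c. c) star pos e n jp N mult"
    using product n unfolding jb_levels_def by blast
  then interpret A: jb_product scale "\<lambda>c. c" star pos e n jp N mult .
  interpret B: jb_star_algebra scale "\<lambda>c. c" star pos e jp N mult
    by (rule A.jb_star_algebra) (simp add: power2_eq_square)
  have "unital_cstar_algebra scale (\<lambda>c. c) mult e star B.norm_e"
    using sys by (intro B.cstar_algebra) (simp add: complete_operator_system_def)
  then have cstar: "unital_real_cstar_algebra scale mult e star B.norm_e"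
    using B.norm_e_sum by (simp add: unital_real_cstar_algebra_def unital_real_cstar_algebra_axioms_def)
  have "jp' x y = mat_jordan scale mult m x y"
    if m: "1 \<le> m" and c: "compatible_jb (mat_rscale scale) (sa m) (pos m) (diag_mat e m) jp'"
      and xy: "x \<in> sa m" "y \<in> sa m" for m jp' x y
  proof (cases "m \<le> n")
    case True
    then show ?thesis using A.jp_lower_eq_mj[OF m True c xy] by simp
  next
    case False
    obtain N' mult' where "jb_product scale (\<lambda>c. c) star pos e m jp' N' mult'"
      using product[OF _ c] False n by auto
    then interpret A': jb_product scale "\<lambda>c. c" star pos e m jp' N' mult' .
    have "mult a b = mult' a b" for a b
    proof -
      have "mat_jordan scale mult n (hm a 0 1) (hm b 1 2) = mat_jordan scale mult' n (hm a 0 1) (hm b 1 2)"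
        using A.jp_eq_mj[of "hm a 0 1" "hm b 1 2"] A'.jp_lower_eq_mj[OF A.n_pos _ A.J.compatible] False n
        by simp
      then have "hm (mult a b) 0 2 = hm (mult' a b) 0 2"
        using n by (simp add: A.mj_hm A'.mj_hm)
      then show ?thesis by (rule A.hm_eqD[rotated]) simp
    qed
    then have "mult = mult'" by (intro ext)
    then show ?thesis using A'.jp_eq_mj xy by simp
  qed
  with cstar show ?thesis by blast
qed

lemma complex_levels:
  fixes scale :: "complex \<Rightarrow> 'e::ab_group_add \<Rightarrow> 'e"
  assumes sys: "complete_operator_system scale cnj star pos e"
    and n: "n \<in> jb_levels scale star pos e" "2 \<le> n"
  shows "\<exists>mult N. unital_cstar_algebra scale cnj mult e star N \<and>
    (\<forall>m\<ge>1. \<forall>jp. compatible_jb (mat_rscale scale) (sa_mats star m) (pos m) (diag_mat e m) jp \<longrightarrow>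
      (\<forall>x\<in>sa_mats star m. \<forall>y\<in>sa_mats star m. jp x y = mat_jordan scale mult m x y))"
proof -
  interpret operator_system scale cnj star pos e
    using sys by (simp add: complete_operator_system_def)
  interpret star_system scale cnj star pos e by unfold_locales simp_all
  have level: "\<exists>N. complex_jb_level scale star pos e m jp N"
    if level: "2 \<le> m" "compatible_jb (mat_rscale scale) (sa_mats star m) (pos m) (diag_mat e m) jp" for m jp
  proof -
    obtain N where "jb_level scale cnj star pos e m jp N"
      using compatible_jb_level[of m jp] level by auto
    then show ?thesis using level by (auto simp: complex_jb_level_def complex_jb_level_axioms_def)
  qed
  obtain jp N where "complex_jb_level scale star pos e n jp N"
    using level n unfolding jb_levels_def by blast
  then interpret X: complex_jb_level scale star pos e n jp N .
  interpret A: jb_product scale cnj star pos e n jp N X.cmult by (rule X.jb_product)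
  interpret B: jb_star_algebra scale cnj star pos e jp N X.cmult
    by (rule A.jb_star_algebra) (simp add: complex_norm_square mult.commute)
  have cstar: "unital_cstar_algebra scale cnj X.cmult e star B.norm_e"
    using sys by (intro B.cstar_algebra) (simp add: complete_operator_system_def)
  have "jp' x y = mat_jordan scale X.cmult m x y"
    if m: "1 \<le> m" and c: "compatible_jb (mat_rscale scale) (sa m) (pos m) (diag_mat e m) jp'"
      and xy: "x \<in> sa m" "y \<in> sa m" for m jp' x y
  proof (cases "m \<le> n")
    case True
    then show ?thesis using A.jp_lower_eq_mj[OF m True c xy] by simp
  next
    case False
    obtain N' where "complex_jb_level scale star pos e m jp' N'"
      using level[OF _ c] False n by auto
    then interpret X': complex_jb_level scale star pos e m jp' N' .
    interpret A': jb_product scale cnj star pos e m jp' N' X'.cmult by (rule X'.jb_product)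
    \<comment> \<open>Only two indices are guaranteed here, so the multiplication is recovered from
      a diagonal left factor, hence first for self-adjoint \<open>a\<close>; complex linearity does
      the rest.\<close>
    have sa: "X.cmult a b = X'.cmult a b" if "star a = a" for a b
    proof -
      have "mat_jordan scale X.cmult n (hm a 0 0) (hm b 0 1) = mat_jordan scale X'.cmult n (hm a 0 0) (hm b 0 1)"
        using A.jp_eq_mj[of "hm a 0 0" "hm b 0 1"] A'.jp_lower_eq_mj[OF X.n_pos _ X.J.compatible] False n
        by simp
      then have "mat_rscale scale (1/2) (hm (X.cmult a b) 0 1 + hm (X.cmult a b) 0 1) =
          mat_rscale scale (1/2) (hm (X'.cmult a b) 0 1 + hm (X'.cmult a b) 0 1)"
        using n that by (simp add: A.mj_hm A'.mj_hm)
      then have "hm (X.cmult a b) 0 1 = hm (X'.cmult a b) 0 1"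
        by (simp only: X.J.scale_right_distrib X.J.scale_half)
      then show ?thesis by (rule X.hm_eqD[rotated]) simp
    qed
    have "X.cmult a b = X'.cmult a b" for a b
    proof -
      have "X.cmult (X.re a + scale \<i> (X.im a)) b = X'.cmult (X.re a + scale \<i> (X.im a)) b"
        by (simp add: X.cmult_add X'.cmult_add X.cmult_i X'.cmult_i sa)
      then show ?thesis by (simp flip: X.re_im)
    qed
    then have "X.cmult = X'.cmult" by (intro ext)
    then show ?thesis using A'.jp_eq_mj xy by simp
  qed
  with cstar show ?thesis by blast
qed

lemma (in star_system) identity_isomorphism:
  assumes "\<forall>m\<ge>1. \<forall>jp. compatible_jb (mat_rscale scale) (sa_mats star m) (pos m) (diag_mat e m) jp \<longrightarrow>
      (\<forall>x\<in>sa_mats star m. \<forall>y\<in>sa_mats star m. jp x y = mat_jordan scale mult m x y)"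
  shows "unital_star_iso scale e star scale e star id \<and>
    (\<forall>m\<in>jb_levels scale star pos e. \<forall>jp.
      compatible_jb (mat_rscale scale) (sa_mats star m) (pos m) (diag_mat e m) jp \<longrightarrow>
      jb_iso (mat_rscale scale) (sa_mats star m) (mat_jordan scale mult m)
        (mat_rscale scale) (sa_mats star m) jp (mat_map id))"
proof
  have map_id: "mat_map id = (id :: 'e matrix \<Rightarrow> 'e matrix)" by (simp add: mat_map_def fun_eq_iff)
  show "unital_star_iso scale e star scale e star id"
    using linear_id by (simp add: unital_star_iso_def)
  show "\<forall>m\<in>jb_levels scale star pos e. \<forall>jp.
      compatible_jb (mat_rscale scale) (sa_mats star m) (pos m) (diag_mat e m) jp \<longrightarrow>
      jb_iso (mat_rscale scale) (sa_mats star m) (mat_jordan scale mult m)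
        (mat_rscale scale) (sa_mats star m) jp (mat_map id)"
    using assms unfolding map_id jb_levels_def by (auto intro!: jb_iso_identity)
qed

theorem theorem4p1:
  shows
    "(\<forall>(scale :: real \<Rightarrow> 'e::ab_group_add \<Rightarrow> 'e) star pos e S.
        complete_operator_system scale (\<lambda>c. c) star pos e \<longrightarrow>
        S = jb_levels scale star pos e \<longrightarrow>
        (\<forall>m n. 1 \<le> m \<and> m < n \<and> n \<in> S \<longrightarrow> m \<in> S) \<and>
        ((\<exists>n\<in>S. 4 \<le> n) \<longrightarrow>
          (\<exists>(scaleA :: real \<Rightarrow> 'e \<Rightarrow> 'e) multA oneA starA NA (\<phi> :: 'e \<Rightarrow> 'e).
             unital_real_cstar_algebra scaleA multA oneA starA NA \<and>
             unital_star_iso scaleA oneA starA scale e star \<phi> \<and>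
             (\<forall>m\<in>S. \<forall>jp.
                compatible_jb (mat_rscale scale) (sa_mats star m) (pos m) (diag_mat e m) jp \<longrightarrow>
                jb_iso (mat_rscale scaleA) (sa_mats starA m) (mat_jordan scaleA multA m)
                       (mat_rscale scale) (sa_mats star m) jp (mat_map \<phi>)))))
     \<and>
     (\<forall>(scale :: complex \<Rightarrow> 'e::ab_group_add \<Rightarrow> 'e) star pos e S.
        complete_operator_system scale cnj star pos e \<longrightarrow>
        S = jb_levels scale star pos e \<longrightarrow>
        (\<forall>m n. 1 \<le> m \<and> m < n \<and> n \<in> S \<longrightarrow> m \<in> S) \<and>
        ((\<exists>n\<in>S. 2 \<le> n) \<longrightarrow>
          (\<exists>(scaleA :: complex \<Rightarrow> 'e \<Rightarrow> 'e) multA oneA starA NA (\<phi> :: 'e \<Rightarrow> 'e).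
             unital_cstar_algebra scaleA cnj multA oneA starA NA \<and>
             unital_star_iso scaleA oneA starA scale e star \<phi> \<and>
             (\<forall>m\<in>S. \<forall>jp.
                compatible_jb (mat_rscale scale) (sa_mats star m) (pos m) (diag_mat e m) jp \<longrightarrow>
                jb_iso (mat_rscale scaleA) (sa_mats starA m) (mat_jordan scaleA multA m)
                       (mat_rscale scale) (sa_mats star m) jp (mat_map \<phi>)))))"
proof (intro conjI allI impI)
  fix scale :: "real \<Rightarrow> 'e \<Rightarrow> 'e" and star pos e S
  assume sys: "complete_operator_system scale (\<lambda>c. c) star pos e" and S: "S = jb_levels scale star pos e"
  then interpret operator_system scale "(\<lambda>c. c)" star pos e by (simp add: complete_operator_system_def)
  interpret star_system scale "(\<lambda>c. c)" star pos e by unfold_locales simp_all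
  show "m \<in> S" if "1 \<le> m \<and> m < n \<and> n \<in> S" for m n
    using jb_levels_downward that S by blast
  assume "\<exists>n\<in>S. 4 \<le> n"
  then obtain mult N where cstar: "unital_real_cstar_algebra scale mult e star N"
    and eq: "\<forall>m\<ge>1. \<forall>jp. compatible_jb (mat_rscale scale) (sa_mats star m) (pos m) (diag_mat e m) jp \<longrightarrow>
      (\<forall>x\<in>sa_mats star m. \<forall>y\<in>sa_mats star m. jp x y = mat_jordan scale mult m x y)"
    using real_levels[OF sys] S by blast
  show "\<exists>(scaleA :: real \<Rightarrow> 'e \<Rightarrow> 'e) multA oneA starA NA (\<phi> :: 'e \<Rightarrow> 'e).
             unital_real_cstar_algebra scaleA multA oneA starA NA \<and>
             unital_star_iso scaleA oneA starA scale e star \<phi> \<and>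
             (\<forall>m\<in>S. \<forall>jp.
                compatible_jb (mat_rscale scale) (sa_mats star m) (pos m) (diag_mat e m) jp \<longrightarrow>
                jb_iso (mat_rscale scaleA) (sa_mats starA m) (mat_jordan scaleA multA m)
                       (mat_rscale scale) (sa_mats star m) jp (mat_map \<phi>))"
    using cstar identity_isomorphism[OF eq] unfolding S by blast
next
  fix scale :: "complex \<Rightarrow> 'e \<Rightarrow> 'e" and star pos e S
  assume sys: "complete_operator_system scale cnj star pos e" and S: "S = jb_levels scale star pos e"
  then interpret operator_system scale "cnj" star pos e by (simp add: complete_operator_system_def)
  interpret star_system scale "cnj" star pos e by unfold_locales simp_all
  show "m \<in> S" if "1 \<le> m \<and> m < n \<and> n \<in> S" for m n
    using jb_levels_downward that S by blast
  assume "\<exists>n\<in>S. 2 \<le> n"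
  then obtain mult N where cstar: "unital_cstar_algebra scale cnj mult e star N"
    and eq: "\<forall>m\<ge>1. \<forall>jp. compatible_jb (mat_rscale scale) (sa_mats star m) (pos m) (diag_mat e m) jp \<longrightarrow>
      (\<forall>x\<in>sa_mats star m. \<forall>y\<in>sa_mats star m. jp x y = mat_jordan scale mult m x y)"
    using complex_levels[OF sys] S by blast
  show "\<exists>(scaleA :: complex \<Rightarrow> 'e \<Rightarrow> 'e) multA oneA starA NA (\<phi> :: 'e \<Rightarrow> 'e).
             unital_cstar_algebra scaleA cnj multA oneA starA NA \<and>
             unital_star_iso scaleA oneA starA scale e star \<phi> \<and>
             (\<forall>m\<in>S. \<forall>jp.
                compatible_jb (mat_rscale scale) (sa_mats star m) (pos m) (diag_mat e m) jp \<longrightarrow>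
                jb_iso (mat_rscale scaleA) (sa_mats starA m) (mat_jordan scaleA multA m)
                       (mat_rscale scale) (sa_mats star m) jp (mat_map \<phi>))"
    using cstar identity_isomorphism[OF eq] unfolding S by blast
qed

end
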